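(* Let $(\mathcal E,\mathcal F)$ be a symmetric local regular Dirichlet form on $L_2(X,\mu)$, and let the functions $f_n$ and the measure $\widetilde m$ be as constructed in the context. Then $\{f_n\}_{n\in\mathbb N}$ is a set of continuous coordinates for $\mathcal E$ with respect to $\widetilde m$.
   Context: $X$ is a locally compact separable metric space, $\mu$ a nonnegative Radon measure on $X$ with $\mu(U)>0$ for every nonempty open $U$ (an admissible reference measure). $\mathcal E(f)=\mathcal E(f,f)$, $\mathcal E_1(f)=\mathcal E(f)+\|f\|_{L_2(X,\mu)}^2$. $C_0(X)$ is the space of continuous compactly supported functions, $\mathcal C:=C_0(X)\cap\mathcal F$. Energy measures: for $g,h\in\mathcal C$, $\Gamma(g,h)$ is the unique finite signed Radon measure with $2\int_X f\,d\Gamma(g,h)=\mathcal E(fg,h)+\mathcal E(fh,g)-\mathcal E(gh,f)$ for all $f\in\mathcal C$; $\Gamma(g):=\Gamma(g,g)\ge0$. Capacity: for open $A\subset X$, $\mathrm{Cap}(A):=\inf\{\mathcal E_1(u): u\in\mathcal F,\ u\ge1\ \mu\text{-a.e. on }A\}$ (infinity if there is no such $u$), and for arbitrary $A\subset X$, $\mathrm{Cap}(A):=\inf\{\mathrm{Cap}(B): B\supset A,\ B\text{ open}\}$. Construction: let $\{e_n\}_n$ be a countable dense subset of $(\mathcal F,\mathcal E_1)$ and, for each $n$, let $(\varphi_{n,k})_k\subset\mathcal C$ satisfy $\mathcal E_1(e_n-\varphi_{n,k})^{1/2}\le2^{-k}$ for all $k$. Let $\{\psi_n\}_n$ be an enumeration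 of the countable $\mathcal E_1$-dense family $\{\varphi_{n,k}\}_{k,n}$, where each $\psi_n$ may be assumed to have positive energy, and set $f_n:=\psi_n/\Gamma(\psi_n)(X)^{1/2}$. Let $(U_n)_n$ be an exhaustion of $X$ by nonempty relatively compact open sets with $\overline{U_n}\subset U_{n+1}$, where $\mu(U_{n+1}\setminus U_n)\ge\mu(U_{n+1}\setminus\overline{U_n})>0$ for all $n$. Put $$\widetilde m:=\sum_{n=0}^\infty2^{-n}\Gamma(f_n)+\sum_{k=0}^\infty2^{-k}\mu(U_{k+1}\setminus U_k)^{-1}\mu|_{U_{k+1}\setminus U_k}+\mu(U_0)^{-1}\mu|_{U_0}.$$ This is an admissible reference measure, and all energy measures $\Gamma(f)$, $f\in\mathcal C$, are absolutely continuous with respect to $\widetilde m$. Continuous coordinates: let $m$ be an admissible reference measure such that all $\Gamma(f)$, $f\in\mathcal C$, are absolutely continuous with respect to $m$, and such that $m$ is finite and does not charge sets of zero capacity; $\Gamma(f,g)$ also denotes the density with respect to $m$. A set $\{\varphi_i\}_{i\in I}\subset\mathcal C$ ($I\ne\emptyset$) is a set of continuous coordinates for $\mathcal E$ with respect to $m$ if (COI) for all $i,j\in I$, $\Gamma(\varphi_i,\varphi_j)\in L_1(X,m)\cap L_\infty(X,m)$; (COII) the space of all cylinder functions $f=F(\varphi_{i_1},\dots,\varphi_{i_k})$ with $i_1,\dots,i_k\in I$, suitable $k\in\mathbb N$, and $F\in C_b^1(\mathbb R^k)$ ($C^1$, bounded with bounded first derivatives), $F(0)=0$, is dense in $\mathcal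 C$ with respect to the norm in $\mathcal F$, i.e. $\mathcal E_1$-dense. *)

theory Defs
  imports "HOL-Analysis.Analysis"
begin

text \<open>
  The space X is the whole type \<open>'a\<close>, of class \<open>metric_space\<close> and
  \<open>second_countable_topology\<close> (for metric spaces the latter is separability); local compactness
  is a hypothesis of the theorem. Elements of L2 are represented by functions, not by classes.
  The domain \<open>F\<close> of a form is closed under almost everywhere equality and \<open>E\<close> respects it, so
  \<open>F\<close> and \<open>E\<close> amount to a subspace of L2 and a form on it. \<open>E\<close> is a total function, but only its
  values on \<open>F\<close> carry meaning.
\<close>

definition radon_measure :: "'a::topological_space measure \<Rightarrow> bool" where
  "radon_measure M \<longleftrightarrow> sets M = sets borel
     \<and> (\<forall>K. compact K \<longrightarrow> emeasure M K < \<infinity>)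
     \<and> (\<forall>A\<in>sets borel. emeasure M A = (SUP K\<in>{K \<in> sets borel. compact K \<and> K \<subseteq> A}. emeasure M K))"

definition admissible_measure :: "'a::topological_space measure \<Rightarrow> bool" where
  "admissible_measure M \<longleftrightarrow> radon_measure M \<and> (\<forall>U. open U \<and> U \<noteq> {} \<longrightarrow> emeasure M U > 0)"

definition L2_space :: "'a measure \<Rightarrow> ('a \<Rightarrow> real) set" where
  "L2_space \<mu> = {u \<in> borel_measurable \<mu>. integrable \<mu> (\<lambda>x. (u x)\<^sup>2)}"

definition C0_space :: "('a::topological_space \<Rightarrow> real) set" where
  "C0_space = {u. continuous_on UNIV u \<and> compact (closure {x. u x \<noteq> 0})}"

definition E1 :: "'a measure \<Rightarrow> (('a \<Rightarrow> real) \<Rightarrow> ('a \<Rightarrow> real) \<Rightarrow> real) \<Rightarrow> ('a \<Rightarrow> real) \<Rightarrow> real" where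
  "E1 \<mu> E u = E u u + (\<integral>x. (u x)\<^sup>2 \<partial>\<mu>)"


section \<open>Dirichlet forms\<close>

definition symmetric_form_on_L2 ::
  "'a measure \<Rightarrow> (('a \<Rightarrow> real) \<Rightarrow> ('a \<Rightarrow> real) \<Rightarrow> real) \<Rightarrow> ('a \<Rightarrow> real) set \<Rightarrow> bool" where
  "symmetric_form_on_L2 \<mu> E F \<longleftrightarrow>
     F \<subseteq> L2_space \<mu> \<and> (\<lambda>x. 0) \<in> F
     \<and> (\<forall>u\<in>F. \<forall>v\<in>F. (\<lambda>x. u x + v x) \<in> F)
     \<and> (\<forall>u\<in>F. \<forall>c. (\<lambda>x. c * u x) \<in> F)
     \<and> (\<forall>u\<in>F. \<forall>v\<in>L2_space \<mu>. (AE x in \<mu>. u x = v x) \<longrightarrow> v \<in> F \<and> (\<forall>w\<in>F. E u w = E v w))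
     \<and> (\<forall>u\<in>L2_space \<mu>. \<forall>\<epsilon>>0. \<exists>v\<in>F. (\<integral>x. (u x - v x)\<^sup>2 \<partial>\<mu>) < \<epsilon>)
     \<and> (\<forall>u\<in>F. \<forall>v\<in>F. E u v = E v u)
     \<and> (\<forall>u\<in>F. \<forall>v\<in>F. \<forall>w\<in>F. E (\<lambda>x. u x + v x) w = E u w + E v w)
     \<and> (\<forall>u\<in>F. \<forall>w\<in>F. \<forall>c. E (\<lambda>x. c * u x) w = c * E u w)
     \<and> (\<forall>u\<in>F. 0 \<le> E u u)"

definition closed_form ::
  "'a measure \<Rightarrow> (('a \<Rightarrow> real) \<Rightarrow> ('a \<Rightarrow> real) \<Rightarrow> real) \<Rightarrow> ('a \<Rightarrow> real) set \<Rightarrow> bool" where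
  "closed_form \<mu> E F \<longleftrightarrow>
     (\<forall>u::nat \<Rightarrow> 'a \<Rightarrow> real. (\<forall>n. u n \<in> F)
        \<and> (\<forall>\<epsilon>>0. \<exists>N. \<forall>m\<ge>N. \<forall>n\<ge>N. E1 \<mu> E (\<lambda>x. u m x - u n x) < \<epsilon>)
        \<longrightarrow> (\<exists>v\<in>F. (\<lambda>n. E1 \<mu> E (\<lambda>x. u n x - v x)) \<longlonglongrightarrow> 0))"

definition markovian_form :: "(('a \<Rightarrow> real) \<Rightarrow> ('a \<Rightarrow> real) \<Rightarrow> real) \<Rightarrow> ('a \<Rightarrow> real) set \<Rightarrow> bool" where
  "markovian_form E F \<longleftrightarrow>
     (\<forall>u\<in>F. (\<lambda>x. min (max (u x) 0) 1) \<in> F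
        \<and> E (\<lambda>x. min (max (u x) 0) 1) (\<lambda>x. min (max (u x) 0) 1) \<le> E u u)"

definition dirichlet_form ::
  "'a measure \<Rightarrow> (('a \<Rightarrow> real) \<Rightarrow> ('a \<Rightarrow> real) \<Rightarrow> real) \<Rightarrow> ('a \<Rightarrow> real) set \<Rightarrow> bool" where
  "dirichlet_form \<mu> E F \<longleftrightarrow> symmetric_form_on_L2 \<mu> E F \<and> closed_form \<mu> E F \<and> markovian_form E F"

definition regular_form ::
  "'a::metric_space measure \<Rightarrow> (('a \<Rightarrow> real) \<Rightarrow> ('a \<Rightarrow> real) \<Rightarrow> real) \<Rightarrow> ('a \<Rightarrow> real) set \<Rightarrow> bool" where
  "regular_form \<mu> E F \<longleftrightarrow>
     (\<forall>u\<in>F. \<forall>\<epsilon>>0. \<exists>v\<in>C0_space \<inter> F. E1 \<mu> E (\<lambda>x. u x - v x) < \<epsilon>)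
     \<and> (\<forall>u\<in>C0_space. \<forall>\<epsilon>>0. \<exists>v\<in>C0_space \<inter> F. \<forall>x. \<bar>u x - v x\<bar> < \<epsilon>)"

text \<open>The support of the (signed) measure with density \<open>u\<close>; it depends only on the class of \<open>u\<close>.\<close>

definition ae_support :: "'a::topological_space measure \<Rightarrow> ('a \<Rightarrow> real) \<Rightarrow> 'a set" where
  "ae_support \<mu> u = - \<Union>{W. open W \<and> (AE x in \<mu>. x \<in> W \<longrightarrow> u x = 0)}"

text \<open>Locality, not strong locality: a killing part is allowed.\<close>

definition local_form ::
  "'a::topological_space measure \<Rightarrow> (('a \<Rightarrow> real) \<Rightarrow> ('a \<Rightarrow> real) \<Rightarrow> real) \<Rightarrow> ('a \<Rightarrow> real) set \<Rightarrow> bool" where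
  "local_form \<mu> E F \<longleftrightarrow>
     (\<forall>u\<in>F. \<forall>v\<in>F. compact (ae_support \<mu> u) \<and> compact (ae_support \<mu> v)
        \<and> ae_support \<mu> u \<inter> ae_support \<mu> v = {} \<longrightarrow> E u v = 0)"


section \<open>Capacity\<close>

definition open_capacity ::
  "'a measure \<Rightarrow> (('a \<Rightarrow> real) \<Rightarrow> ('a \<Rightarrow> real) \<Rightarrow> real) \<Rightarrow> ('a \<Rightarrow> real) set \<Rightarrow> 'a set \<Rightarrow> ennreal" where
  "open_capacity \<mu> E F A = (INF u\<in>{u \<in> F. AE x in \<mu>. x \<in> A \<longrightarrow> 1 \<le> u x}. ennreal (E1 \<mu> E u))"

definition capacity ::
  "'a::topological_space measure \<Rightarrow> (('a \<Rightarrow> real) \<Rightarrow> ('a \<Rightarrow> real) \<Rightarrow> real) \<Rightarrow> ('a \<Rightarrow> real) set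
    \<Rightarrow> 'a set \<Rightarrow> ennreal" where
  "capacity \<mu> E F A = (INF B\<in>{B. open B \<and> A \<subseteq> B}. open_capacity \<mu> E F B)"


section \<open>Energy measures\<close>

text \<open>
  A finite signed Radon measure is a set function \<open>\<nu>\<close> whose values on Borel sets are differences
  \<open>P - N\<close> of two finite Radon measures; the integral against \<open>\<nu>\<close> is then the difference of the
  integrals against \<open>P\<close> and \<open>N\<close> (the choice of \<open>P\<close> and \<open>N\<close> does not matter).
\<close>

definition is_energy_measure ::
  "(('a::topological_space \<Rightarrow> real) \<Rightarrow> ('a \<Rightarrow> real) \<Rightarrow> real) \<Rightarrow> ('a \<Rightarrow> real) set
    \<Rightarrow> ('a \<Rightarrow> real) \<Rightarrow> ('a \<Rightarrow> real) \<Rightarrow> ('a set \<Rightarrow> real) \<Rightarrow> bool" where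
  "is_energy_measure E F g h \<nu> \<longleftrightarrow>
     (\<exists>P N. finite_measure P \<and> finite_measure N \<and> radon_measure P \<and> radon_measure N
        \<and> (\<forall>A\<in>sets borel. \<nu> A = measure P A - measure N A)
        \<and> (\<forall>f\<in>C0_space \<inter> F. 2 * ((\<integral>x. f x \<partial>P) - (\<integral>x. f x \<partial>N))
              = E (\<lambda>x. f x * g x) h + E (\<lambda>x. f x * h x) g - E (\<lambda>x. g x * h x) f))"

definition energy_reference_measure ::
  "'a::topological_space measure \<Rightarrow> (('a \<Rightarrow> real) \<Rightarrow> ('a \<Rightarrow> real) \<Rightarrow> 'a set \<Rightarrow> real)
    \<Rightarrow> (nat \<Rightarrow> 'a \<Rightarrow> real) \<Rightarrow> (nat \<Rightarrow> 'a set) \<Rightarrow> 'a measure" where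
  "energy_reference_measure \<mu> \<Gamma> f U = measure_of UNIV (sets borel)
     (\<lambda>A. (\<Sum>n. ennreal ((1 / 2) ^ n * \<Gamma> (f n) (f n) A))
        + (\<Sum>k. ennreal ((1 / 2) ^ k)
              * (emeasure \<mu> (A \<inter> (U (Suc k) - U k)) / emeasure \<mu> (U (Suc k) - U k)))
        + emeasure \<mu> (A \<inter> U 0) / emeasure \<mu> (U 0))"


section \<open>Continuous coordinates\<close>

text \<open>
  Functions on \<open>\<real>\<^sup>k\<close>, with \<open>k\<close> a variable, are functions of sequences \<open>nat \<Rightarrow> real\<close> that depend only
  on the first \<open>k\<close> entries. For these, continuity in the product topology of \<open>nat \<Rightarrow> real\<close> is
  continuity on \<open>\<real>\<^sup>k\<close>; \<open>D i\<close> below is the \<open>i\<close>-th partial derivative.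
\<close>

definition Cb1 :: "nat \<Rightarrow> ((nat \<Rightarrow> real) \<Rightarrow> real) set" where
  "Cb1 k = {G. (\<forall>x y. (\<forall>j<k. x j = y j) \<longrightarrow> G x = G y)
     \<and> continuous_on UNIV G \<and> bounded (range G)
     \<and> (\<exists>D. \<forall>i<k. continuous_on UNIV (D i) \<and> bounded (range (D i))
          \<and> (\<forall>x. ((\<lambda>t. G (x(i := t))) has_real_derivative D i x) (at (x i))))}"

definition cylinder_functions :: "('a \<Rightarrow> real) set \<Rightarrow> ('a \<Rightarrow> real) set" where
  "cylinder_functions \<Phi> = {\<lambda>x. G (\<lambda>j. \<phi> j x) | (k::nat) G \<phi>.
     G \<in> Cb1 k \<and> G (\<lambda>j. 0) = 0 \<and> (\<forall>j<k. \<phi> j \<in> \<Phi>)}"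

definition is_density :: "'a::topological_space measure \<Rightarrow> ('a set \<Rightarrow> real) \<Rightarrow> ('a \<Rightarrow> real) \<Rightarrow> bool" where
  "is_density m \<nu> d \<longleftrightarrow> integrable m d \<and> (\<forall>A\<in>sets borel. \<nu> A = set_lebesgue_integral m A d)"

text \<open>
  The first five conjuncts are the conditions under which coordinates with respect to \<open>m\<close> are
  considered at all; the last three are (COI) and the density (COII), which includes that cylinder
  functions belong to the space in which they are to be dense.
\<close>

definition continuous_coordinates ::
  "'a::topological_space measure \<Rightarrow> (('a \<Rightarrow> real) \<Rightarrow> ('a \<Rightarrow> real) \<Rightarrow> real) \<Rightarrow> ('a \<Rightarrow> real) set
    \<Rightarrow> (('a \<Rightarrow> real) \<Rightarrow> ('a \<Rightarrow> real) \<Rightarrow> 'a set \<Rightarrow> real) \<Rightarrow> 'a measure \<Rightarrow> ('a \<Rightarrow> real) set \<Rightarrow> bool" where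
  "continuous_coordinates \<mu> E F \<Gamma> m \<Phi> \<longleftrightarrow>
     admissible_measure m
     \<and> (\<forall>g\<in>C0_space \<inter> F. \<forall>A\<in>sets borel. emeasure m A = 0 \<longrightarrow> \<Gamma> g g A = 0)
     \<and> finite_measure m
     \<and> (\<forall>A\<in>sets borel. capacity \<mu> E F A = 0 \<longrightarrow> emeasure m A = 0)
     \<and> \<Phi> \<noteq> {} \<and> \<Phi> \<subseteq> C0_space \<inter> F
     \<and> (\<forall>\<phi>\<in>\<Phi>. \<forall>\<psi>\<in>\<Phi>. \<exists>d. is_density m (\<Gamma> \<phi> \<psi>) d \<and> (\<exists>c. AE x in m. \<bar>d x\<bar> \<le> c))
     \<and> cylinder_functions \<Phi> \<subseteq> C0_space \<inter> F
     \<and> (\<forall>g\<in>C0_space \<inter> F. \<forall>\<epsilon>>0. \<exists>f\<in>cylinder_functions \<Phi>. E1 \<mu> E (\<lambda>x. g x - f x) < \<epsilon>)"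

end

theory Submission
  imports Defs
begin

text \<open>
  Write \<open>G\<^sub>\<beta>\<close> for the resolvent of \<open>E\<close>. The operators \<open>S = \<beta> G\<^sub>\<beta>\<close> are symmetric on \<open>L\<^sub>2\<close>, and the
  Markov property of \<open>E\<close> says that \<open>0 \<le> u \<le> 1\<close> implies \<open>0 \<le> S u \<le> 1\<close>. The approximating forms
  \<open>\<beta> \<langle>u - S u, v\<rangle>\<close> therefore behave like
  a double integral of \<open>(u x - u y) (v x - v y)\<close> against nonnegative jump weights plus an integral of
  \<open>u v\<close> against a nonnegative killing weight. This gives one principle from which all properties of
  \<open>E\<close> below are read off: if
  \<open>\<Sum>i. (a\<^sub>i x - a\<^sub>i y) (b\<^sub>i x - b\<^sub>i y) \<ge> 0\<close> and \<open>\<Sum>i. a\<^sub>i x b\<^sub>i x \<ge> 0\<close> for all points \<open>x\<close>, \<open>y\<close>, then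
  \<open>\<Sum>i. E a\<^sub>i b\<^sub>i \<ge> 0\<close> (lemma \<open>energy_nonneg\<close>). It is shown for the approximating forms first
  (\<open>resolvent_energy_nonneg\<close>) and then passed to the limit \<open>\<beta> \<rightarrow> \<infinity>\<close>; the same limit shows that a
  function of \<open>L\<^sub>2\<close> with bounded approximating energies belongs to \<open>F\<close>
  (\<open>resolvent_approximation\<close>). So Lipschitz functions of finitely many elements of \<open>F\<close> that
  vanish at the origin, such as products of bounded functions and cylinder functions, are in \<open>F\<close>.

  Twice the integral of \<open>f\<close> against \<open>\<Gamma>(g, g)\<close> is \<open>L f = 2 E (f g) g - E (g\<^sup>2) f\<close>. Suitable \<open>a\<^sub>i\<close>,
  \<open>b\<^sub>i\<close> in the principle show that \<open>L\<close> is positive, that \<open>L f \<le> 2 E g g\<close> if \<open>f \<le> 1\<close>, and that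
  \<open>L f \<ge> E g g\<close> if moreover \<open>f \<ge> 0\<close> and \<open>f = 1\<close> wherever \<open>g\<close> does not vanish. By regularity
  and inner regularity of Radon measures, the numbers \<open>\<Gamma>(g, h)(A)\<close> are limits of values of such functionals
  at cutoff functions, simultaneously for finitely many pairs \<open>(g, h)\<close>. Hence, for each Borel set \<open>A\<close>,
  \<open>(g, h) \<mapsto> \<Gamma>(g, h)(A)\<close> is a positive semidefinite bilinear form, \<open>\<Gamma>(g, g)(A) \<le> E g g\<close>, and
  \<open>\<Gamma>(g, g)(UNIV) \<ge> E g g / 2\<close>. The last bound makes the normalisation in \<open>f\<^sub>n\<close> meaningful.
  Finally \<open>L f\<close> tends to \<open>0\<close> when \<open>0 \<le> f \<le> 1\<close> and \<open>E\<^sub>1 f \<rightarrow> 0\<close>, so that energy measures do not charge sets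
  of capacity zero.

  Now let \<open>m\<close> be the reference measure. By construction \<open>\<Gamma>(f\<^sub>n, f\<^sub>n) \<le> 2\<^sup>n m\<close>, so the Cauchy-Schwarz
  inequality bounds \<open>\<bar>\<Gamma>(f\<^sub>i, f\<^sub>j)(A)\<bar>\<close> by a multiple of \<open>m A\<close>, and \<open>\<Gamma>(f\<^sub>i, f\<^sub>j)\<close> has a bounded
  density. If \<open>m A = 0\<close>, then \<open>\<Gamma>(g, g)(A) \<le> 2 \<Gamma>(\<psi>\<^sub>n, \<psi>\<^sub>n)(A) + 2 E (g - \<psi>\<^sub>n) (g - \<psi>\<^sub>n)\<close>, where the first term
  is \<open>0\<close> and the second is small for a suitable \<open>n\<close>. Every \<open>\<psi>\<^sub>n\<close> is a cylinder function, since it is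
  a multiple of the bounded function \<open>f\<^sub>n\<close> and multiplication by a constant on a bounded interval
  extends to a bounded \<open>C\<^sup>1\<close> function with bounded derivative. The \<open>\<psi>\<^sub>n\<close> remain dense although the
  \<open>\<phi>\<^sub>n\<^sub>k\<close> of zero energy are left out: a function of zero energy is moved to one of positive energy by
  adding a small multiple of \<open>\<psi>\<^sub>0\<close> (\<open>positive_energy_dense\<close>).
\<close>

section \<open>Positive semidefinite forms on spaces of functions\<close>

lemma linear_coeff_zero:
  fixes p q :: real
  assumes "\<And>t. 0 \<le> 2 * t * p + t\<^sup>2 * q"
  shows "p = 0"
proof (rule ccontr)
  assume "p \<noteq> 0"
  define s where "s = \<bar>q\<bar> + 1"
  have s: "s > 0" "q < s" by (auto simp: s_def)
  have "0 \<le> 2 * (- p / s) * p + (- p / s)\<^sup>2 * q" by (rule assms)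
  also have "\<dots> = (p / s)\<^sup>2 * (q - 2 * s)"
    using s by (simp add: power2_eq_square field_simps)
  also have "\<dots> < 0"
    using s \<open>p \<noteq> 0\<close> by (intro mult_pos_neg) auto
  finally show False by simp
qed

text \<open>
  The same computations with a semi-inner product are needed for the inner product of \<open>L\<^sub>2\<close>, for
  the form \<open>E\<close> and its shifts \<open>E + \<beta> \<langle>_, _\<rangle>\<close>, and for \<open>(g, h) \<mapsto> \<Gamma>(g, h)(A)\<close> with \<open>A\<close> fixed. The
  elements are functions and not classes, so definiteness is not available.
\<close>

locale semi_inner =
  fixes V :: "('a \<Rightarrow> real) set" and b :: "('a \<Rightarrow> real) \<Rightarrow> ('a \<Rightarrow> real) \<Rightarrow> real"
  assumes add: "u \<in> V \<Longrightarrow> v \<in> V \<Longrightarrow> (\<lambda>x. u x + v x) \<in> V"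
    and scale: "u \<in> V \<Longrightarrow> (\<lambda>x. c * u x) \<in> V"
    and b_add: "u \<in> V \<Longrightarrow> v \<in> V \<Longrightarrow> w \<in> V \<Longrightarrow> b (\<lambda>x. u x + v x) w = b u w + b v w"
    and b_scale: "u \<in> V \<Longrightarrow> w \<in> V \<Longrightarrow> b (\<lambda>x. c * u x) w = c * b u w"
    and b_sym: "u \<in> V \<Longrightarrow> v \<in> V \<Longrightarrow> b u v = b v u"
    and b_nonneg: "u \<in> V \<Longrightarrow> 0 \<le> b u u"
begin

abbreviation (input) qb where "qb u \<equiv> b u u"

lemma diff: "u \<in> V \<Longrightarrow> v \<in> V \<Longrightarrow> (\<lambda>x. u x - v x) \<in> V"
  using add[OF _ scale, of u v "-1"] by simp

lemma b_add_right: "u \<in> V \<Longrightarrow> v \<in> V \<Longrightarrow> w \<in> V \<Longrightarrow> b w (\<lambda>x. u x + v x) = b w u + b w v"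
  using b_add[of u v w] b_sym add by metis

lemma b_scale_right: "u \<in> V \<Longrightarrow> w \<in> V \<Longrightarrow> b w (\<lambda>x. c * u x) = c * b w u"
  using b_scale[of u w c] b_sym scale by metis

lemma b_diff: "u \<in> V \<Longrightarrow> v \<in> V \<Longrightarrow> w \<in> V \<Longrightarrow> b (\<lambda>x. u x - v x) w = b u w - b v w"
  using b_add[OF _ scale, of u v w "-1"] b_scale[of v w "-1"] by simp

lemma b_diff_right: "u \<in> V \<Longrightarrow> v \<in> V \<Longrightarrow> w \<in> V \<Longrightarrow> b w (\<lambda>x. u x - v x) = b w u - b w v"
  using b_diff[of u v w] b_sym diff by metis

lemma b_square_add: "u \<in> V \<Longrightarrow> v \<in> V \<Longrightarrow>
    qb (\<lambda>x. u x + c * v x) = b u u + 2 * c * b u v + c\<^sup>2 * b v v"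
  by (simp add: b_add b_add_right b_scale b_scale_right add scale b_sym[of v u]
      power2_eq_square algebra_simps)

lemma b_square_diff: "u \<in> V \<Longrightarrow> v \<in> V \<Longrightarrow>
    qb (\<lambda>x. u x - v x) = b u u - 2 * b u v + b v v"
  using b_square_add[of u v "-1"] by simp

lemma cauchy_schwarz: "u \<in> V \<Longrightarrow> v \<in> V \<Longrightarrow> (b u v)\<^sup>2 \<le> b u u * b v v"
proof -
  assume u: "u \<in> V" and v: "v \<in> V"
  have *: "0 \<le> b u u + 2 * c * b u v + c\<^sup>2 * b v v" for c
    using b_nonneg[OF add[OF u scale[OF v, of c]]] b_square_add[OF u v] by simp
  show ?thesis
  proof (cases "b v v = 0")
    case False
    then have "b v v > 0" using b_nonneg[OF v] by simp
    then show ?thesis using *[of "- b u v / b v v"]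
      by (simp add: field_simps power2_eq_square)
  next
    case True
    have "b u v = 0"
    proof (rule ccontr)
      assume "b u v \<noteq> 0"
      then show False using *[of "- (b u u + 1) / (2 * b u v)"] True by (simp add: field_simps)
    qed
    then show ?thesis using True by simp
  qed
qed

lemma cauchy_schwarz_abs: "u \<in> V \<Longrightarrow> v \<in> V \<Longrightarrow> \<bar>b u v\<bar> \<le> sqrt (b u u) * sqrt (b v v)"
  using cauchy_schwarz[of u v] by (metis real_le_rsqrt real_sqrt_abs real_sqrt_le_mono real_sqrt_mult)

lemma triangle:
  assumes u: "u \<in> V" and v: "v \<in> V"
  shows "sqrt (qb (\<lambda>x. u x + v x)) \<le> sqrt (b u u) + sqrt (b v v)"
proof (rule real_le_lsqrt)
  show "0 \<le> sqrt (b u u) + sqrt (b v v)" using b_nonneg u v by simp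
  show "qb (\<lambda>x. u x + v x) \<le> (sqrt (b u u) + sqrt (b v v))\<^sup>2"
    using b_square_add[OF u v, of 1] cauchy_schwarz_abs[OF u v] b_nonneg[OF u] b_nonneg[OF v]
    by (simp add: power2_sum)
qed

lemma triangle_diff:
  assumes u: "u \<in> V" and v: "v \<in> V" and w: "w \<in> V"
  shows "sqrt (qb (\<lambda>x. u x - w x)) \<le>
    sqrt (qb (\<lambda>x. u x - v x)) + sqrt (qb (\<lambda>x. v x - w x))"
  using triangle[OF diff[OF u v] diff[OF v w]] by simp

lemma dist_commute: "u \<in> V \<Longrightarrow> v \<in> V \<Longrightarrow>
    qb (\<lambda>x. u x - v x) = qb (\<lambda>x. v x - u x)"
  by (simp add: b_square_diff b_sym)

lemma square_add_le: "u \<in> V \<Longrightarrow> v \<in> V \<Longrightarrow>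
    qb (\<lambda>x. u x + v x) \<le> 2 * b u u + 2 * b v v"
  using b_square_add[of u v 1] b_square_diff[of u v] b_nonneg[OF diff[of u v]] by simp

lemma tendsto_left:
  assumes u: "\<And>n. u n \<in> V" "l \<in> V" "(\<lambda>n. qb (\<lambda>x. u n x - l x)) \<longlonglongrightarrow> 0"
    and v: "v \<in> V"
  shows "(\<lambda>n. b (u n) v) \<longlonglongrightarrow> b l v"
proof -
  have "(\<lambda>n. b (u n) v - b l v) \<longlonglongrightarrow> 0"
  proof (rule Lim_null_comparison)
    show "\<forall>\<^sub>F n in sequentially. norm (b (u n) v - b l v)
        \<le> sqrt (qb (\<lambda>x. u n x - l x)) * sqrt (b v v)"
      using cauchy_schwarz_abs[OF diff[OF u(1) u(2)] v] u v by (simp add: b_diff)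
    show "(\<lambda>n. sqrt (qb (\<lambda>x. u n x - l x)) * sqrt (b v v)) \<longlonglongrightarrow> 0"
      by (rule tendsto_eq_intros tendsto_real_sqrt u(3) | simp)+
  qed
  then show ?thesis by (simp add: LIM_zero_iff)
qed

lemma tendsto_both:
  assumes u: "\<And>n. u n \<in> V" "l \<in> V" "(\<lambda>n. qb (\<lambda>x. u n x - l x)) \<longlonglongrightarrow> 0"
    and v: "\<And>n. v n \<in> V" "k \<in> V" "(\<lambda>n. qb (\<lambda>x. v n x - k x)) \<longlonglongrightarrow> 0"
  shows "(\<lambda>n. b (u n) (v n)) \<longlonglongrightarrow> b l k"
proof -
  let ?U = "\<lambda>n x. u n x - l x" and ?W = "\<lambda>n x. v n x - k x"
  have "(\<lambda>n. b (?U n) (?W n)) \<longlonglongrightarrow> 0"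
  proof (rule Lim_null_comparison)
    show "\<forall>\<^sub>F n in sequentially. norm (b (?U n) (?W n)) \<le> sqrt (b (?U n) (?U n)) * sqrt (b (?W n) (?W n))"
      using cauchy_schwarz_abs[OF diff[OF u(1) u(2)] diff[OF v(1) v(2)]] by simp
    show "(\<lambda>n. sqrt (b (?U n) (?U n)) * sqrt (b (?W n) (?W n))) \<longlonglongrightarrow> 0"
      by (rule tendsto_eq_intros tendsto_real_sqrt u(3) v(3) | simp)+
  qed
  moreover have "(\<lambda>n. b (u n) k) \<longlonglongrightarrow> b l k" "(\<lambda>n. b (v n) l) \<longlonglongrightarrow> b k l"
    using tendsto_left[OF u v(2)] tendsto_left[OF v u(2)] by auto
  ultimately have "(\<lambda>n. b (?U n) (?W n) + b (u n) k + b (v n) l - b l k) \<longlonglongrightarrow> 0 + b l k + b k l - b l k"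
    by (intro tendsto_intros)
  moreover have "b (?U n) (?W n) + b (u n) k + b (v n) l - b l k = b (u n) (v n)" for n
    using u(1,2) v(1,2) by (simp add: b_diff b_diff_right diff b_sym[of l "v n"])
  ultimately show ?thesis using b_sym[OF u(2) v(2)] by simp
qed

definition complete_under :: bool where
  "complete_under \<longleftrightarrow> (\<forall>u. (\<forall>n. u n \<in> V)
      \<and> (\<forall>\<epsilon>>0. \<exists>N::nat. \<forall>m\<ge>N. \<forall>n\<ge>N. qb (\<lambda>x. u m x - u n x) < \<epsilon>)
      \<longrightarrow> (\<exists>v\<in>V. (\<lambda>n. qb (\<lambda>x. u n x - v x)) \<longlonglongrightarrow> 0))"

text \<open>
  A minimising sequence of the quadratic functional \<open>J v = b v v - 2 l v\<close> is a Cauchy sequence by the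
  parallelogram identity; the Euler equation of a minimiser \<open>w\<close> is \<open>b w v = l v\<close>.
\<close>

lemma riesz_representation:
  assumes complete: complete_under and zero: "(\<lambda>x. 0) \<in> V"
    and l_add: "\<And>u v. u \<in> V \<Longrightarrow> v \<in> V \<Longrightarrow> l (\<lambda>x. u x + v x) = l u + (l v::real)"
    and l_scale: "\<And>u c. u \<in> V \<Longrightarrow> l (\<lambda>x. c * u x) = c * l u"
    and l_bounded: "\<And>u. u \<in> V \<Longrightarrow> \<bar>l u\<bar> \<le> C * sqrt (b u u)"
  shows "\<exists>w\<in>V. \<forall>v\<in>V. b w v = l v"
proof -
  define J where "J v = b v v - 2 * l v" for v
  have J_add: "J (\<lambda>x. u x + t * v x) = J u + 2 * t * (b u v - l v) + t\<^sup>2 * b v v"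
    if "u \<in> V" "v \<in> V" for u v t
    using that by (simp add: J_def b_square_add l_add l_scale scale algebra_simps)
  have below: "- C\<^sup>2 \<le> J v" if "v \<in> V" for v
  proof -
    have "0 \<le> (sqrt (b v v) - C)\<^sup>2" by simp
    also have "\<dots> = b v v - 2 * C * sqrt (b v v) + C\<^sup>2"
      using b_nonneg[OF that] by (simp add: power2_diff)
    finally show ?thesis using l_bounded[OF that] by (simp add: J_def)
  qed
  define d where "d = (INF v\<in>V. J v)"
  have bdd: "bdd_below (J ` V)" using below by (auto intro!: bdd_belowI2)
  have d_le: "d \<le> J v" if "v \<in> V" for v
    unfolding d_def using bdd that by (rule cINF_lower)
  have "\<exists>v\<in>V. J v < d + 1 / real (Suc n)" for n
    using cINF_less_iff[of V J "d + 1 / real (Suc n)"] bdd zero unfolding d_def by auto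
  then obtain v where v: "\<And>n. v n \<in> V" "\<And>n. J (v n) < d + 1 / real (Suc n)" by metis
  \<comment> \<open>the midpoint of \<open>u\<close> and \<open>w\<close> competes with the infimum \<open>d\<close>\<close>
  have par: "qb (\<lambda>x. u x - w x) \<le> 2 * (J u - d) + 2 * (J w - d)"
    if u: "u \<in> V" and w: "w \<in> V" for u w
  proof -
    have "(\<lambda>x. w x + (1 / 2) * (u x - w x)) \<in> V" by (intro add scale diff u w)
    from d_le[OF this] have "d \<le> J w + (b w (\<lambda>x. u x - w x) - l (\<lambda>x. u x - w x))
        + (1 / 4) * qb (\<lambda>x. u x - w x)"
      using J_add[OF w diff[OF u w], of "1 / 2"] by (simp add: power2_eq_square)
    moreover have "J u = J w + 2 * (b w (\<lambda>x. u x - w x) - l (\<lambda>x. u x - w x))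
        + qb (\<lambda>x. u x - w x)"
      using J_add[OF w diff[OF u w], of 1] by simp
    ultimately show ?thesis by argo
  qed
  have "\<exists>N. \<forall>m\<ge>N. \<forall>n\<ge>N. qb (\<lambda>x. v m x - v n x) < \<epsilon>" if "\<epsilon> > 0" for \<epsilon>
  proof -
    from that have "0 < \<epsilon> / 4" by simp
    then obtain N where N: "1 / real (Suc N) < \<epsilon> / 4" by (rule nat_approx_posE)
    have J_small: "J (v n) - d < \<epsilon> / 4" if "n \<ge> N" for n
    proof -
      have "1 / real (Suc n) \<le> 1 / real (Suc N)" using that by (simp add: frac_le)
      then show ?thesis using v(2)[of n] N by linarith
    qed
    have "qb (\<lambda>x. v m x - v n x) < \<epsilon>" if "m \<ge> N" "n \<ge> N" for m n
    proof -
      have "2 * (J (v m) - d) + 2 * (J (v n) - d) < \<epsilon>"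
        using J_small[OF that(1)] J_small[OF that(2)] by (simp add: field_simps)
      then show ?thesis using par[OF v(1)[of m] v(1)[of n]] by (rule le_less_trans[rotated])
    qed
    then show ?thesis by blast
  qed
  then obtain w where w: "w \<in> V" "(\<lambda>n. qb (\<lambda>x. v n x - w x)) \<longlonglongrightarrow> 0"
    using complete v(1) unfolding complete_under_def by blast
  have Jw: "J w \<le> d"
  proof (rule LIMSEQ_le)
    have "(\<lambda>n. b (v n) (v n)) \<longlonglongrightarrow> b w w" by (rule tendsto_both) (use v w in auto)
    moreover have "(\<lambda>n. l (v n)) \<longlonglongrightarrow> l w"
    proof -
      have "(\<lambda>n. l (v n) - l w) \<longlonglongrightarrow> 0"
      proof (rule Lim_null_comparison)
        have "l (\<lambda>x. v n x - w x) = l (v n) - l w" for n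
          using l_add[OF v(1) scale[OF w(1)], of n "-1"] l_scale[OF w(1), of "-1"] by simp
        then show "\<forall>\<^sub>F n in sequentially. norm (l (v n) - l w)
            \<le> C * sqrt (qb (\<lambda>x. v n x - w x))"
          using l_bounded[OF diff[OF v(1) w(1)]] by simp
        show "(\<lambda>n. C * sqrt (qb (\<lambda>x. v n x - w x))) \<longlonglongrightarrow> 0"
          by (rule tendsto_eq_intros tendsto_real_sqrt w(2) | simp)+
      qed
      then show ?thesis by (simp add: LIM_zero_iff)
    qed
    ultimately show "(\<lambda>n. J (v n)) \<longlonglongrightarrow> J w" unfolding J_def by (intro tendsto_intros)
    have "(\<lambda>n. d + 1 / real (Suc n)) \<longlonglongrightarrow> d + 0"
      by (intro tendsto_intros lim_1_over_n LIMSEQ_Suc)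
    then show "(\<lambda>n. d + 1 / real (Suc n)) \<longlonglongrightarrow> d" by simp
    show "\<exists>N. \<forall>n\<ge>N. J (v n) \<le> d + 1 / real (Suc n)" using v(2) by (meson less_imp_le)
  qed
  have "b w u - l u = 0" if u: "u \<in> V" for u
  proof (rule linear_coeff_zero[of _ "b u u"])
    fix t
    have "J w \<le> J (\<lambda>x. w x + t * u x)" using Jw d_le[OF add[OF w(1) scale[OF u]], of t] by linarith
    then show "0 \<le> 2 * t * (b w u - l u) + t\<^sup>2 * b u u" using J_add[OF w(1) u] by simp
  qed
  then show ?thesis using w(1) by (auto intro!: bexI[of _ w])
qed

end

section \<open>Resolvents of a Dirichlet form\<close>

definition L2_inner :: "'a measure \<Rightarrow> ('a \<Rightarrow> real) \<Rightarrow> ('a \<Rightarrow> real) \<Rightarrow> real" where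
  "L2_inner M u v = (\<integral>x. u x * v x \<partial>M)"

lemma L2_spaceI:
  assumes "v \<in> borel_measurable M" "integrable M g" "\<And>x. (v x)\<^sup>2 \<le> g x"
  shows "v \<in> L2_space M"
  unfolding L2_space_def
proof (intro CollectI conjI assms(1) Bochner_Integration.integrable_bound[OF assms(2)])
  show "(\<lambda>x. (v x)\<^sup>2) \<in> borel_measurable M" using assms(1) by measurable
  show "AE x in M. norm ((v x)\<^sup>2) \<le> norm (g x)"
    using assms(3) by (intro always_eventually allI) (metis abs_ge_self abs_of_nonneg order_trans real_norm_def zero_le_power2)
qed

lemma L2_space_measurable: "u \<in> L2_space M \<Longrightarrow> u \<in> borel_measurable M"
  by (simp add: L2_space_def)

lemma L2_space_integrable: "u \<in> L2_space M \<Longrightarrow> integrable M (\<lambda>x. (u x)\<^sup>2)"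
  by (simp add: L2_space_def)

lemma L2_product_integrable:
  assumes "u \<in> L2_space M" "v \<in> L2_space M"
  shows "integrable M (\<lambda>x. u x * v x)"
proof (rule Bochner_Integration.integrable_bound)
  show "integrable M (\<lambda>x. (u x)\<^sup>2 + (v x)\<^sup>2)" using assms by (simp add: L2_space_def)
  show "(\<lambda>x. u x * v x) \<in> borel_measurable M"
    using assms by (intro borel_measurable_times L2_space_measurable)
  have "\<bar>u x * v x\<bar> \<le> (u x)\<^sup>2 + (v x)\<^sup>2" for x
  proof -
    have "0 \<le> (u x + v x)\<^sup>2" "0 \<le> (u x - v x)\<^sup>2" by simp_all
    then show ?thesis using zero_le_power2[of "u x"] zero_le_power2[of "v x"]
      by (simp add: power2_sum power2_diff abs_le_iff)
  qed
  then show "AE x in M. norm (u x * v x) \<le> norm ((u x)\<^sup>2 + (v x)\<^sup>2)" by simp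
qed

interpretation L2: semi_inner "L2_space M" "L2_inner M" for M
proof
  fix u v w :: "'a \<Rightarrow> real" and c :: real
  assume u: "u \<in> L2_space M"
  show "(\<lambda>x. c * u x) \<in> L2_space M" "0 \<le> L2_inner M u u"
    using u by (auto simp: L2_space_def L2_inner_def power_mult_distrib)
  assume v: "v \<in> L2_space M"
  show "L2_inner M u v = L2_inner M v u" by (simp add: L2_inner_def mult.commute)
  have "(u x + v x)\<^sup>2 \<le> 2 * (u x)\<^sup>2 + 2 * (v x)\<^sup>2" for x
    using zero_le_power2[of "u x - v x"] by (simp add: power2_sum power2_diff)
  then show "(\<lambda>x. u x + v x) \<in> L2_space M"
    using u v by (intro L2_spaceI[where g = "\<lambda>x. 2 * (u x)\<^sup>2 + 2 * (v x)\<^sup>2"]) (auto simp: L2_space_def)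
  assume w: "w \<in> L2_space M"
  show "L2_inner M (\<lambda>x. u x + v x) w = L2_inner M u w + L2_inner M v w"
    using L2_product_integrable[OF u w] L2_product_integrable[OF v w]
    by (simp add: L2_inner_def distrib_right)
next
  fix u w :: "'a \<Rightarrow> real" and c :: real
  show "L2_inner M (\<lambda>x. c * u x) w = c * L2_inner M u w"
    by (simp add: L2_inner_def mult.assoc)
qed

lemma L2_inner_mono:
  assumes "u \<in> L2_space M" "v \<in> L2_space M" "\<And>x. \<bar>u x\<bar> \<le> \<bar>v x\<bar>"
  shows "L2_inner M u u \<le> L2_inner M v v"
  unfolding L2_inner_def
  using assms by (intro integral_mono L2_product_integrable) (auto simp: abs_le_square_iff simp flip: power2_eq_square)

lemma L2_inner_zero_AE:
  assumes "u \<in> L2_space M" "L2_inner M u u = 0"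
  shows "AE x in M. u x = 0"
  using assms integral_nonneg_eq_0_iff_AE[OF L2_product_integrable[OF assms(1,1)]]
  by (simp add: L2_inner_def)

locale dirichlet_space =
  fixes \<mu> :: "'a measure" and E :: "('a \<Rightarrow> real) \<Rightarrow> ('a \<Rightarrow> real) \<Rightarrow> real" and F :: "('a \<Rightarrow> real) set"
  assumes form: "dirichlet_form \<mu> E F"
begin

abbreviation ip where "ip \<equiv> L2_inner \<mu>"
abbreviation L2 where "L2 \<equiv> L2_space \<mu>"
abbreviation (input) qE where "qE u \<equiv> E u u"
abbreviation (input) qip where "qip u \<equiv> ip u u"

lemma symmetric_form: "symmetric_form_on_L2 \<mu> E F"
  using form by (simp add: dirichlet_form_def)

lemma F_L2: "u \<in> F \<Longrightarrow> u \<in> L2"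
  using symmetric_form by (auto simp: symmetric_form_on_L2_def)

lemma zero_F: "(\<lambda>x. 0) \<in> F"
  using symmetric_form by (auto simp: symmetric_form_on_L2_def)

lemma F_cong_AE:
  assumes "u \<in> F" "v \<in> L2" "AE x in \<mu>. u x = v x"
  shows "v \<in> F" "w \<in> F \<Longrightarrow> E u w = E v w"
proof -
  have "\<forall>u\<in>F. \<forall>v\<in>L2. (AE x in \<mu>. u x = v x) \<longrightarrow> v \<in> F \<and> (\<forall>w\<in>F. E u w = E v w)"
    using symmetric_form unfolding symmetric_form_on_L2_def by (elim conjE)
  then show "v \<in> F" "w \<in> F \<Longrightarrow> E u w = E v w" using assms by blast+
qed

sublocale En: semi_inner F E
proof
  fix u v w :: "'a \<Rightarrow> real" and c :: real
  note f = symmetric_form[unfolded symmetric_form_on_L2_def]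
  assume u: "u \<in> F"
  show "(\<lambda>x. c * u x) \<in> F" "0 \<le> E u u" using f u by blast+
  assume v: "v \<in> F"
  show "(\<lambda>x. u x + v x) \<in> F" "E u v = E v u" using f u v by blast+
  assume w: "w \<in> F"
  show "E (\<lambda>x. u x + v x) w = E u w + E v w" using f u v w by blast
next
  fix u w :: "'a \<Rightarrow> real" and c :: real
  assume "u \<in> F" "w \<in> F"
  then show "E (\<lambda>x. c * u x) w = c * E u w"
    using symmetric_form[unfolded symmetric_form_on_L2_def] by blast
qed

text \<open>
  The forms \<open>E + \<beta> \<langle>_, _\<rangle>\<close> with \<open>\<beta> > 0\<close> are equivalent to \<open>E\<^sub>1\<close>, hence complete since \<open>E\<close> is
  closed; the Riesz representation for them yields the resolvent.
\<close>

lemma semi_inner_shifted: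
  assumes "0 \<le> \<beta>" shows "semi_inner F (\<lambda>u v. E u v + \<beta> * ip u v)"
proof
  fix u v w :: "'a \<Rightarrow> real" and c :: real
  assume u: "u \<in> F"
  show "(\<lambda>x. c * u x) \<in> F" using u by (rule En.scale)
  show "0 \<le> E u u + \<beta> * ip u u"
    using assms u by (simp add: En.b_nonneg L2.b_nonneg F_L2)
  assume v: "v \<in> F"
  show "(\<lambda>x. u x + v x) \<in> F" using u v by (rule En.add)
  show "E u v + \<beta> * ip u v = E v u + \<beta> * ip v u"
    using u v by (simp add: En.b_sym L2.b_sym F_L2)
  assume w: "w \<in> F"
  show "E (\<lambda>x. u x + v x) w + \<beta> * ip (\<lambda>x. u x + v x) w = E u w + \<beta> * ip u w + (E v w + \<beta> * ip v w)"
    using u v w by (simp add: En.b_add L2.b_add F_L2 algebra_simps)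
next
  fix u w :: "'a \<Rightarrow> real" and c :: real
  assume u: "u \<in> F" and w: "w \<in> F"
  show "E (\<lambda>x. c * u x) w + \<beta> * ip (\<lambda>x. c * u x) w = c * (E u w + \<beta> * ip u w)"
    using u w by (simp add: En.b_scale L2.b_scale F_L2 algebra_simps)
qed

lemma E1_eq: "E1 \<mu> E u = E u u + 1 * ip u u"
  by (simp add: E1_def L2_inner_def power2_eq_square)

lemma E1_nonneg: "u \<in> F \<Longrightarrow> 0 \<le> E1 \<mu> E u"
  unfolding E1_eq by (intro add_nonneg_nonneg mult_nonneg_nonneg En.b_nonneg L2.b_nonneg F_L2) auto

lemma closed:
  assumes "\<And>n. u n \<in> F"
    and "\<And>\<epsilon>. \<epsilon> > 0 \<Longrightarrow> \<exists>N::nat. \<forall>m\<ge>N. \<forall>n\<ge>N. E1 \<mu> E (\<lambda>x. u m x - u n x) < \<epsilon>"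
  shows "\<exists>v\<in>F. (\<lambda>n. E1 \<mu> E (\<lambda>x. u n x - v x)) \<longlonglongrightarrow> 0"
  using form assms unfolding dirichlet_form_def closed_form_def by blast

lemma complete_shifted:
  assumes "0 < \<beta>" shows "semi_inner.complete_under F (\<lambda>u v. E u v + \<beta> * ip u v)"
proof -
  interpret Eb: semi_inner F "\<lambda>u v. E u v + \<beta> * ip u v" using assms by (intro semi_inner_shifted) simp
  define K where "K = 1 + 1 / \<beta>"
  define K' where "K' = 1 + \<beta>"
  have K: "0 < K" "0 < K'" using assms by (auto simp: K_def K'_def add_pos_pos)
  have le: "E1 \<mu> E u \<le> K * (E u u + \<beta> * ip u u)" and ge: "E u u + \<beta> * ip u u \<le> K' * E1 \<mu> E u" if "u \<in> F" for u
    using that assms En.b_nonneg[OF that] L2.b_nonneg[OF F_L2[OF that]]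
    by (simp_all add: E1_eq K_def K'_def algebra_simps)
  show ?thesis unfolding Eb.complete_under_def
  proof (intro allI impI)
    fix u :: "nat \<Rightarrow> 'a \<Rightarrow> real"
    assume u: "(\<forall>n. u n \<in> F) \<and> (\<forall>\<epsilon>>0. \<exists>N. \<forall>m\<ge>N. \<forall>n\<ge>N. qE (\<lambda>x. u m x - u n x)
      + \<beta> * qip (\<lambda>x. u m x - u n x) < \<epsilon>)"
    then have uF: "u n \<in> F" for n by blast
    have "\<exists>v\<in>F. (\<lambda>n. E1 \<mu> E (\<lambda>x. u n x - v x)) \<longlonglongrightarrow> 0"
    proof (rule closed[OF uF])
      fix \<epsilon> :: real assume "\<epsilon> > 0"
      then have "\<epsilon> / K > 0" using K by simp
      then obtain N where N: "qE (\<lambda>x. u m x - u n x)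
        + \<beta> * qip (\<lambda>x. u m x - u n x) < \<epsilon> / K" if "m \<ge> N" "n \<ge> N" for m n
        using u by blast
      have "E1 \<mu> E (\<lambda>x. u m x - u n x) < \<epsilon>" if "m \<ge> N" "n \<ge> N" for m n
        using le[OF En.diff[OF uF[of m] uF[of n]]] N[OF that] K by (simp add: field_simps)
      then show "\<exists>N. \<forall>m\<ge>N. \<forall>n\<ge>N. E1 \<mu> E (\<lambda>x. u m x - u n x) < \<epsilon>" by blast
    qed
    then obtain v where v: "v \<in> F" "(\<lambda>n. E1 \<mu> E (\<lambda>x. u n x - v x)) \<longlonglongrightarrow> 0" by blast
    have "(\<lambda>n. qE (\<lambda>x. u n x - v x) + \<beta> * qip (\<lambda>x. u n x - v x)) \<longlonglongrightarrow> 0"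
    proof (rule Lim_null_comparison)
      show "\<forall>\<^sub>F n in sequentially. norm (qE (\<lambda>x. u n x - v x)
          + \<beta> * qip (\<lambda>x. u n x - v x)) \<le> K' * E1 \<mu> E (\<lambda>x. u n x - v x)"
        using ge Eb.b_nonneg En.diff[OF uF v(1)] by simp
      show "(\<lambda>n. K' * E1 \<mu> E (\<lambda>x. u n x - v x)) \<longlonglongrightarrow> 0" by (rule tendsto_eq_intros v(2) | simp)+
    qed
    then show "\<exists>v\<in>F. (\<lambda>n. qE (\<lambda>x. u n x - v x)
      + \<beta> * qip (\<lambda>x. u n x - v x)) \<longlonglongrightarrow> 0" using v(1) by blast
  qed
qed

text \<open>
  The relation \<open>w = \<beta> G\<^sub>\<beta> u\<close>, where \<open>G\<^sub>\<beta>\<close> is the resolvent of \<open>E\<close>. Functions that agree almost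
  everywhere are not identified, so \<open>w\<close> is only determined up to null sets, and a relation avoids choosing a
  representative: sums and multiples of solutions are again solutions.
\<close>

definition resolves :: "real \<Rightarrow> ('a \<Rightarrow> real) \<Rightarrow> ('a \<Rightarrow> real) \<Rightarrow> bool" where
  "resolves \<beta> u w \<longleftrightarrow> u \<in> L2 \<and> w \<in> F \<and> (\<forall>v\<in>F. E w v + \<beta> * ip w v = \<beta> * ip u v)"

lemma resolvesD:
  assumes "resolves \<beta> u w"
  shows "u \<in> L2" "w \<in> F" "w \<in> L2" "v \<in> F \<Longrightarrow> E w v + \<beta> * ip w v = \<beta> * ip u v"
  using assms F_L2 by (auto simp: resolves_def)

lemma resolvent_exists:
  assumes "0 < \<beta>" "u \<in> L2"
  shows "\<exists>w. resolves \<beta> u w"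
proof -
  interpret Eb: semi_inner F "\<lambda>u v. E u v + \<beta> * ip u v" using assms by (intro semi_inner_shifted) simp
  have "\<exists>w\<in>F. \<forall>v\<in>F. E w v + \<beta> * ip w v = \<beta> * ip u v"
  proof (rule Eb.riesz_representation[OF complete_shifted[OF assms(1)] zero_F])
    fix v assume v: "v \<in> F"
    have "\<bar>\<beta> * ip u v\<bar> \<le> \<beta> * (sqrt (ip u u) * sqrt (ip v v))"
      using L2.cauchy_schwarz_abs[OF assms(2) F_L2[OF v]] assms(1) by (simp add: abs_mult)
    also have "\<dots> = \<beta> * sqrt (ip u u) / sqrt \<beta> * sqrt (\<beta> * ip v v)"
      using assms(1) by (simp add: real_sqrt_mult)
    also have "\<dots> \<le> \<beta> * sqrt (ip u u) / sqrt \<beta> * sqrt (E v v + \<beta> * ip v v)"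
      using assms v by (intro mult_left_mono) (auto simp: En.b_nonneg L2.b_nonneg)
    finally show "\<bar>\<beta> * ip u v\<bar> \<le> \<beta> * sqrt (ip u u) / sqrt \<beta> * sqrt (E v v + \<beta> * ip v v)" .
  qed (use assms in \<open>auto simp: L2.b_add_right L2.b_scale_right F_L2 algebra_simps\<close>)
  then show ?thesis using assms(2) by (auto simp: resolves_def)
qed

lemma resolves_add: "resolves \<beta> u w \<Longrightarrow> resolves \<beta> u' w' \<Longrightarrow> resolves \<beta> (\<lambda>x. u x + u' x) (\<lambda>x. w x + w' x)"
  unfolding resolves_def by (simp add: L2.add En.add En.b_add L2.b_add F_L2 algebra_simps)

lemma resolves_scale:
  assumes "resolves \<beta> u w" shows "resolves \<beta> (\<lambda>x. c * u x) (\<lambda>x. c * w x)"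
  unfolding resolves_def
proof (intro conjI ballI)
  note r = resolvesD[OF assms]
  show "(\<lambda>x. c * u x) \<in> L2" "(\<lambda>x. c * w x) \<in> F" using r by (auto intro: L2.scale En.scale)
  fix v assume v: "v \<in> F"
  have "E (\<lambda>x. c * w x) v + \<beta> * ip (\<lambda>x. c * w x) v = c * (E w v + \<beta> * ip w v)"
    using En.b_scale[OF r(2) v, of c] L2.b_scale[OF r(3) F_L2[OF v], of c] by (simp add: algebra_simps)
  also have "\<dots> = c * (\<beta> * ip u v)" by (simp only: r(4)[OF v])
  also have "\<dots> = \<beta> * ip (\<lambda>x. c * u x) v" using L2.b_scale[OF r(1) F_L2[OF v], of c] by simp
  finally show "E (\<lambda>x. c * w x) v + \<beta> * ip (\<lambda>x. c * w x) v = \<beta> * ip (\<lambda>x. c * u x) v" .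
qed

lemma resolves_diff: "resolves \<beta> u w \<Longrightarrow> resolves \<beta> u' w' \<Longrightarrow> resolves \<beta> (\<lambda>x. u x - u' x) (\<lambda>x. w x - w' x)"
  using resolves_add[OF _ resolves_scale, of \<beta> u w u' w' "-1"] by simp

lemma resolves_zero: "resolves \<beta> (\<lambda>x. 0) (\<lambda>x. 0)"
  unfolding resolves_def using zero_F F_L2 En.b_scale[of "\<lambda>x. 0" _ 0] by (auto simp: L2_inner_def)

lemma resolves_sum: "(\<And>i. i \<in> I \<Longrightarrow> resolves \<beta> (u i) (w i)) \<Longrightarrow>
    resolves \<beta> (\<lambda>x. \<Sum>i\<in>I. u i x) (\<lambda>x. \<Sum>i\<in>I. w i x)"
  by (induction I rule: infinite_finite_induct) (auto simp: resolves_zero intro!: resolves_add)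

lemma resolves_contraction:
  assumes "0 < \<beta>" "resolves \<beta> u w"
  shows "ip w w \<le> ip u u"
proof -
  note r = resolvesD[OF assms(2)]
  have "\<beta> * ip w w \<le> \<beta> * ip u w" using r(4)[OF r(2)] En.b_nonneg[OF r(2)] by linarith
  then have "ip w w \<le> ip u w" using assms(1) by simp
  moreover have "0 \<le> ip u u - 2 * ip u w + ip w w"
    using L2.b_nonneg[OF L2.diff[OF r(1,3)]] L2.b_square_diff[OF r(1,3)] by simp
  ultimately show ?thesis by linarith
qed

lemma resolves_sym:
  assumes "0 < \<beta>" "resolves \<beta> u w" "resolves \<beta> u' w'"
  shows "ip w u' = ip w' u"
proof -
  note r = resolvesD[OF assms(2)] and r' = resolvesD[OF assms(3)]
  have "E w w' + \<beta> * ip w w' = E w' w + \<beta> * ip w' w"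
    using En.b_sym[OF r(2) r'(2)] L2.b_sym[OF r(3) r'(3)] by simp
  then have "\<beta> * ip u w' = \<beta> * ip u' w" using r(4)[OF r'(2)] r'(4)[OF r(2)] by linarith
  then show ?thesis using assms(1) L2.b_sym[OF r(3) r'(1)] L2.b_sym[OF r'(3) r(1)] by simp
qed

text \<open>
  \<open>w\<close> minimises \<open>v \<mapsto> E v v + \<beta> \<parallel>v - u\<parallel>\<^sup>2\<close> over \<open>F\<close>, with minimum \<open>\<beta> \<langle>u - w, u\<rangle>\<close>; this is the exact
  value at any other \<open>v\<close>.
\<close>

lemma resolvent_variation:
  assumes "resolves \<beta> u w" "v \<in> F"
  shows "E v v + \<beta> * qip (\<lambda>x. v x - u x)
    = \<beta> * ip (\<lambda>x. u x - w x) u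
      + (qE (\<lambda>x. v x - w x) + \<beta> * qip (\<lambda>x. v x - w x))"
proof -
  note r = resolvesD[OF assms(1)]
  have vL: "v \<in> L2" using assms(2) by (rule F_L2)
  have "E v w = \<beta> * ip v u - \<beta> * ip v w"
    using r(4)[OF assms(2)] En.b_sym[OF r(2) assms(2)] L2.b_sym[OF r(3) vL] L2.b_sym[OF r(1) vL]
    by simp
  moreover have "E w w = \<beta> * ip w u - \<beta> * ip w w"
    using r(4)[OF r(2)] L2.b_sym[OF r(1,3)] by simp
  ultimately show ?thesis
    by (simp add: En.b_square_diff[OF assms(2) r(2)] L2.b_square_diff[OF vL r(1)]
        L2.b_square_diff[OF vL r(3)] L2.b_diff[OF r(1,3,1)] algebra_simps)
qed

lemma unit_contraction:
  assumes "u \<in> F"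
  shows "(\<lambda>x. min (max (u x) 0) 1) \<in> F"
    "E (\<lambda>x. min (max (u x) 0) 1) (\<lambda>x. min (max (u x) 0) 1) \<le> E u u"
  using form assms unfolding dirichlet_form_def markovian_form_def by auto

text \<open>
  Truncating \<open>w\<close> to \<open>[0, 1]\<close> does not increase \<open>E\<close>, and it brings \<open>w\<close> closer to \<open>u\<close>, whose values
  lie in \<open>[0, 1]\<close>. So the truncation minimises the same functional, and minimisers agree almost everywhere.
\<close>

lemma resolves_markov:
  assumes "0 < \<beta>" "resolves \<beta> u w" "\<And>x. 0 \<le> u x \<and> u x \<le> 1"
  shows "AE x in \<mu>. 0 \<le> w x \<and> w x \<le> 1"
proof -
  note r = resolvesD[OF assms(2)]
  define v where "v = (\<lambda>x. min (max (w x) 0) 1)"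
  have v: "v \<in> F" "E v v \<le> E w w" using unit_contraction[OF r(2)] by (auto simp: v_def)
  have "\<bar>v x - u x\<bar> \<le> \<bar>w x - u x\<bar>" for x using assms(3)[of x] by (auto simp: v_def)
  then have "qip (\<lambda>x. v x - u x) \<le> qip (\<lambda>x. w x - u x)"
    by (intro L2_inner_mono L2.diff r F_L2 v)
  then have "E v v + \<beta> * qip (\<lambda>x. v x - u x) \<le> E w w + \<beta> * qip (\<lambda>x. w x - u x)"
    using v(2) assms(1) by (intro add_mono mult_left_mono) auto
  then have "qE (\<lambda>x. v x - w x) + \<beta> * qip (\<lambda>x. v x - w x)
     \<le> qE (\<lambda>x. w x - w x) + \<beta> * qip (\<lambda>x. w x - w x)"
    using resolvent_variation[OF assms(2) v(1)] resolvent_variation[OF assms(2) r(2)] by linarith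
  also have "\<dots> = 0" using En.b_square_diff[OF r(2,2)] L2.b_square_diff[OF r(3,3)] by simp
  finally have "\<beta> * qip (\<lambda>x. v x - w x) \<le> 0"
    using En.b_nonneg[OF En.diff[OF v(1) r(2)]] by linarith
  then have "qip (\<lambda>x. v x - w x) = 0"
    using assms(1) L2.b_nonneg[OF L2.diff[OF F_L2[OF v(1)] r(3)]] by (simp add: mult_le_0_iff)
  then have "AE x in \<mu>. v x - w x = 0" by (intro L2_inner_zero_AE L2.diff F_L2[OF v(1)] r(3))
  then show ?thesis by eventually_elim (auto simp: v_def)
qed

lemma resolves_nonneg:
  assumes "0 < \<beta>" "resolves \<beta> u w" "\<And>x. 0 \<le> u x \<and> u x \<le> c"
  shows "AE x in \<mu>. 0 \<le> w x"
proof -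
  define d where "d = \<bar>c\<bar> + 1"
  have "0 < d" "c \<le> d" by (auto simp: d_def)
  have "AE x in \<mu>. 0 \<le> inverse d * w x \<and> inverse d * w x \<le> 1"
  proof (rule resolves_markov[OF assms(1) resolves_scale[OF assms(2)]])
    fix x show "0 \<le> inverse d * u x \<and> inverse d * u x \<le> 1"
      using assms(3)[of x] \<open>0 < d\<close> \<open>c \<le> d\<close> by (auto simp: field_simps)
  qed
  then show ?thesis by eventually_elim (use \<open>0 < d\<close> in \<open>simp add: zero_le_mult_iff\<close>)
qed

section \<open>From pointwise inequalities to energy inequalities\<close>

text \<open>
  Positivity of the operator \<open>S\<close> that maps \<open>p\<^sub>i\<close> to \<open>w\<^sub>i\<close> extends to functions of two variables. For
  each fixed \<open>y\<close>, the function \<open>\<Sum>i. q\<^sub>i y p\<^sub>i\<close> is nonnegative, hence so is \<open>\<Sum>i. q\<^sub>i y w\<^sub>i\<close> almost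
  everywhere. The exceptional null set depends on \<open>y\<close>; it is made independent of \<open>y\<close> by choosing the
  coefficient vectors from a countable dense subset of all vectors \<open>(q\<^sub>i y)\<^sub>i\<close>. Then \<open>y = x\<close> can be
  inserted. This does the work of a kernel that represents \<open>S\<close>.
\<close>

lemma resolvent_tensor_nonneg:
  fixes p q w :: "'i::countable \<Rightarrow> 'a \<Rightarrow> real"
  assumes "finite I" "0 < \<beta>"
    and p: "\<And>i. i \<in> I \<Longrightarrow> resolves \<beta> (p i) (w i)" "\<And>i x. i \<in> I \<Longrightarrow> \<bar>p i x\<bar> \<le> c"
    and q: "\<And>i. i \<in> I \<Longrightarrow> q i \<in> L2"
    and nonneg: "\<And>x y. 0 \<le> (\<Sum>i\<in>I. p i x * q i y)"
  shows "0 \<le> (\<Sum>i\<in>I. ip (w i) (q i))"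
proof -
  define S where "S = range (\<lambda>y i. q i y)"
  obtain T where T: "countable T" "T \<subseteq> S" "S \<subseteq> closure T"
    using separable[of S] by blast
  have "AE x in \<mu>. 0 \<le> (\<Sum>i\<in>I. t i * w i x)" if "t \<in> T" for t
  proof -
    obtain y where y: "t = (\<lambda>i. q i y)" using \<open>t \<in> T\<close> T(2) by (auto simp: S_def)
    show ?thesis
    proof (rule resolves_nonneg[OF assms(2) resolves_sum])
      show "resolves \<beta> (\<lambda>x. t i * p i x) (\<lambda>x. t i * w i x)" if "i \<in> I" for i
        using p(1)[OF that] by (rule resolves_scale)
      fix x
      have "(\<Sum>i\<in>I. t i * p i x) \<le> (\<Sum>i\<in>I. \<bar>t i\<bar> * c)"
        using p(2) by (intro sum_mono) (metis abs_ge_self abs_ge_zero abs_mult mult_left_mono order_trans)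
      then show "0 \<le> (\<Sum>i\<in>I. t i * p i x) \<and> (\<Sum>i\<in>I. t i * p i x) \<le> (\<Sum>i\<in>I. \<bar>t i\<bar> * c)"
        using nonneg[of x y] by (simp add: y mult.commute)
    qed
  qed
  then have "AE x in \<mu>. \<forall>t\<in>T. 0 \<le> (\<Sum>i\<in>I. t i * w i x)"
    using T(1) by (simp add: AE_ball_countable)
  then have "AE x in \<mu>. 0 \<le> (\<Sum>i\<in>I. w i x * q i x)"
  proof eventually_elim
    case (elim x)
    have "closed {t. 0 \<le> (\<Sum>i\<in>I. t i * w i x)}"
      by (intro closed_Collect_le continuous_intros continuous_on_product_coordinates)
    then have "closure T \<subseteq> {t. 0 \<le> (\<Sum>i\<in>I. t i * w i x)}" using elim by (intro closure_minimal) auto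
    then have "(\<lambda>i. q i x) \<in> {t. 0 \<le> (\<Sum>i\<in>I. t i * w i x)}" using T(3) by (auto simp: S_def)
    then show ?case by (simp add: mult.commute)
  qed
  then have "0 \<le> (\<integral>x. (\<Sum>i\<in>I. w i x * q i x) \<partial>\<mu>)" by (rule integral_nonneg_AE)
  also have "\<dots> = (\<Sum>i\<in>I. ip (w i) (q i))"
    unfolding L2_inner_def using resolvesD(3)[OF p(1)] q
    by (intro Bochner_Integration.integral_sum L2_product_integrable) auto
  finally show ?thesis .
qed

lemma L2_tendsto_truncation:
  assumes "u \<in> L2" and [measurable]: "\<And>n. A n \<in> sets \<mu>"
    and "\<And>x. x \<in> space \<mu> \<Longrightarrow> u x \<noteq> 0 \<Longrightarrow> eventually (\<lambda>n. x \<in> A n) sequentially"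
  shows "\<And>n. (\<lambda>x. u x * indicator (A n) x) \<in> L2"
    "(\<lambda>n. qip (\<lambda>x. u x * indicator (A n) x - u x)) \<longlonglongrightarrow> 0"
proof -
  note [measurable] = L2_space_measurable[OF assms(1)]
  show "(\<lambda>x. u x * indicator (A n) x) \<in> L2" for n
    by (rule L2_spaceI[OF _ L2_space_integrable[OF assms(1)]]) (auto simp: indicator_def)
  have "(\<lambda>n. \<integral>x. (u x * indicator (A n) x - u x) * (u x * indicator (A n) x - u x) \<partial>\<mu>) \<longlonglongrightarrow> (\<integral>x. 0 \<partial>\<mu>)"
  proof (rule integral_dominated_convergence)
    show "integrable \<mu> (\<lambda>x. (u x)\<^sup>2)" using assms(1) by (rule L2_space_integrable)
    show "AE x in \<mu>. (\<lambda>n. (u x * indicator (A n) x - u x) * (u x * indicator (A n) x - u x)) \<longlonglongrightarrow> 0"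
    proof (rule AE_I2)
      fix x assume x: "x \<in> space \<mu>"
      have "eventually (\<lambda>n. (u x * indicator (A n) x - u x) * (u x * indicator (A n) x - u x) = 0) sequentially"
      proof (cases "u x = 0")
        case False
        from assms(3)[OF x this] show ?thesis by eventually_elim simp
      qed simp
      then show "(\<lambda>n. (u x * indicator (A n) x - u x) * (u x * indicator (A n) x - u x)) \<longlonglongrightarrow> 0"
        by (rule tendsto_eventually)
    qed
    show "AE x in \<mu>. norm ((u x * indicator (A n) x - u x) * (u x * indicator (A n) x - u x)) \<le> (u x)\<^sup>2" for n
      by (intro AE_I2) (auto simp: indicator_def power2_eq_square)
  qed measurable
  then show "(\<lambda>n. qip (\<lambda>x. u x * indicator (A n) x - u x)) \<longlonglongrightarrow> 0"
    by (simp add: L2_inner_def)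
qed

text \<open>
  Put \<open>h = \<Sum>i. a\<^sub>i b\<^sub>i\<close>. The hypothesis \<open>jump\<close> reads
  \<open>\<Sum>i. a\<^sub>i x b\<^sub>i y + b\<^sub>i x a\<^sub>i y \<le> h x + h y\<close>, which is positivity of a tensor, except that \<open>h\<close> and the
  constant function \<open>1\<close> need not be in \<open>L\<^sub>2\<close> and that \<open>a\<close> and \<open>b\<close> need not be bounded. Multiplying in both
  variables by the indicator \<open>\<kappa>\<close> of a set \<open>A\<^sub>n\<close> of finite measure on which all functions are bounded
  repairs this. Then \<open>\<langle>S \<kappa>, h \<kappa>\<rangle> \<le> \<integral> h\<close> because \<open>S \<kappa> \<le> 1\<close> and \<open>h \<ge> 0\<close> by
  \<open>kill\<close>, and the sets \<open>A\<^sub>n\<close> exhaust everything but the common zeros of the \<open>a\<^sub>i\<close> and \<open>b\<^sub>i\<close>.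
\<close>

lemma resolvent_energy_nonneg:
  fixes a b w :: "nat \<Rightarrow> 'a \<Rightarrow> real"
  assumes \<beta>: "0 < \<beta>"
    and a: "\<And>i. i < N \<Longrightarrow> resolves \<beta> (a i) (w i)" and b: "\<And>i. i < N \<Longrightarrow> b i \<in> L2"
    and jump: "\<And>x y. 0 \<le> (\<Sum>i<N. (a i x - a i y) * (b i x - b i y))"
    and kill: "\<And>x. 0 \<le> (\<Sum>i<N. a i x * b i x)"
  shows "0 \<le> (\<Sum>i<N. ip (\<lambda>x. a i x - w i x) (b i))"
proof -
  have aL: "a i \<in> L2" if "i < N" for i using resolvesD(1)[OF a[OF that]] .
  have wL: "w i \<in> L2" if "i < N" for i using resolvesD(3)[OF a[OF that]] .
  have meas: "a i \<in> borel_measurable \<mu>" "b i \<in> borel_measurable \<mu>" if "i < N" for i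
    using aL[OF that] b[OF that] by (auto dest: L2_space_measurable)
  define h where "h x = (\<Sum>i<N. a i x * b i x)" for x
  define q where "q x = (\<Sum>i<N. (a i x)\<^sup>2 + (b i x)\<^sup>2)" for x
  have [measurable]: "h \<in> borel_measurable \<mu>" "q \<in> borel_measurable \<mu>"
    unfolding h_def q_def using meas by (auto intro!: borel_measurable_sum borel_measurable_times borel_measurable_add borel_measurable_power)
  have h_int: "integrable \<mu> h" unfolding h_def
    using aL b by (intro Bochner_Integration.integrable_sum L2_product_integrable) auto
  have q_int: "integrable \<mu> q" unfolding q_def
    using aL b by (intro Bochner_Integration.integrable_sum Bochner_Integration.integrable_add L2_space_integrable) auto
  have q_nonneg: "0 \<le> q x" for x unfolding q_def by (intro sum_nonneg) simp
  have ab_q: "(a i x)\<^sup>2 + (b i x)\<^sup>2 \<le> q x" if "i < N" for i x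
    unfolding q_def using that by (intro member_le_sum[where f = "\<lambda>i. (a i x)\<^sup>2 + (b i x)\<^sup>2"]) auto
  have h_q: "h x \<le> q x" for x
    unfolding h_def q_def
  proof (rule sum_mono)
    fix i
    show "a i x * b i x \<le> (a i x)\<^sup>2 + (b i x)\<^sup>2"
      using sum_squares_bound[of "a i x" "b i x"] sum_power2_ge_zero[of "a i x" "b i x"]
      by (simp only: mult.assoc)
  qed
  have h_nonneg: "0 \<le> h x" for x using kill by (simp add: h_def)
  define A where "A n = {x \<in> space \<mu>. 1 / real (Suc n) \<le> q x \<and> q x \<le> real (Suc n)}" for n
  have [measurable]: "A n \<in> sets \<mu>" for n unfolding A_def by measurable
  have q_eventually: "eventually (\<lambda>n. x \<in> A n) sequentially" if x: "x \<in> space \<mu>" "q x \<noteq> 0" for x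
  proof -
    have "0 < q x" using q_nonneg[of x] that by simp
    have "eventually (\<lambda>n. 1 / real (Suc n) < q x) sequentially"
      using LIMSEQ_Suc[OF lim_1_over_n] \<open>0 < q x\<close> by (rule order_tendstoD)
    moreover have "eventually (\<lambda>n. q x \<le> real (Suc n)) sequentially"
      using eventually_ge_at_top[of "nat \<lceil>q x\<rceil>"] by eventually_elim linarith
    ultimately show ?thesis by eventually_elim (use x in \<open>auto simp: A_def\<close>)
  qed
  have ne: "q x \<noteq> 0" if "i < N" "a i x \<noteq> 0 \<or> b i x \<noteq> 0" for i x
  proof -
    have "0 < (a i x)\<^sup>2 + (b i x)\<^sup>2" using that(2) by (auto simp: sum_power2_gt_zero_iff)
    then show ?thesis using ab_q[OF that(1), of x] by linarith
  qed
  define a' where "a' n i x = a i x * indicator (A n) x" for n i x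
  define b' where "b' n i x = b i x * indicator (A n) x" for n i x
  have a'L: "a' n i \<in> L2" and a'_lim: "(\<lambda>n. qip (\<lambda>x. a' n i x - a i x)) \<longlonglongrightarrow> 0"
    if "i < N" for n i
    using L2_tendsto_truncation[OF aL[OF that], of A] q_eventually ne[OF that] unfolding a'_def by auto
  have b'L: "b' n i \<in> L2" and b'_lim: "(\<lambda>n. qip (\<lambda>x. b' n i x - b i x)) \<longlonglongrightarrow> 0"
    if "i < N" for n i
    using L2_tendsto_truncation[OF b[OF that], of A] q_eventually ne[OF that] unfolding b'_def by auto
  define r where "r n i = (SOME z. resolves \<beta> (a' n i) z)" for n i
  have r: "resolves \<beta> (a' n i) (r n i)" if "i < N" for n i
    unfolding r_def using resolvent_exists[OF \<beta> a'L[OF that]] by (rule someI_ex)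
  have r_lim: "(\<lambda>n. qip (\<lambda>x. r n i x - w i x)) \<longlonglongrightarrow> 0" if i: "i < N" for i
  proof (rule tendsto_sandwich[OF _ _ tendsto_const a'_lim[OF i]])
    have d: "resolves \<beta> (\<lambda>x. a' n i x - a i x) (\<lambda>x. r n i x - w i x)" for n
      by (rule resolves_diff[OF r[OF i] a[OF i]])
    show "\<forall>\<^sub>F n in sequentially. 0 \<le> qip (\<lambda>x. r n i x - w i x)"
      using resolvesD(3)[OF d] by (intro always_eventually allI L2.b_nonneg)
    show "\<forall>\<^sub>F n in sequentially. qip (\<lambda>x. r n i x - w i x)
        \<le> qip (\<lambda>x. a' n i x - a i x)"
      using resolves_contraction[OF \<beta> d] by simp
  qed
  have bound: "(\<Sum>i<N. ip (r n i) (b' n i)) \<le> (\<integral>x. h x \<partial>\<mu>)" for n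
  proof -
    define \<kappa> :: "'a \<Rightarrow> real" where "\<kappa> = indicator (A n)"
    have \<kappa>_range: "0 \<le> \<kappa> x" "\<kappa> x \<le> 1" "\<kappa> x * \<kappa> x = \<kappa> x" for x by (auto simp: \<kappa>_def indicator_def)
    have [measurable]: "\<kappa> \<in> borel_measurable \<mu>" unfolding \<kappa>_def by measurable
    have "emeasure \<mu> (A n) \<le> emeasure \<mu> {x \<in> space \<mu>. 1 / real (Suc n) \<le> q x}"
      by (rule emeasure_mono) (auto simp: A_def)
    also have "\<dots> \<le> ennreal (1 / (1 / real (Suc n)) * (\<integral>x. q x \<partial>\<mu>))"
      using q_int q_nonneg by (intro integral_Markov_inequality) auto
    also have "\<dots> < \<infinity>" by simp
    finally have \<kappa>_int: "integrable \<mu> \<kappa>" unfolding \<kappa>_def by (intro integrable_real_indicator) auto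
    have \<kappa>L: "\<kappa> \<in> L2"
      by (rule L2_spaceI[OF _ \<kappa>_int]) (auto simp: power2_eq_square \<kappa>_range)
    have le_q: "u * \<kappa> x \<le> real (Suc n)" if "u \<le> q x" for u x
      using that by (auto simp: \<kappa>_def A_def indicator_def)
    have hL: "(\<lambda>x. h x * \<kappa> x) \<in> L2"
    proof (rule L2_spaceI)
      show "integrable \<mu> (\<lambda>x. real (Suc n) * h x)" using h_int by simp
      fix x
      have "(h x * \<kappa> x)\<^sup>2 = (h x * \<kappa> x) * h x"
        by (auto simp: power2_eq_square \<kappa>_def indicator_def)
      also have "\<dots> \<le> real (Suc n) * h x" using le_q[OF h_q] h_nonneg by (rule mult_right_mono)
      finally show "(h x * \<kappa> x)\<^sup>2 \<le> real (Suc n) * h x" .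
    qed measurable
    define rb where "rb i = (SOME z. resolves \<beta> (b' n i) z)" for i
    have rb: "resolves \<beta> (b' n i) (rb i)" if "i < N" for i
      unfolding rb_def using resolvent_exists[OF \<beta> b'L[OF that]] by (rule someI_ex)
    obtain rh where rh: "resolves \<beta> (\<lambda>x. h x * \<kappa> x) rh" using resolvent_exists[OF \<beta> hL] by blast
    obtain r1 where r1: "resolves \<beta> \<kappa> r1" using resolvent_exists[OF \<beta> \<kappa>L] by blast
    \<comment> \<open>the tensors \<open>- a \<otimes> b\<close>, \<open>- b \<otimes> a\<close>, \<open>h \<otimes> 1\<close> and \<open>1 \<otimes> h\<close>, all multiplied by \<open>\<kappa> \<otimes> \<kappa>\<close>\<close>
    let ?I = "{..<N} <+> ({..<N} <+> (UNIV :: bool set))"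
    let ?p = "case_sum (\<lambda>i x. - 1 * a' n i x) (case_sum (\<lambda>i x. - 1 * b' n i x)
        (\<lambda>c. if c then \<lambda>x. h x * \<kappa> x else \<kappa>))"
    let ?w = "case_sum (\<lambda>i x. - 1 * r n i x) (case_sum (\<lambda>i x. - 1 * rb i x) (\<lambda>c. if c then rh else r1))"
    let ?q = "case_sum (b' n) (case_sum (a' n) (\<lambda>c. if c then \<kappa> else (\<lambda>x. h x * \<kappa> x)))"
    have small: "\<bar>u * \<kappa> x\<bar> \<le> real (Suc n)" if "u\<^sup>2 \<le> q x" for u x
    proof (rule power2_le_imp_le)
      have "(u * \<kappa> x)\<^sup>2 = u\<^sup>2 * \<kappa> x"
        by (auto simp: \<kappa>_def indicator_def)
      also have "\<dots> \<le> real (Suc n)" by (rule le_q[OF that])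
      also have "\<dots> \<le> (real (Suc n))\<^sup>2" by (simp add: power2_eq_square)
      finally show "\<bar>u * \<kappa> x\<bar>\<^sup>2 \<le> (real (Suc n))\<^sup>2" by simp
    qed simp
    have "0 \<le> (\<Sum>i\<in>?I. ip (?w i) (?q i))"
    proof (rule resolvent_tensor_nonneg[OF _ \<beta>])
      show "finite ?I" by simp
      show "resolves \<beta> (?p i) (?w i)" if "i \<in> ?I" for i
        using that resolves_scale[OF r, where c = "-1"] resolves_scale[OF rb, where c = "-1"] rh r1
        by (auto split: if_splits)
      show "?q i \<in> L2" if "i \<in> ?I" for i
        using that a'L b'L \<kappa>L hL by (auto split: if_splits)
      show "\<bar>?p i x\<bar> \<le> real (Suc n)" if "i \<in> ?I" for i x
      proof -
        have "\<bar>a' n i x\<bar> \<le> real (Suc n)" "\<bar>b' n i x\<bar> \<le> real (Suc n)" if "i < N" for i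
          using small[of "a i x" x] small[of "b i x" x] ab_q[OF that, of x]
            zero_le_power2[of "a i x"] zero_le_power2[of "b i x"] unfolding a'_def b'_def \<kappa>_def by linarith+
        moreover have "\<bar>h x * \<kappa> x\<bar> \<le> real (Suc n)" using le_q[OF h_q] h_nonneg[of x] \<kappa>_range(1)[of x] by simp
        moreover have "\<bar>\<kappa> x\<bar> \<le> real (Suc n)" using \<kappa>_range[of x] by simp
        ultimately show ?thesis using that by (auto split: if_splits)
      qed
      show "0 \<le> (\<Sum>i\<in>?I. ?p i x * ?q i y)" for x y
      proof -
        have "(\<Sum>i\<in>?I. ?p i x * ?q i y) = (\<Sum>i<N. - (a' n i x * b' n i y)) + ((\<Sum>i<N. - (b' n i x * a' n i y))
            + (h x * \<kappa> x * \<kappa> y + \<kappa> x * (h y * \<kappa> y)))"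
          by (simp add: sum.Plus UNIV_bool add.commute)
        also have "\<dots> = \<kappa> x * \<kappa> y * (\<Sum>i<N. (a i x - a i y) * (b i x - b i y))"
          unfolding h_def a'_def b'_def \<kappa>_def
          by (simp add: sum_distrib_left sum_distrib_right sum_subtractf sum.distrib sum_negf algebra_simps)
        finally show ?thesis using jump[of x y] \<kappa>_range by simp
      qed
    qed
    also have "\<dots> = (\<Sum>i<N. - ip (r n i) (b' n i)) + ((\<Sum>i<N. - ip (rb i) (a' n i))
          + (ip rh \<kappa> + ip r1 (\<lambda>x. h x * \<kappa> x)))"
      using L2.b_scale[OF resolvesD(3)[OF r] b'L, where c = "-1"] L2.b_scale[OF resolvesD(3)[OF rb] a'L, where c = "-1"]
      by (simp add: sum.Plus UNIV_bool add.commute)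
    also have "(\<Sum>i<N. - ip (rb i) (a' n i)) = (\<Sum>i<N. - ip (r n i) (b' n i))"
      using resolves_sym[OF \<beta> r rb] by simp
    also have "ip rh \<kappa> = ip r1 (\<lambda>x. h x * \<kappa> x)" by (rule resolves_sym[OF \<beta> rh r1])
    finally have "(\<Sum>i<N. ip (r n i) (b' n i)) \<le> ip r1 (\<lambda>x. h x * \<kappa> x)" by (simp add: sum_negf)
    also have "\<dots> \<le> (\<integral>x. h x \<partial>\<mu>)"
      unfolding L2_inner_def
    proof (rule integral_mono_AE[OF L2_product_integrable[OF resolvesD(3)[OF r1] hL] h_int])
      have "AE x in \<mu>. 0 \<le> r1 x \<and> r1 x \<le> 1" using resolves_markov[OF \<beta> r1] \<kappa>_range by simp
      then show "AE x in \<mu>. r1 x * (h x * \<kappa> x) \<le> h x"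
      proof eventually_elim
        case (elim x)
        have "r1 x * (h x * \<kappa> x) \<le> 1 * (h x * 1)"
          using elim h_nonneg[of x] \<kappa>_range[of x] by (intro mult_mono) auto
        then show ?case by simp
      qed
    qed
    finally show ?thesis .
  qed
  have "(\<lambda>n. \<Sum>i<N. ip (r n i) (b' n i)) \<longlonglongrightarrow> (\<Sum>i<N. ip (w i) (b i))"
  proof (rule tendsto_sum)
    fix i assume "i \<in> {..<N}"
    then have i: "i < N" by simp
    show "(\<lambda>n. ip (r n i) (b' n i)) \<longlonglongrightarrow> ip (w i) (b i)"
      using resolvesD(3)[OF r[OF i]] wL[OF i] r_lim[OF i] b'L[OF i] b[OF i] b'_lim[OF i]
      by (rule L2.tendsto_both)
  qed
  then have "(\<Sum>i<N. ip (w i) (b i)) \<le> (\<integral>x. h x \<partial>\<mu>)"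
    using bound by (intro LIMSEQ_le_const2) auto
  also have "\<dots> = (\<Sum>i<N. ip (a i) (b i))"
    unfolding h_def L2_inner_def using aL b by (intro Bochner_Integration.integral_sum L2_product_integrable) auto
  finally show ?thesis using L2.b_diff[OF aL wL b] by (simp add: sum_subtractf)
qed

text \<open>
  The approximating energies \<open>e n = \<beta> \<langle>u - w\<^sub>n, u\<rangle>\<close>, with \<open>\<beta> = n + 1\<close>, are minima of functionals that
  increase with \<open>\<beta>\<close>. They are therefore increasing, and \<open>resolvent_variation\<close> bounds the distance of two
  approximants by \<open>e m - e n\<close>. If they are bounded, the approximants form a Cauchy sequence for \<open>E\<^sub>1\<close>,
  and the limit can only be \<open>u\<close>.
\<close>

lemma resolvent_approximation:
  assumes u: "u \<in> L2" and w: "\<And>n. resolves (real (Suc n)) u (w n)"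
    and bound: "\<And>n. real (Suc n) * ip (\<lambda>x. u x - w n x) u \<le> C"
  shows "u \<in> F" "(\<lambda>n. E1 \<mu> E (\<lambda>x. w n x - u x)) \<longlonglongrightarrow> 0"
proof -
  define e where "e n = real (Suc n) * ip (\<lambda>x. u x - w n x) u" for n
  note wF = resolvesD(2)[OF w] and wL = resolvesD(3)[OF w]
  have e_eq: "e n = E (w n) (w n) + real (Suc n) * qip (\<lambda>x. w n x - u x)" for n
    using resolvent_variation[OF w wF, of n] En.b_square_diff[OF wF wF] L2.b_square_diff[OF wL wL]
    by (simp add: e_def)
  have step: "E1 \<mu> E (\<lambda>x. w m x - w n x) \<le> e m - e n" if "n \<le> m" for m n
  proof -
    have nn: "0 \<le> qip (\<lambda>x. w m x - u x)" "0 \<le> qip (\<lambda>x. w m x - w n x)"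
      by (intro L2.b_nonneg L2.diff wL u)+
    have "e n + (qE (\<lambda>x. w m x - w n x) + real (Suc n) * qip (\<lambda>x. w m x - w n x))
        = E (w m) (w m) + real (Suc n) * qip (\<lambda>x. w m x - u x)"
      using resolvent_variation[OF w[of n] wF[of m]] by (simp add: e_def)
    moreover have "real (Suc n) * qip (\<lambda>x. w m x - u x) \<le> real (Suc m) * qip (\<lambda>x. w m x - u x)"
      using that nn by (intro mult_right_mono) auto
    moreover have "1 * qip (\<lambda>x. w m x - w n x) \<le> real (Suc n) * qip (\<lambda>x. w m x - w n x)"
      using nn by (intro mult_right_mono) auto
    ultimately show ?thesis unfolding E1_eq e_eq[of m] by linarith
  qed
  have "incseq e" using step E1_nonneg[OF En.diff[OF wF wF]] unfolding incseq_def by (meson diff_ge_0_iff_ge order_trans)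
  moreover have "e n \<le> C" for n using bound by (simp add: e_def)
  ultimately obtain l where "e \<longlonglongrightarrow> l" using incseq_convergent by metis
  then have "Cauchy e" by (rule LIMSEQ_imp_Cauchy)
  have "\<exists>v\<in>F. (\<lambda>n. E1 \<mu> E (\<lambda>x. w n x - v x)) \<longlonglongrightarrow> 0"
  proof (rule closed[OF wF])
    fix \<epsilon> :: real assume "\<epsilon> > 0"
    then obtain N where N: "\<And>m n. m \<ge> N \<Longrightarrow> n \<ge> N \<Longrightarrow> dist (e m) (e n) < \<epsilon>"
      using \<open>Cauchy e\<close> unfolding Cauchy_def by blast
    have sym: "E1 \<mu> E (\<lambda>x. w m x - w n x) = E1 \<mu> E (\<lambda>x. w n x - w m x)" for m n
      unfolding E1_eq using En.dist_commute[OF wF wF] L2.dist_commute[OF wL wL] by simp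
    have "E1 \<mu> E (\<lambda>x. w m x - w n x) < \<epsilon>" if "m \<ge> N" "n \<ge> N" for m n
    proof (cases "n \<le> m")
      case True
      then show ?thesis using step[OF True] N[OF that] by (simp add: dist_real_def)
    next
      case False
      then show ?thesis using step[of m n] N[OF that] by (simp add: dist_real_def sym[of m n])
    qed
    then show "\<exists>N. \<forall>m\<ge>N. \<forall>n\<ge>N. E1 \<mu> E (\<lambda>x. w m x - w n x) < \<epsilon>" by blast
  qed
  then obtain v where v: "v \<in> F" "(\<lambda>n. E1 \<mu> E (\<lambda>x. w n x - v x)) \<longlonglongrightarrow> 0" by blast
  have vL: "v \<in> L2" using v(1) by (rule F_L2)
  have ip_u: "(\<lambda>n. qip (\<lambda>x. w n x - u x)) \<longlonglongrightarrow> 0"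
  proof (rule tendsto_sandwich[OF _ _ tendsto_const])
    show "\<forall>\<^sub>F n in sequentially. 0 \<le> qip (\<lambda>x. w n x - u x)"
      by (intro always_eventually allI L2.b_nonneg L2.diff wL u)
    show "\<forall>\<^sub>F n in sequentially. qip (\<lambda>x. w n x - u x) \<le> C * (1 / real (Suc n))"
    proof (intro always_eventually allI)
      fix n
      have "real (Suc n) * qip (\<lambda>x. w n x - u x) \<le> C"
        using e_eq[of n] bound[of n] En.b_nonneg[OF wF, of n] unfolding e_def by linarith
      then show "qip (\<lambda>x. w n x - u x) \<le> C * (1 / real (Suc n))"
        by (simp add: field_simps)
    qed
    show "(\<lambda>n. C * (1 / real (Suc n))) \<longlonglongrightarrow> 0"
      by (rule tendsto_eq_intros LIMSEQ_Suc[OF lim_1_over_n] refl | simp)+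
  qed
  have ip_v: "(\<lambda>n. qip (\<lambda>x. w n x - v x)) \<longlonglongrightarrow> 0"
  proof (rule tendsto_sandwich[OF _ _ tendsto_const v(2)])
    show "\<forall>\<^sub>F n in sequentially. 0 \<le> qip (\<lambda>x. w n x - v x)"
      by (intro always_eventually allI L2.b_nonneg L2.diff wL vL)
    show "\<forall>\<^sub>F n in sequentially. qip (\<lambda>x. w n x - v x) \<le> E1 \<mu> E (\<lambda>x. w n x - v x)"
      using En.b_nonneg[OF En.diff[OF wF v(1)]] by (simp add: E1_eq)
  qed
  have "qip (\<lambda>x. v x - u x) = 0"
  proof -
    have "(\<lambda>n. ip (w n) (\<lambda>x. v x - u x)) \<longlonglongrightarrow> ip u (\<lambda>x. v x - u x)"
      by (rule L2.tendsto_left[OF wL u ip_u L2.diff[OF vL u]])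
    moreover have "(\<lambda>n. ip (w n) (\<lambda>x. v x - u x)) \<longlonglongrightarrow> ip v (\<lambda>x. v x - u x)"
      by (rule L2.tendsto_left[OF wL vL ip_v L2.diff[OF vL u]])
    ultimately have "ip u (\<lambda>x. v x - u x) = ip v (\<lambda>x. v x - u x)" by (rule LIMSEQ_unique)
    then show ?thesis using L2.b_diff[OF vL u L2.diff[OF vL u]] by simp
  qed
  then have "AE x in \<mu>. v x - u x = 0" by (rule L2_inner_zero_AE[OF L2.diff[OF vL u]])
  then have vu: "AE x in \<mu>. v x = u x" by simp
  show uF: "u \<in> F" by (rule F_cong_AE(1)[OF v(1) u vu])
  have Evu: "E v z = E u z" if "z \<in> F" for z using F_cong_AE(2)[OF v(1) u vu that] .
  have "E1 \<mu> E (\<lambda>x. w n x - v x) = E1 \<mu> E (\<lambda>x. w n x - u x)" for n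
  proof -
    have "E v v = E u u" "E (w n) v = E (w n) u"
      using Evu[OF v(1)] Evu[OF uF] Evu[OF wF] En.b_sym[OF v(1) uF] En.b_sym[OF v(1) wF[of n]] En.b_sym[OF uF wF[of n]]
      by auto
    moreover have "qip (\<lambda>x. w n x - v x) = qip (\<lambda>x. w n x - u x)"
      unfolding L2_inner_def
    proof (rule integral_cong_AE)
      show "AE x in \<mu>. (w n x - v x) * (w n x - v x) = (w n x - u x) * (w n x - u x)"
        using vu by eventually_elim simp
    qed (intro borel_measurable_integrable L2_product_integrable L2.diff wL vL u)+
    ultimately show ?thesis unfolding E1_eq
      by (simp add: En.b_square_diff[OF wF v(1)] En.b_square_diff[OF wF uF])
  qed
  then show "(\<lambda>n. E1 \<mu> E (\<lambda>x. w n x - u x)) \<longlonglongrightarrow> 0" using v(2) by simp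
qed

text \<open>
  A choice of \<open>\<beta> G\<^sub>\<beta> u\<close> for \<open>\<beta> = n + 1\<close>; the shift keeps \<open>\<beta>\<close> positive.
\<close>

definition res :: "nat \<Rightarrow> ('a \<Rightarrow> real) \<Rightarrow> 'a \<Rightarrow> real" where
  "res n u = (SOME w. resolves (real (Suc n)) u w)"

lemma res: "u \<in> L2 \<Longrightarrow> resolves (real (Suc n)) u (res n u)"
  unfolding res_def by (rule someI_ex[OF resolvent_exists]) auto

lemma res_F: "u \<in> L2 \<Longrightarrow> res n u \<in> F"
  using resolvesD(2)[OF res] .

lemma E_res:
  assumes u: "u \<in> L2" and v: "v \<in> F"
  shows "E (res n u) v = real (Suc n) * ip (\<lambda>x. u x - res n u x) v"
proof -
  have "ip (\<lambda>x. u x - res n u x) v = ip u v - ip (res n u) v"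
    by (rule L2.b_diff[OF u F_L2[OF res_F[OF u]] F_L2[OF v]])
  then show ?thesis
    using resolvesD(4)[OF res[OF u] v, of n] by (simp only: right_diff_distrib)
qed

lemma res_energy_le:
  assumes "u \<in> F" shows "real (Suc n) * ip (\<lambda>x. u x - res n u x) u \<le> E u u"
proof -
  note r = res[OF F_L2[OF assms], of n]
  have d: "(\<lambda>x. u x - res n u x) \<in> F" using assms resolvesD(2)[OF r] by (rule En.diff)
  have "E u u + real (Suc n) * qip (\<lambda>x. u x - u x) = E u u" by (simp add: L2_inner_def)
  then show ?thesis using resolvent_variation[OF r assms] En.b_nonneg[OF d]
      mult_nonneg_nonneg[OF _ L2.b_nonneg[OF F_L2[OF d]], of "real (Suc n)"]
    by simp
qed

lemma res_tendsto:
  assumes "u \<in> F"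
  shows "(\<lambda>n. E1 \<mu> E (\<lambda>x. res n u x - u x)) \<longlonglongrightarrow> 0"
    "(\<lambda>n. qE (\<lambda>x. res n u x - u x)) \<longlonglongrightarrow> 0"
proof -
  show *: "(\<lambda>n. E1 \<mu> E (\<lambda>x. res n u x - u x)) \<longlonglongrightarrow> 0"
    by (rule resolvent_approximation(2)[OF F_L2[OF assms] res[OF F_L2[OF assms]] res_energy_le[OF assms]])
  have d: "(\<lambda>x. res n u x - u x) \<in> F" for n using res_F[OF F_L2[OF assms]] assms by (rule En.diff)
  show "(\<lambda>n. qE (\<lambda>x. res n u x - u x)) \<longlonglongrightarrow> 0"
    by (rule tendsto_sandwich[OF _ _ tendsto_const *])
      (use En.b_nonneg[OF d] L2.b_nonneg[OF F_L2[OF d]] in \<open>auto simp: E1_eq\<close>)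
qed

text \<open>
  The energy inequality principle: \<open>E\<close> inherits from its approximating forms the sign of a jump part
  and of a killing part.
\<close>

lemma energy_nonneg:
  fixes a b :: "nat \<Rightarrow> 'a \<Rightarrow> real"
  assumes ab: "\<And>i. i < N \<Longrightarrow> a i \<in> F" "\<And>i. i < N \<Longrightarrow> b i \<in> F"
    and jump: "\<And>x y. 0 \<le> (\<Sum>i<N. (a i x - a i y) * (b i x - b i y))"
    and kill: "\<And>x. 0 \<le> (\<Sum>i<N. a i x * b i x)"
  shows "0 \<le> (\<Sum>i<N. E (a i) (b i))"
proof (rule LIMSEQ_le_const)
  show "(\<lambda>n. \<Sum>i<N. E (res n (a i)) (b i)) \<longlonglongrightarrow> (\<Sum>i<N. E (a i) (b i))"
    using ab by (intro tendsto_sum En.tendsto_left res_F F_L2 res_tendsto) auto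
  have "0 \<le> (\<Sum>i<N. E (res n (a i)) (b i))" for n
  proof -
    have "0 \<le> (\<Sum>i<N. ip (\<lambda>x. a i x - res n (a i) x) (b i))"
      by (rule resolvent_energy_nonneg[OF _ res _ jump kill]) (use ab F_L2 in auto)
    then have "0 \<le> real (Suc n) * (\<Sum>i<N. ip (\<lambda>x. a i x - res n (a i) x) (b i))" by simp
    also have "\<dots> = (\<Sum>i<N. E (res n (a i)) (b i))"
      using ab E_res F_L2 by (simp add: sum_distrib_left)
    finally show ?thesis .
  qed
  then show "\<exists>N'. \<forall>n\<ge>N'. 0 \<le> (\<Sum>i<N. E (res n (a i)) (b i))" by blast
qed

text \<open>
  Generalised normal contractions. The pointwise hypotheses bound the approximating energies of \<open>v\<close>
  by those of the \<open>u\<^sub>i\<close>, which are at most \<open>E (u i) (u i)\<close>; so \<open>v\<close> is in \<open>F\<close>, and the bound holds for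
  \<open>E\<close> itself. The index \<open>k\<close> of the families \<open>a\<close> and \<open>b\<close> in the proof carries \<open>v\<close>.
\<close>

lemma lipschitz_contraction:
  fixes u :: "nat \<Rightarrow> 'a \<Rightarrow> real"
  assumes C: "0 \<le> C" and u: "\<And>i. i < k \<Longrightarrow> u i \<in> F"
    and meas: "v \<in> borel_measurable \<mu>"
    and jump: "\<And>x y. (v x - v y)\<^sup>2 \<le> C * (\<Sum>i<k. (u i x - u i y)\<^sup>2)"
    and kill: "\<And>x. (v x)\<^sup>2 \<le> C * (\<Sum>i<k. (u i x)\<^sup>2)"
  shows "v \<in> F" "E v v \<le> C * (\<Sum>i<k. E (u i) (u i))"
proof -
  have vL: "v \<in> L2"
  proof (rule L2_spaceI[OF meas _ kill])
    show "integrable \<mu> (\<lambda>x. C * (\<Sum>i<k. (u i x)\<^sup>2))"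
      using u L2_space_integrable F_L2
      by (intro Bochner_Integration.integrable_mult_right Bochner_Integration.integrable_sum) auto
  qed
  define a where "a i = (if i < k then (\<lambda>x. C * u i x) else (\<lambda>x. - 1 * v x))" for i
  define b where "b i = (if i < k then u i else v)" for i
  have j: "0 \<le> (\<Sum>i<Suc k. (a i x - a i y) * (b i x - b i y))" for x y
    using jump[of x y] by (simp add: a_def b_def sum_distrib_left power2_eq_square algebra_simps)
  have l: "0 \<le> (\<Sum>i<Suc k. a i x * b i x)" for x
    using kill[of x] by (simp add: a_def b_def sum_distrib_left power2_eq_square algebra_simps)
  have bound: "real (Suc n) * ip (\<lambda>x. v x - res n v x) v \<le> C * (\<Sum>i<k. E (u i) (u i))" for n
  proof -
    define w where "w i = (if i < k then (\<lambda>x. C * res n (u i) x) else (\<lambda>x. - 1 * res n v x))" for i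
    have "0 \<le> (\<Sum>i<Suc k. ip (\<lambda>x. a i x - w i x) (b i))"
    proof (rule resolvent_energy_nonneg[OF _ _ _ j l])
      show "0 < real (Suc n)" by simp
      show "resolves (real (Suc n)) (a i) (w i)" if "i < Suc k" for i
        using resolves_scale[OF res[OF F_L2[OF u]], where c = C] resolves_scale[OF res[OF vL], where c = "-1"]
        by (simp add: a_def w_def)
      show "b i \<in> L2" if "i < Suc k" for i using u vL F_L2 by (simp add: b_def)
    qed
    also have "\<dots> = (\<Sum>i<k. ip (\<lambda>x. a i x - w i x) (b i)) + ip (\<lambda>x. a k x - w k x) (b k)" by simp
    also have "(\<Sum>i<k. ip (\<lambda>x. a i x - w i x) (b i)) = (\<Sum>i<k. C * ip (\<lambda>x. u i x - res n (u i) x) (u i))"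
    proof (rule sum.cong[OF refl])
      fix i assume "i \<in> {..<k}"
      then have i: "i < k" by simp
      have "(\<lambda>x. a i x - w i x) = (\<lambda>x. C * (u i x - res n (u i) x))"
        using i by (simp add: a_def w_def right_diff_distrib)
      then show "ip (\<lambda>x. a i x - w i x) (b i) = C * ip (\<lambda>x. u i x - res n (u i) x) (u i)"
        using i u F_L2 res_F by (simp add: b_def L2.b_scale L2.diff)
    qed
    also have "ip (\<lambda>x. a k x - w k x) (b k) = - ip (\<lambda>x. v x - res n v x) v"
    proof -
      have "(\<lambda>x. a k x - w k x) = (\<lambda>x. - 1 * (v x - res n v x))"
        by (simp add: a_def w_def right_diff_distrib)
      then show ?thesis using L2.b_scale[of "\<lambda>x. v x - res n v x" \<mu> v "-1"] vL F_L2 res_F[OF vL]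
        by (simp add: b_def L2.diff)
    qed
    finally have "ip (\<lambda>x. v x - res n v x) v \<le> (\<Sum>i<k. C * ip (\<lambda>x. u i x - res n (u i) x) (u i))" by simp
    then have "real (Suc n) * ip (\<lambda>x. v x - res n v x) v
        \<le> real (Suc n) * (\<Sum>i<k. C * ip (\<lambda>x. u i x - res n (u i) x) (u i))"
      by (rule mult_left_mono) simp
    also have "\<dots> = (\<Sum>i<k. C * (real (Suc n) * ip (\<lambda>x. u i x - res n (u i) x) (u i)))"
      by (simp add: sum_distrib_left mult.left_commute)
    also have "\<dots> \<le> (\<Sum>i<k. C * E (u i) (u i))"
      using C u by (intro sum_mono mult_left_mono res_energy_le) auto
    finally show ?thesis by (simp add: sum_distrib_left)
  qed
  show vF: "v \<in> F" by (rule resolvent_approximation(1)[OF vL res[OF vL] bound])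
  have "0 \<le> (\<Sum>i<Suc k. E (a i) (b i))"
    by (rule energy_nonneg[OF _ _ j l]) (use u vF En.scale[OF vF, of "-1"] in \<open>auto simp: a_def b_def En.scale\<close>)
  also have "\<dots> = C * (\<Sum>i<k. E (u i) (u i)) - E v v"
    using u En.b_scale[OF vF vF, of "-1"] by (simp add: a_def b_def En.b_scale sum_distrib_left)
  finally show "E v v \<le> C * (\<Sum>i<k. E (u i) (u i))" by simp
qed

lemma lipschitz_contraction1:
  assumes u: "u \<in> F" and C: "0 \<le> C" and meas: "v \<in> borel_measurable \<mu>"
    and jump: "\<And>x y. \<bar>v x - v y\<bar> \<le> C * \<bar>u x - u y\<bar>"
    and kill: "\<And>x. \<bar>v x\<bar> \<le> C * \<bar>u x\<bar>"
  shows "v \<in> F" "E v v \<le> C\<^sup>2 * E u u"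
proof -
  have j: "(v x - v y)\<^sup>2 \<le> C\<^sup>2 * (\<Sum>i<1::nat. (u x - u y)\<^sup>2)" for x y
    using power_mono[OF jump[of x y] abs_ge_zero, of 2] by (simp add: power_mult_distrib)
  have l: "(v x)\<^sup>2 \<le> C\<^sup>2 * (\<Sum>i<1::nat. (u x)\<^sup>2)" for x
    using power_mono[OF kill[of x] abs_ge_zero, of 2] by (simp add: power_mult_distrib)
  show "v \<in> F" "E v v \<le> C\<^sup>2 * E u u"
    using lipschitz_contraction[of "C\<^sup>2" 1 "\<lambda>i. u" v, OF _ _ meas j l] u by auto
qed

lemma product:
  assumes u: "u \<in> F" and v: "v \<in> F" and bd: "\<And>x. \<bar>u x\<bar> \<le> c" "\<And>x. \<bar>v x\<bar> \<le> c"
  shows "(\<lambda>x. u x * v x) \<in> F" "qE (\<lambda>x. u x * v x) \<le> 2 * c\<^sup>2 * (E u u + E v v)"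
proof -
  define z where "z i = (if i = 0 then u else v)" for i :: nat
  have z: "(\<Sum>i<2. f (z i)) = f u + f v" for f :: "_ \<Rightarrow> real"
    by (simp add: z_def numeral_2_eq_2)
  have sq: "p\<^sup>2 \<le> c\<^sup>2" if "\<bar>p\<bar> \<le> c" for p :: real using that abs_ge_zero[of p] by (simp add: abs_le_square_iff[symmetric])
  have kill: "(u x * v x)\<^sup>2 \<le> 2 * c\<^sup>2 * (\<Sum>i<2. (z i x)\<^sup>2)" for x
  proof -
    have "(u x * v x)\<^sup>2 \<le> c\<^sup>2 * (v x)\<^sup>2" using sq[OF bd(1)] by (simp add: power_mult_distrib mult_right_mono)
    also have "\<dots> \<le> 2 * c\<^sup>2 * ((u x)\<^sup>2 + (v x)\<^sup>2)" by (simp add: algebra_simps)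
    finally show ?thesis unfolding z[of "\<lambda>g. (g x)\<^sup>2"] .
  qed
  have jump: "(u x * v x - u y * v y)\<^sup>2 \<le> 2 * c\<^sup>2 * (\<Sum>i<2. (z i x - z i y)\<^sup>2)" for x y
  proof -
    define p q where "p = u x * (v x - v y)" and "q = (u x - u y) * v y"
    have "u x * v x - u y * v y = p + q" by (simp add: p_def q_def algebra_simps)
    then have "(u x * v x - u y * v y)\<^sup>2 \<le> 2 * p\<^sup>2 + 2 * q\<^sup>2"
      using sum_squares_bound[of p q] by (simp add: power2_sum)
    moreover have "p\<^sup>2 \<le> c\<^sup>2 * (v x - v y)\<^sup>2"
      unfolding p_def power_mult_distrib by (intro mult_right_mono sq bd) simp
    moreover have "q\<^sup>2 \<le> (u x - u y)\<^sup>2 * c\<^sup>2"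
      unfolding q_def power_mult_distrib by (intro mult_left_mono sq bd) simp
    ultimately show ?thesis unfolding z[of "\<lambda>g. (g x - g y)\<^sup>2"] by (simp add: algebra_simps)
  qed
  have meas: "(\<lambda>x. u x * v x) \<in> borel_measurable \<mu>"
    using u v F_L2 by (intro borel_measurable_times L2_space_measurable) auto
  have "z i \<in> F" for i using u v by (simp add: z_def)
  from lipschitz_contraction[OF _ this meas jump kill]
  show "(\<lambda>x. u x * v x) \<in> F" "qE (\<lambda>x. u x * v x) \<le> 2 * c\<^sup>2 * (E u u + E v v)"
    unfolding z[of "\<lambda>g. E g g"] by auto
qed

section \<open>The energy functional of bounded functions\<close>

definition bounded_F :: "('a \<Rightarrow> real) set" where
  "bounded_F = {u \<in> F. \<exists>c. \<forall>x. \<bar>u x\<bar> \<le> c}"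

lemma bounded_F_F: "u \<in> bounded_F \<Longrightarrow> u \<in> F" by (simp add: bounded_F_def)

lemma bounded_F_mult: "u \<in> bounded_F \<Longrightarrow> v \<in> bounded_F \<Longrightarrow> (\<lambda>x. u x * v x) \<in> bounded_F"
proof -
  assume "u \<in> bounded_F" "v \<in> bounded_F"
  then obtain c d where *: "u \<in> F" "v \<in> F" "\<And>x. \<bar>u x\<bar> \<le> c" "\<And>x. \<bar>v x\<bar> \<le> d" by (auto simp: bounded_F_def)
  have "\<bar>u x\<bar> \<le> max c d" "\<bar>v x\<bar> \<le> max c d" for x using *(3,4)[of x] by auto
  then have "(\<lambda>x. u x * v x) \<in> F" by (rule product(1)[OF *(1,2)])
  moreover have "\<bar>u x * v x\<bar> \<le> c * d" for x
    unfolding abs_mult using *(3,4)[of x] by (intro mult_mono) auto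
  ultimately show ?thesis by (auto simp: bounded_F_def)
qed

lemma bounded_F_add: "u \<in> bounded_F \<Longrightarrow> v \<in> bounded_F \<Longrightarrow> (\<lambda>x. u x + v x) \<in> bounded_F"
proof -
  assume "u \<in> bounded_F" "v \<in> bounded_F"
  then obtain c d where *: "u \<in> F" "v \<in> F" "\<And>x. \<bar>u x\<bar> \<le> c" "\<And>x. \<bar>v x\<bar> \<le> d" by (auto simp: bounded_F_def)
  have "\<bar>u x + v x\<bar> \<le> c + d" for x using *(3,4)[of x] by linarith
  then show ?thesis using En.add[OF *(1,2)] by (auto simp: bounded_F_def)
qed

lemma bounded_F_scale: "u \<in> bounded_F \<Longrightarrow> (\<lambda>x. c * u x) \<in> bounded_F"
proof -
  assume "u \<in> bounded_F"
  then obtain d where *: "u \<in> F" "\<And>x. \<bar>u x\<bar> \<le> d" by (auto simp: bounded_F_def)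
  have "\<bar>c * u x\<bar> \<le> \<bar>c\<bar> * d" for x unfolding abs_mult using *(2) by (intro mult_left_mono) auto
  then show ?thesis using En.scale[OF *(1)] by (auto simp: bounded_F_def)
qed

text \<open>
  The functional \<open>f \<mapsto> 2 \<integral> f d\<Gamma>(g, h)\<close>, which defines the energy measure. It makes sense for all
  bounded \<open>f\<close>, \<open>g\<close>, \<open>h\<close> in \<open>F\<close>, continuous or not; comparing it at continuous and at merely bounded
  \<open>f\<close> is what relates energy measures to capacity.
\<close>

definition carre :: "('a \<Rightarrow> real) \<Rightarrow> ('a \<Rightarrow> real) \<Rightarrow> ('a \<Rightarrow> real) \<Rightarrow> real" where
  "carre g h f = E (\<lambda>x. f x * g x) h + E (\<lambda>x. f x * h x) g - E (\<lambda>x. g x * h x) f"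

lemma carre_self: "carre g g f = 2 * E (\<lambda>x. f x * g x) g - E (\<lambda>x. g x * g x) f"
  by (simp add: carre_def)

lemma carre_sym: "g \<in> bounded_F \<Longrightarrow> h \<in> bounded_F \<Longrightarrow> carre g h f = carre h g f"
  by (simp add: carre_def mult.commute)

lemma carre_add:
  assumes "g \<in> bounded_F" "g' \<in> bounded_F" "h \<in> bounded_F" "f \<in> bounded_F"
  shows "carre (\<lambda>x. g x + g' x) h f = carre g h f + carre g' h f"
  using assms bounded_F_mult
  by (simp add: carre_def distrib_left distrib_right En.b_add En.b_add_right bounded_F_F)

lemma carre_scale:
  assumes "g \<in> bounded_F" "h \<in> bounded_F" "f \<in> bounded_F"
  shows "carre (\<lambda>x. c * g x) h f = c * carre g h f"
proof -
  have "(\<lambda>x. f x * (c * g x)) = (\<lambda>x. c * (f x * g x))" "(\<lambda>x. c * g x * h x) = (\<lambda>x. c * (g x * h x))"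
    by (auto simp: algebra_simps)
  then show ?thesis using assms bounded_F_mult
    by (simp add: carre_def En.b_scale En.b_scale_right bounded_F_F algebra_simps)
qed

lemma carre_diff_test:
  assumes "g \<in> bounded_F" "f \<in> bounded_F" "f' \<in> bounded_F"
  shows "carre g g (\<lambda>x. f x - f' x) = carre g g f - carre g g f'"
  using assms bounded_F_mult
  by (simp add: carre_self left_diff_distrib En.b_diff En.b_diff_right bounded_F_F)

text \<open>
  The pairs \<open>(2 f g, g)\<close> and \<open>(- g\<^sup>2, f)\<close> in the principle have jump part
  \<open>(g x - g y)\<^sup>2 (f x + f y)\<close> and killing part \<open>f g\<^sup>2\<close>.
\<close>

lemma carre_nonneg:
  assumes g: "g \<in> bounded_F" and f: "f \<in> bounded_F" and "\<And>x. 0 \<le> f x"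
  shows "0 \<le> carre g g f"
proof -
  define a where "a i = (if i = 0 then (\<lambda>x. 2 * (f x * g x)) else (\<lambda>x. - 1 * (g x * g x)))" for i :: nat
  define b where "b i = (if i = 0 then g else f)" for i :: nat
  have two: "(\<Sum>i<2. c i) = c 0 + c 1" for c :: "nat \<Rightarrow> real" by (simp add: numeral_2_eq_2)
  note m = bounded_F_F[OF bounded_F_mult[OF f g]] bounded_F_F[OF bounded_F_mult[OF g g]]
    bounded_F_F[OF f] bounded_F_F[OF g]
  have "0 \<le> (\<Sum>i<2. E (a i) (b i))"
  proof (rule energy_nonneg)
    show "a i \<in> F" "b i \<in> F" for i using m En.scale[OF m(2), of "-1"] by (auto simp: a_def b_def En.scale)
    fix x y
    have "(\<Sum>i<2. (a i x - a i y) * (b i x - b i y)) = (g x - g y)\<^sup>2 * (f x + f y)"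
      unfolding two by (simp add: a_def b_def power2_eq_square algebra_simps)
    then show "0 \<le> (\<Sum>i<2. (a i x - a i y) * (b i x - b i y))" using assms(3) by simp
    have "(\<Sum>i<2. a i x * b i x) = f x * (g x)\<^sup>2"
      unfolding two by (simp add: a_def b_def power2_eq_square algebra_simps)
    then show "0 \<le> (\<Sum>i<2. a i x * b i x)" using assms(3) by simp
  qed
  also have "\<dots> = carre g g f"
    unfolding two using m En.b_scale[OF m(2,3), of "-1"] by (simp add: a_def b_def carre_self En.b_scale)
  finally show ?thesis .
qed

lemma carre_mono:
  assumes "g \<in> bounded_F" "f \<in> bounded_F" "f' \<in> bounded_F" "\<And>x. f x \<le> f' x"
  shows "carre g g f \<le> carre g g f'"
proof -
  have "(\<lambda>x. f' x - f x) \<in> bounded_F"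
    using bounded_F_add[OF assms(3) bounded_F_scale[OF assms(2)], of "-1"] by simp
  then have "0 \<le> carre g g (\<lambda>x. f' x - f x)" using assms by (intro carre_nonneg) auto
  then show ?thesis using carre_diff_test assms by simp
qed

text \<open>
  Here the pairs \<open>(2 g, g)\<close>, \<open>(- 2 f g, g)\<close> and \<open>(g\<^sup>2, f)\<close> have jump part
  \<open>(g x - g y)\<^sup>2 ((1 - f x) + (1 - f y))\<close>.
\<close>

lemma carre_le:
  assumes g: "g \<in> bounded_F" and f: "f \<in> bounded_F" and "\<And>x. f x \<le> 1"
  shows "carre g g f \<le> 2 * E g g"
proof -
  define a where "a i = (if i = 0 then (\<lambda>x. 2 * g x) else if i = 1 then (\<lambda>x. - 2 * (f x * g x))
    else (\<lambda>x. g x * g x))" for i :: nat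
  define b where "b i = (if i < 2 then g else f)" for i :: nat
  have three: "(\<Sum>i<3. c i) = c 0 + c 1 + c 2" for c :: "nat \<Rightarrow> real" by (simp add: numeral_3_eq_3 numeral_2_eq_2)
  note m = bounded_F_F[OF bounded_F_mult[OF f g]] bounded_F_F[OF bounded_F_mult[OF g g]]
    bounded_F_F[OF f] bounded_F_F[OF g]
  have "0 \<le> (\<Sum>i<3. E (a i) (b i))"
  proof (rule energy_nonneg)
    show "a i \<in> F" "b i \<in> F" for i using m En.scale[OF m(1), of "-2"] by (auto simp: a_def b_def En.scale)
    fix x y
    have "(\<Sum>i<3. (a i x - a i y) * (b i x - b i y)) = (g x - g y)\<^sup>2 * ((1 - f x) + (1 - f y))"
      unfolding three by (simp add: a_def b_def power2_eq_square algebra_simps)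
    also have "0 \<le> \<dots>" using assms(3) by (intro mult_nonneg_nonneg add_nonneg_nonneg) auto
    finally show "0 \<le> (\<Sum>i<3. (a i x - a i y) * (b i x - b i y))" .
    have "(\<Sum>i<3. a i x * b i x) = (1 + (1 - f x)) * (g x)\<^sup>2"
      unfolding three by (simp add: a_def b_def power2_eq_square algebra_simps)
    moreover have "0 \<le> 1 + (1 - f x)" using assms(3)[of x] by simp
    ultimately show "0 \<le> (\<Sum>i<3. a i x * b i x)" by simp
  qed
  also have "\<dots> = 2 * E g g - carre g g f"
    unfolding three using m En.b_scale[OF m(1,4), of "-2"] by (simp add: a_def b_def carre_self En.b_scale)
  finally show ?thesis by simp
qed

text \<open>
  Since \<open>f g = g\<close>, the claim is \<open>E (g\<^sup>2) f \<le> E g g\<close>. In the principle with the pairs \<open>(g, g)\<close> and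
  \<open>(- g\<^sup>2, f)\<close> the difference \<open>f x - f y\<close> matters only if one of \<open>g x\<close> and \<open>g y\<close> vanishes.
  The energy measure counts killing only with weight one half, so \<open>2 E g g\<close> would be too much to expect.
\<close>

lemma carre_ge:
  assumes g: "g \<in> bounded_F" and f: "f \<in> bounded_F" and range: "\<And>x. 0 \<le> f x" "\<And>x. f x \<le> 1"
    and one: "\<And>x. g x \<noteq> 0 \<Longrightarrow> f x = 1"
  shows "E g g \<le> carre g g f"
proof -
  define a where "a i = (if i = 0 then g else (\<lambda>x. - 1 * (g x * g x)))" for i :: nat
  define b where "b i = (if i = 0 then g else f)" for i :: nat
  have two: "(\<Sum>i<2. c i) = c 0 + c 1" for c :: "nat \<Rightarrow> real" by (simp add: numeral_2_eq_2)
  note m = bounded_F_F[OF bounded_F_mult[OF g g]] bounded_F_F[OF f] bounded_F_F[OF g]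
  have "0 \<le> (\<Sum>i<2. E (a i) (b i))"
  proof (rule energy_nonneg)
    show "a i \<in> F" "b i \<in> F" for i using m En.scale[OF m(1), of "-1"] by (auto simp: a_def b_def)
    fix x y
    have eq: "(\<Sum>i<2. (a i x - a i y) * (b i x - b i y)) = (g x - g y)\<^sup>2 - ((g x)\<^sup>2 - (g y)\<^sup>2) * (f x - f y)"
      unfolding two by (simp add: a_def b_def power2_eq_square algebra_simps)
    have "((g x)\<^sup>2 - (g y)\<^sup>2) * (f x - f y) \<le> (g x - g y)\<^sup>2"
    proof (cases "g x = 0")
      case True
      have "(g y)\<^sup>2 * (f y - f x) \<le> (g y)\<^sup>2 * 1"
        using range[of x] range[of y] by (intro mult_left_mono) auto
      then show ?thesis using True by (simp add: algebra_simps)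
    next
      case False
      have *: "(g x)\<^sup>2 * (f x - f y) \<le> (g x)\<^sup>2 * 1"
        using range[of x] range[of y] by (intro mult_left_mono) auto
      show ?thesis
      proof (cases "g y = 0")
        case True
        then show ?thesis using * by simp
      next
        case False
        then show ?thesis using one[of x] one[of y] \<open>g x \<noteq> 0\<close> by simp
      qed
    qed
    then show "0 \<le> (\<Sum>i<2. (a i x - a i y) * (b i x - b i y))" unfolding eq by simp
    have "(\<Sum>i<2. a i x * b i x) = (g x)\<^sup>2 * (1 - f x)"
      unfolding two by (simp add: a_def b_def power2_eq_square algebra_simps)
    then show "0 \<le> (\<Sum>i<2. a i x * b i x)" using range by simp
  qed
  also have "\<dots> = E g g - E (\<lambda>x. g x * g x) f"
    unfolding two using En.b_scale[OF m(1,2), of "-1"] by (simp add: a_def b_def)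
  finally have "E (\<lambda>x. g x * g x) f \<le> E g g" by simp
  moreover have "(\<lambda>x. f x * g x) = g" using one by (intro ext) auto
  ultimately show ?thesis by (simp add: carre_self)
qed

text \<open>
  In \<open>E (u\<^sub>n g) g\<close> the functions \<open>u\<^sub>n g\<close> are bounded in energy and tend to \<open>0\<close> in \<open>L\<^sub>2\<close>, so they tend to
  \<open>0\<close> weakly. Concretely, \<open>g\<close> is replaced by a resolvent approximant, against which \<open>E\<close> is an inner product
  of \<open>L\<^sub>2\<close>; the error is uniformly small in \<open>n\<close>.
\<close>

lemma carre_tendsto_zero:
  assumes g: "g \<in> bounded_F" and u: "\<And>n. u n \<in> F" "\<And>n x. \<bar>u n x\<bar> \<le> 1"
    and lim: "(\<lambda>n. E1 \<mu> E (u n)) \<longlonglongrightarrow> 0"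
  shows "(\<lambda>n. carre g g (u n)) \<longlonglongrightarrow> 0"
proof -
  obtain c0 where gF: "g \<in> F" and c0: "\<And>x. \<bar>g x\<bar> \<le> c0" using g by (auto simp: bounded_F_def)
  define c where "c = max c0 1"
  have c: "\<bar>g x\<bar> \<le> c" "\<bar>u n x\<bar> \<le> c" "1 \<le> c" for x n using c0[of x] u(2)[of n x] by (auto simp: c_def)
  note ug = product[OF u(1) gF c(2,1)]
  have ggF: "(\<lambda>x. g x * g x) \<in> F" using product(1)[OF gF gF c(1,1)] .
  have lims: "(\<lambda>n. E (u n) (u n)) \<longlonglongrightarrow> 0" "(\<lambda>n. ip (u n) (u n)) \<longlonglongrightarrow> 0"
    by (rule tendsto_sandwich[OF _ _ tendsto_const lim];
        use En.b_nonneg[OF u(1)] L2.b_nonneg[OF F_L2[OF u(1)]] in \<open>simp add: E1_eq\<close>)+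
  have first: "(\<lambda>n. E (\<lambda>x. g x * g x) (u n)) \<longlonglongrightarrow> 0"
  proof (rule Lim_null_comparison)
    show "\<forall>\<^sub>F n in sequentially. norm (E (\<lambda>x. g x * g x) (u n))
        \<le> sqrt (qE (\<lambda>x. g x * g x)) * sqrt (E (u n) (u n))"
      using En.cauchy_schwarz_abs[OF ggF u(1)] by simp
    show "(\<lambda>n. sqrt (qE (\<lambda>x. g x * g x)) * sqrt (E (u n) (u n))) \<longlonglongrightarrow> 0"
      by (rule tendsto_eq_intros tendsto_real_sqrt lims(1) | simp)+
  qed
  obtain B where B: "\<And>n. E (u n) (u n) \<le> B"
    using convergent_imp_Bseq[OF convergentI[OF lims(1)]] unfolding Bseq_def by (metis abs_le_D1 real_norm_def)
  define D where "D = 2 * c\<^sup>2 * (B + E g g)"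
  have D: "qE (\<lambda>x. u n x * g x) \<le> D" for n
    using ug(2)[of n] B[of n] by (simp add: D_def) (smt (verit) mult_left_mono zero_le_power2)
  have second: "(\<lambda>n. E (\<lambda>x. u n x * g x) g) \<longlonglongrightarrow> 0"
  proof (rule LIMSEQ_I)
    fix \<epsilon> :: real assume "0 < \<epsilon>"
    let ?d = "\<lambda>k x. res k g x - g x"
    have dF: "?d k \<in> F" for k using res_F[OF F_L2[OF gF]] gF by (rule En.diff)
    have "(\<lambda>k. sqrt D * sqrt (E (?d k) (?d k))) \<longlonglongrightarrow> 0"
      by (rule tendsto_eq_intros tendsto_real_sqrt res_tendsto(2)[OF gF] | simp)+
    then have "eventually (\<lambda>k. sqrt D * sqrt (E (?d k) (?d k)) < \<epsilon> / 2) sequentially"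
      using \<open>0 < \<epsilon>\<close> by (intro order_tendstoD) auto
    then obtain k where k: "sqrt D * sqrt (E (?d k) (?d k)) < \<epsilon> / 2"
      by (auto simp: eventually_sequentially)
    have part: "\<bar>E (\<lambda>x. u n x * g x) (?d k)\<bar> < \<epsilon> / 2" for n
    proof -
      have "\<bar>E (\<lambda>x. u n x * g x) (?d k)\<bar> \<le> sqrt (qE (\<lambda>x. u n x * g x)) * sqrt (E (?d k) (?d k))"
        by (rule En.cauchy_schwarz_abs[OF ug(1) dF])
      also have "\<dots> \<le> sqrt D * sqrt (E (?d k) (?d k))"
        using D En.b_nonneg[OF dF] by (intro mult_right_mono) auto
      finally show ?thesis using k by simp
    qed
    have ip_lim: "(\<lambda>n. ip (\<lambda>x. u n x * g x) (\<lambda>x. g x - res k g x)) \<longlonglongrightarrow> 0"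
    proof (rule Lim_null_comparison)
      let ?e = "\<lambda>x. g x - res k g x"
      have eL: "?e \<in> L2" using F_L2 gF res_F[OF F_L2[OF gF]] by (intro L2.diff) auto
      show "\<forall>\<^sub>F n in sequentially. norm (ip (\<lambda>x. u n x * g x) ?e) \<le> c * sqrt (ip (u n) (u n)) * sqrt (ip ?e ?e)"
      proof (intro always_eventually allI)
        fix n
        have "\<bar>u n x * g x\<bar> \<le> \<bar>c * u n x\<bar>" for x
          using mult_right_mono[OF c(1)[of x] abs_ge_zero[of "u n x"]] c(3) by (simp add: abs_mult mult.commute)
        then have "qip (\<lambda>x. u n x * g x) \<le> qip (\<lambda>x. c * u n x)"
          using F_L2 ug(1) u(1) by (intro L2_inner_mono L2.scale) auto
        also have "\<dots> = c\<^sup>2 * ip (u n) (u n)"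
          using F_L2[OF u(1)] by (simp add: L2.b_scale L2.b_scale_right L2.scale power2_eq_square)
        finally have le: "qip (\<lambda>x. u n x * g x) \<le> c\<^sup>2 * ip (u n) (u n)" .
        have "sqrt (qip (\<lambda>x. u n x * g x)) \<le> c * sqrt (ip (u n) (u n))"
          using real_sqrt_le_mono[OF le] c(3) by (simp add: real_sqrt_mult)
        moreover have "\<bar>ip (\<lambda>x. u n x * g x) ?e\<bar> \<le> sqrt (qip (\<lambda>x. u n x * g x)) * sqrt (ip ?e ?e)"
          by (rule L2.cauchy_schwarz_abs[OF F_L2[OF ug(1)] eL])
        ultimately show "norm (ip (\<lambda>x. u n x * g x) ?e) \<le> c * sqrt (ip (u n) (u n)) * sqrt (ip ?e ?e)"
          using L2.b_nonneg[OF eL] by (smt (verit) mult_right_mono real_norm_def real_sqrt_ge_zero)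
      qed
      show "(\<lambda>n. c * sqrt (ip (u n) (u n)) * sqrt (ip ?e ?e)) \<longlonglongrightarrow> 0"
        by (rule tendsto_eq_intros tendsto_real_sqrt lims(2) | simp)+
    qed
    have scaled: "(\<lambda>n. real (Suc k) * ip (\<lambda>x. u n x * g x) (\<lambda>x. g x - res k g x)) \<longlonglongrightarrow> 0"
      by (rule tendsto_eq_intros ip_lim refl | simp)+
    have eq: "real (Suc k) * ip (\<lambda>x. u n x * g x) (\<lambda>x. g x - res k g x) = E (\<lambda>x. u n x * g x) (res k g)" for n
      using E_res[OF F_L2[OF gF] ug(1), of k n] En.b_sym[OF ug(1) res_F[OF F_L2[OF gF]], of n k]
        L2.b_sym[OF F_L2[OF ug(1)] L2.diff[OF F_L2[OF gF] F_L2[OF res_F[OF F_L2[OF gF]]]], of n k] by simp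
    have res_lim: "(\<lambda>n. E (\<lambda>x. u n x * g x) (res k g)) \<longlonglongrightarrow> 0" using scaled unfolding eq .
    obtain N where "\<forall>n\<ge>N. norm (E (\<lambda>x. u n x * g x) (res k g) - 0) < \<epsilon> / 2"
      using LIMSEQ_D[OF res_lim half_gt_zero[OF \<open>0 < \<epsilon>\<close>]] by blast
    then have N: "\<bar>E (\<lambda>x. u n x * g x) (res k g)\<bar> < \<epsilon> / 2" if "n \<ge> N" for n
      using that by simp
    have "\<bar>E (\<lambda>x. u n x * g x) g\<bar> < \<epsilon>" if "n \<ge> N" for n
      using En.b_diff_right[OF res_F[OF F_L2[OF gF]] gF ug(1), of n k] part[of n] N[OF that] by linarith
    then show "\<exists>N. \<forall>n\<ge>N. norm (E (\<lambda>x. u n x * g x) g - 0) < \<epsilon>" by auto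
  qed
  have "(\<lambda>n. 2 * E (\<lambda>x. u n x * g x) g - E (\<lambda>x. g x * g x) (u n)) \<longlonglongrightarrow> 2 * 0 - 0"
    by (intro tendsto_intros first second)
  then show ?thesis by (simp add: carre_self)
qed

end

section \<open>Cutoff functions and energy measures\<close>

lemma C0_spaceI:
  fixes v :: "'a::t2_space \<Rightarrow> real"
  assumes "continuous_on UNIV v" "compact K" "{x. v x \<noteq> 0} \<subseteq> K"
  shows "v \<in> C0_space"
proof -
  have "closure {x. v x \<noteq> 0} \<subseteq> K" using assms(2,3) by (intro closure_minimal compact_imp_closed)
  then have "compact (closure {x. v x \<noteq> 0})"
    using assms(2) compact_Int_closed[of K "closure {x. v x \<noteq> 0}"] by (simp add: Int_absorb1)
  then show ?thesis using assms(1) by (simp add: C0_space_def)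
qed

lemma C0_space_continuous: "u \<in> C0_space \<Longrightarrow> continuous_on UNIV u"
  by (simp add: C0_space_def)

lemma C0_space_support: "u \<in> C0_space \<Longrightarrow> compact (closure {x. u x \<noteq> 0})"
  by (simp add: C0_space_def)

lemma C0_space_bounded:
  fixes u :: "'a::topological_space \<Rightarrow> real"
  assumes u: "u \<in> C0_space" shows "\<exists>c. \<forall>x. \<bar>u x\<bar> \<le> c"
proof -
  have "compact (u ` closure {x. u x \<noteq> 0})"
    using continuous_on_subset[OF C0_space_continuous[OF u] subset_UNIV] C0_space_support[OF u]
    by (rule compact_continuous_image)
  then have "bounded (u ` closure {x. u x \<noteq> 0})" by (rule compact_imp_bounded)
  then obtain c where c: "\<And>x. x \<in> closure {x. u x \<noteq> 0} \<Longrightarrow> \<bar>u x\<bar> \<le> c"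
    unfolding bounded_real by blast
  have "\<bar>u x\<bar> \<le> max c 0" for x
  proof (cases "u x = 0")
    case False
    then have "x \<in> closure {x. u x \<noteq> 0}" using closure_subset[of "{x. u x \<noteq> 0}"] by blast
    then show ?thesis using c[of x] by simp
  qed simp
  then show ?thesis by blast
qed

lemma C0_space_add:
  fixes u v :: "'a::t2_space \<Rightarrow> real"
  assumes "u \<in> C0_space" "v \<in> C0_space" shows "(\<lambda>x. u x + v x) \<in> C0_space"
proof (rule C0_spaceI)
  show "continuous_on UNIV (\<lambda>x. u x + v x)" using assms by (intro continuous_on_add C0_space_continuous)
  show "compact (closure {x. u x \<noteq> 0} \<union> closure {x. v x \<noteq> 0})" using assms by (intro compact_Un C0_space_support)
  show "{x. u x + v x \<noteq> 0} \<subseteq> closure {x. u x \<noteq> 0} \<union> closure {x. v x \<noteq> 0}"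
  proof
    fix x assume "x \<in> {x. u x + v x \<noteq> 0}"
    then have "x \<in> {x. u x \<noteq> 0} \<union> {x. v x \<noteq> 0}" by auto
    then show "x \<in> closure {x. u x \<noteq> 0} \<union> closure {x. v x \<noteq> 0}"
      using closure_subset[of "{x. u x \<noteq> 0}"] closure_subset[of "{x. v x \<noteq> 0}"] by blast
  qed
qed

lemma C0_space_scale:
  fixes u :: "'a::t2_space \<Rightarrow> real"
  assumes "u \<in> C0_space" shows "(\<lambda>x. c * u x) \<in> C0_space"
proof (rule C0_spaceI)
  show "continuous_on UNIV (\<lambda>x. c * u x)" using assms by (intro continuous_on_mult continuous_on_const C0_space_continuous)
  show "compact (closure {x. u x \<noteq> 0})" using assms by (rule C0_space_support)
  show "{x. c * u x \<noteq> 0} \<subseteq> closure {x. u x \<noteq> 0}" using closure_subset[of "{x. u x \<noteq> 0}"] by auto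
qed

lemma compact_neighbourhood:
  fixes K :: "'a::t2_space set"
  assumes "locally compact (UNIV :: 'a set)" "compact K"
  obtains W L where "open W" "K \<subseteq> W" "W \<subseteq> L" "compact L"
proof -
  have "\<exists>u v. open u \<and> compact v \<and> x \<in> u \<and> u \<subseteq> v" for x :: 'a
  proof -
    have "openin (top_of_set UNIV) (UNIV :: 'a set)" "x \<in> UNIV" by auto
    from locallyE[OF assms(1) this] obtain u v
      where "openin (top_of_set UNIV) u" "compact v" "x \<in> u" "u \<subseteq> v" .
    then show ?thesis by auto
  qed
  then have "\<forall>x :: 'a. \<exists>p. open (fst p) \<and> compact (snd p) \<and> x \<in> fst p \<and> fst p \<subseteq> snd p" by simp
  then obtain p where p: "\<forall>x :: 'a. open (fst (p x)) \<and> compact (snd (p x)) \<and> x \<in> fst (p x) \<and> fst (p x) \<subseteq> snd (p x)"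
    by (rule choice[THEN exE])
  define u v where "u x = fst (p x)" and "v x = snd (p x)" for x
  have uv: "open (u x)" "compact (v x)" "x \<in> u x" "u x \<subseteq> v x" for x using p by (auto simp: u_def v_def)
  have "K \<subseteq> (\<Union>x\<in>K. u x)" using uv(3) by auto
  from compactE_image[OF assms(2) uv(1) this]
  obtain D where D: "D \<subseteq> K" "finite D" "K \<subseteq> (\<Union>x\<in>D. u x)" .
  show thesis
  proof (rule that)
    show "open (\<Union>x\<in>D. u x)" "compact (\<Union>x\<in>D. v x)" using uv D(2) by (auto intro!: compact_UN)
    show "(\<Union>x\<in>D. u x) \<subseteq> (\<Union>x\<in>D. v x)" using uv(4) by (intro UN_mono) auto
  qed (rule D(3))
qed

lemma radon_measure_sets: "radon_measure M \<Longrightarrow> sets M = sets borel"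
  by (simp add: radon_measure_def)

lemma radon_inner_approximation:
  fixes M :: "'a::topological_space measure"
  assumes M: "radon_measure M" and A: "A \<in> sets borel" "emeasure M A < \<infinity>" and "0 < \<epsilon>"
  obtains K where "compact K" "K \<subseteq> A" "K \<in> sets borel" "measure M A < measure M K + \<epsilon>"
proof -
  have AM: "A \<in> sets M" using A radon_measure_sets[OF M] by simp
  have eq: "emeasure M A = ennreal (measure M A)" using A(2) by (simp add: emeasure_eq_ennreal_measure)
  have "\<exists>K. compact K \<and> K \<subseteq> A \<and> K \<in> sets borel \<and> measure M A < measure M K + \<epsilon>"
  proof (cases "measure M A < \<epsilon>")
    case True
    then show ?thesis by (intro exI[of _ "{}"]) simp
  next
    case False
    have "ennreal (measure M A - \<epsilon>) < emeasure M A"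
      unfolding eq using \<open>0 < \<epsilon>\<close> False by (intro ennreal_lessI) auto
    also have "emeasure M A = (SUP K\<in>{K \<in> sets borel. compact K \<and> K \<subseteq> A}. emeasure M K)"
      using M A(1) by (simp add: radon_measure_def)
    finally obtain K where K: "K \<in> sets borel" "compact K" "K \<subseteq> A" "ennreal (measure M A - \<epsilon>) < emeasure M K"
      by (auto simp: less_SUP_iff)
    have "emeasure M K \<le> emeasure M A" using K(3) AM by (rule emeasure_mono)
    then have "emeasure M K = ennreal (measure M K)" using A(2) by (intro emeasure_eq_ennreal_measure) auto
    then have "measure M A - \<epsilon> < measure M K" using K(4) False by (simp add: ennreal_less_iff)
    then show ?thesis using K by (intro exI[of _ K]) auto
  qed
  then show thesis using that by blast
qed

lemma radon_sigma_compact: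
  fixes M :: "'a::t2_space measure"
  assumes M: "radon_measure M" and A: "A \<in> sets borel" "emeasure M A < \<infinity>"
  obtains H :: "nat \<Rightarrow> 'a set"
  where "\<And>j. compact (H j)" "\<And>j. H j \<subseteq> A" "emeasure M (A - (\<Union>j. H j)) = 0"
proof -
  have "\<exists>K. compact K \<and> K \<subseteq> A \<and> measure M A < measure M K + 1 / real (Suc j)" for j
    by (rule radon_inner_approximation[OF M A, of "1 / real (Suc j)"]) auto
  then obtain H where H: "\<And>j. compact (H j)" "\<And>j. H j \<subseteq> A" "\<And>j. measure M A < measure M (H j) + 1 / real (Suc j)"
    by metis
  have AM: "A \<in> sets M" and HM: "H j \<in> sets M" for j
    using A(1) borel_compact[OF H(1)] radon_measure_sets[OF M] by auto
  have fin: "emeasure M A \<noteq> \<infinity>" using A(2) by simp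
  have small: "measure M (A - (\<Union>j. H j)) < 1 / real (Suc j)" for j
  proof -
    have "measure M (A - (\<Union>j. H j)) \<le> measure M (A - H j)"
      using AM HM fin by (intro measure_mono_fmeasurable fmeasurable_Diff fmeasurableI) (auto simp: less_top)
    also have "\<dots> = measure M A - measure M (H j)"
      using AM HM H(2) fin by (intro measure_Diff) auto
    finally show ?thesis using H(3)[of j] by linarith
  qed
  have "measure M (A - (\<Union>j. H j)) = 0"
  proof (rule ccontr)
    assume "measure M (A - (\<Union>j. H j)) \<noteq> 0"
    then have "0 < measure M (A - (\<Union>j. H j))" using measure_nonneg[of M "A - (\<Union>j. H j)"] by linarith
    then obtain j where "1 / real (Suc j) < measure M (A - (\<Union>j. H j))" by (rule nat_approx_posE)
    then show False using small[of j] by simp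
  qed
  moreover have "emeasure M (A - (\<Union>j. H j)) = ennreal (measure M (A - (\<Union>j. H j)))"
  proof (rule emeasure_eq_ennreal_measure)
    have "emeasure M (A - (\<Union>j. H j)) \<le> emeasure M A" using AM by (intro emeasure_mono) auto
    also have "\<dots> < top" using A(2) by simp
    finally show "emeasure M (A - (\<Union>j. H j)) \<noteq> top" by simp
  qed
  ultimately have "emeasure M (A - (\<Union>j. H j)) = 0" by simp
  then show thesis using that H(1,2) by blast
qed

lemma compact_outer_approximation:
  fixes M :: "'a::metric_space measure"
  assumes "finite_measure M" and M: "sets M = sets borel" and K: "compact K" and "0 < \<epsilon>"
  obtains V where "open V" "K \<subseteq> V" "measure M V < measure M K + \<epsilon>"
proof -
  interpret finite_measure M by fact
  define V where "V n = (\<Union>x\<in>K. ball x (1 / real (Suc n)))" for n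
  have op: "open (V n)" for n by (auto simp: V_def)
  have sub: "K \<subseteq> V n" for n unfolding V_def by force
  have dec: "decseq V"
  proof (rule decseq_SucI)
    fix n
    have "1 / real (Suc (Suc n)) \<le> 1 / real (Suc n)" by (simp add: frac_le)
    then show "V (Suc n) \<subseteq> V n" unfolding V_def by (intro UN_mono subset_ball) auto
  qed
  have "(\<Inter>n. V n) \<subseteq> K"
  proof
    fix y assume y: "y \<in> (\<Inter>n. V n)"
    have "y \<in> closure K"
    proof (rule iffD2[OF closure_approachable], intro allI impI)
      fix e :: real assume "0 < e"
      then obtain n where n: "1 / real (Suc n) < e" using nat_approx_posE by blast
      from y obtain x where "x \<in> K" "dist x y < 1 / real (Suc n)" by (auto simp: V_def)
      then show "\<exists>x\<in>K. dist x y < e" using n by force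
    qed
    then show "y \<in> K" using compact_imp_closed[OF K] by (simp add: closure_closed)
  qed
  then have eq: "(\<Inter>n. V n) = K" using sub by blast
  have "(\<lambda>n. measure M (V n)) \<longlonglongrightarrow> measure M (\<Inter>n. V n)"
    using op by (intro finite_Lim_measure_decseq dec) (auto simp: M)
  then have "eventually (\<lambda>n. measure M (V n) < measure M K + \<epsilon>) sequentially"
    using \<open>0 < \<epsilon>\<close> unfolding eq by (intro order_tendstoD) auto
  then obtain n where "measure M (V n) < measure M K + \<epsilon>" by (auto simp: eventually_sequentially)
  then show thesis using that op sub by blast
qed

locale energy_space = dirichlet_space \<mu> E F
  for \<mu> :: "'a::{metric_space, second_countable_topology} measure" and E F +
  fixes \<Gamma> :: "('a \<Rightarrow> real) \<Rightarrow> ('a \<Rightarrow> real) \<Rightarrow> 'a set \<Rightarrow> real"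
  assumes locally_compact: "locally compact (UNIV :: 'a set)"
    and borel_sets: "sets \<mu> = sets borel"
    and regular: "regular_form \<mu> E F"
    and energy_measures: "\<And>g h. g \<in> C0_space \<inter> F \<Longrightarrow> h \<in> C0_space \<inter> F \<Longrightarrow> is_energy_measure E F g h (\<Gamma> g h)"
begin

abbreviation core where "core \<equiv> C0_space \<inter> F"

lemma core_bounded: "u \<in> core \<Longrightarrow> u \<in> bounded_F"
  using C0_space_bounded[of u] by (auto simp: bounded_F_def)

lemma continuous_measurable: "continuous_on UNIV u \<Longrightarrow> u \<in> borel_measurable \<mu>" for u :: "'a \<Rightarrow> real"
  using borel_measurable_continuous_onI measurable_cong_sets[OF borel_sets refl] by blast

lemma core_add: "u \<in> core \<Longrightarrow> v \<in> core \<Longrightarrow> (\<lambda>x. u x + v x) \<in> core"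
  using C0_space_add En.add by auto

lemma core_scale: "u \<in> core \<Longrightarrow> (\<lambda>x. c * u x) \<in> core"
  using C0_space_scale En.scale by auto

text \<open>
  Regularity approximates a tent function \<open>h\<close> only uniformly, up to \<open>1/3\<close>, by \<open>v\<close> in the core. The
  contraction of \<open>3 v - 1\<close> to \<open>[0, 1]\<close> is exactly \<open>1\<close> where \<open>h = 1\<close> and exactly \<open>0\<close> where \<open>h = 0\<close>.
\<close>

lemma core_cutoff:
  assumes K: "compact K" and V: "open V" "K \<subseteq> V"
  obtains f where "f \<in> core" "\<And>x. 0 \<le> f x" "\<And>x. f x \<le> 1" "\<And>x. x \<in> K \<Longrightarrow> f x = 1" "\<And>x. f x \<noteq> 0 \<Longrightarrow> x \<in> V"
proof (cases "K = {}")
  case True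
  have "(\<lambda>x. 0) \<in> core" using zero_F C0_spaceI[of "\<lambda>x::'a. 0" "{}"] by auto
  then show thesis using that[of "\<lambda>x. 0"] True by auto
next
  case False
  obtain W L where W: "open W" "K \<subseteq> W" "W \<subseteq> L" "compact L"
    using compact_neighbourhood[OF locally_compact K] .
  obtain e where e: "0 < e" "(\<Union>x\<in>K. ball x e) \<subseteq> V \<inter> W"
    using compact_subset_open_imp_ball_epsilon_subset[OF K open_Int[OF V(1) W(1)]] V(2) W(2) by auto
  define h where "h x = max 0 (1 - infdist x K / e)" for x
  have hK: "h x = 1" if "x \<in> K" for x using that by (simp add: h_def)
  have hV: "x \<in> V \<inter> W" if "h x \<noteq> 0" for x
  proof -
    have "infdist x K < e" using that e(1) by (auto simp: h_def max_def field_simps split: if_splits)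
    then obtain a where "a \<in> K" "dist x a < e"
      using False by (auto simp: infdist_notempty cINF_less_iff)
    then have "x \<in> (\<Union>a\<in>K. ball a e)" by (auto simp: dist_commute)
    then show ?thesis using e(2) by blast
  qed
  have "h \<in> C0_space"
    using hV W(3) e(1) by (intro C0_spaceI[OF _ W(4)]) (auto simp: h_def[abs_def] intro!: continuous_intros)
  then obtain v where v: "v \<in> core" "\<And>x. \<bar>h x - v x\<bar> < 1 / 3"
    using regular unfolding regular_form_def by (metis zero_less_divide_1_iff zero_less_numeral)
  define f where "f x = min (max (3 * v x - 1) 0) 1" for x
  have cont: "continuous_on UNIV f"
    unfolding f_def[abs_def] using v(1) by (intro continuous_intros C0_space_continuous) auto
  have f0: "h x \<noteq> 0" if "f x \<noteq> 0" for x
    using that v(2)[of x] by (auto simp: f_def)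
  have "f \<in> C0_space" using f0 hV W(3) by (intro C0_spaceI[OF cont W(4)]) auto
  moreover have "f \<in> F"
  proof (rule lipschitz_contraction1(1))
    show "v \<in> F" using v(1) by simp
    show "f \<in> borel_measurable \<mu>" using cont by (rule continuous_measurable)
    have lip: "\<bar>min (max (a - 1) 0) 1 - min (max (b - 1) 0) 1\<bar> \<le> \<bar>a - b\<bar>"
      and le: "\<bar>min (max (a - 1) 0) 1\<bar> \<le> \<bar>a\<bar>" for a b :: real by linarith+
    show "\<bar>f x - f y\<bar> \<le> 3 * \<bar>v x - v y\<bar>" for x y
    proof -
      have "\<bar>f x - f y\<bar> \<le> \<bar>3 * v x - 3 * v y\<bar>" unfolding f_def by (rule lip)
      also have "\<dots> = 3 * \<bar>v x - v y\<bar>" unfolding right_diff_distrib[symmetric] abs_mult by simp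
      finally show ?thesis .
    qed
    show "\<bar>f x\<bar> \<le> 3 * \<bar>v x\<bar>" for x
    proof -
      have "\<bar>f x\<bar> \<le> \<bar>3 * v x\<bar>" unfolding f_def by (rule le)
      then show ?thesis by (simp add: abs_mult)
    qed
  qed simp
  moreover have "f x = 1" if "x \<in> K" for x using hK[OF that] v(2)[of x] unfolding f_def by linarith
  moreover have "0 \<le> f x" "f x \<le> 1" for x by (auto simp: f_def)
  ultimately show thesis using that[of f] f0 hV by blast
qed

text \<open>
  One function tests finitely many measures at once: the cutoff between a compact subset of \<open>A\<close> and an
  open neighbourhood of it, both close to it for all measures. Prescribing \<open>K\<close> and \<open>B\<close> allows
  \<open>f = 1\<close> on a given support and \<open>f = 0\<close> off a given neighbourhood.
\<close>

lemma radon_test_approximation: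
  assumes fin: "finite \<M>" and \<M>: "\<And>M. M \<in> \<M> \<Longrightarrow> finite_measure M \<and> radon_measure M"
    and A: "A \<in> sets borel" and K: "compact K" "K \<subseteq> A" and B: "open B" "A \<subseteq> B" and "0 < \<epsilon>"
  obtains f where "f \<in> core" "\<And>x. 0 \<le> f x" "\<And>x. f x \<le> 1" "\<And>x. x \<in> K \<Longrightarrow> f x = 1"
    "\<And>x. f x \<noteq> 0 \<Longrightarrow> x \<in> B" "\<And>M. M \<in> \<M> \<Longrightarrow> \<bar>measure M A - (\<integral>x. f x \<partial>M)\<bar> \<le> \<epsilon>"
proof -
  have "\<exists>L. compact L \<and> L \<subseteq> A \<and> measure M A < measure M L + \<epsilon>" if "M \<in> \<M>" for M
    using \<M>[OF that] A \<open>0 < \<epsilon>\<close> finite_measure.emeasure_finite[of M A]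
    by (metis radon_inner_approximation infinity_ennreal_def less_top)
  then obtain L where L: "\<And>M. M \<in> \<M> \<Longrightarrow> compact (L M) \<and> L M \<subseteq> A \<and> measure M A < measure M (L M) + \<epsilon>"
    by metis
  define K' where "K' = K \<union> (\<Union>M\<in>\<M>. L M)"
  have K': "compact K'" "K' \<subseteq> A" "K \<subseteq> K'" unfolding K'_def using K L fin by (auto intro!: compact_UN)
  have "\<exists>V. open V \<and> K' \<subseteq> V \<and> measure M V < measure M K' + \<epsilon>" if "M \<in> \<M>" for M
    using \<M>[OF that] K'(1) \<open>0 < \<epsilon>\<close> by (metis compact_outer_approximation radon_measure_sets)
  then obtain V where V: "\<And>M. M \<in> \<M> \<Longrightarrow> open (V M) \<and> K' \<subseteq> V M \<and> measure M (V M) < measure M K' + \<epsilon>"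
    by metis
  define V' where "V' = B \<inter> (\<Inter>M\<in>\<M>. V M)"
  have V': "open V'" "K' \<subseteq> V'" unfolding V'_def using V fin B K'(2) by (auto intro!: open_INT)
  obtain f where f: "f \<in> core" "\<And>x. 0 \<le> f x" "\<And>x. f x \<le> 1" "\<And>x. x \<in> K' \<Longrightarrow> f x = 1" "\<And>x. f x \<noteq> 0 \<Longrightarrow> x \<in> V'"
    using core_cutoff[OF K'(1) V'] by blast
  have "\<bar>measure M A - (\<integral>x. f x \<partial>M)\<bar> \<le> \<epsilon>" if M: "M \<in> \<M>" for M
  proof -
    interpret finite_measure M using \<M>[OF M] by simp
    have sM: "sets M = sets borel" using \<M>[OF M] radon_measure_sets by blast
    have K'M: "K' \<in> sets M" using borel_compact[OF K'(1)] sM by simp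
    have VM: "V M \<in> sets M" using V[OF M] sM by auto
    have fm: "f \<in> borel_measurable M"
      using f(1) C0_space_continuous borel_measurable_continuous_onI measurable_cong_sets[OF sM refl] by blast
    have fi: "integrable M f"
      by (rule integrable_const_bound[of _ 1]) (use f(2,3) fm in auto)
    have "measure M K' = (\<integral>x. indicator K' x \<partial>M)" using K'M by simp
    also have "\<dots> \<le> (\<integral>x. f x \<partial>M)"
    proof (rule integral_mono[OF _ fi])
      show "integrable M (indicator K' :: 'a \<Rightarrow> real)"
        using K'M by (intro integrable_real_indicator) (auto simp: less_top[symmetric])
    qed (use f(2,4) in \<open>auto simp: indicator_def\<close>)
    finally have 1: "measure M K' \<le> (\<integral>x. f x \<partial>M)" .
    have "(\<integral>x. f x \<partial>M) \<le> (\<integral>x. indicator (V M) x \<partial>M)"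
    proof (rule integral_mono[OF fi])
      show "integrable M (indicator (V M) :: 'a \<Rightarrow> real)"
        using VM by (intro integrable_real_indicator) (auto simp: less_top[symmetric])
      fix x show "f x \<le> indicator (V M) x"
        using f(3)[of x] f(5)[of x] M by (cases "f x = 0") (auto simp: indicator_def V'_def)
    qed
    also have "\<dots> = measure M (V M)" using VM by simp
    finally have 2: "(\<integral>x. f x \<partial>M) \<le> measure M (V M)" .
    have "measure M (L M) \<le> measure M K'" using K'M M by (intro finite_measure_mono) (auto simp: K'_def)
    moreover have "measure M K' \<le> measure M A" using K'(2) A sM by (intro finite_measure_mono) auto
    ultimately show ?thesis using 1 2 L[OF M] V[OF M] by linarith
  qed
  then show thesis using f(4,5) K'(3) by (intro that[OF f(1-3)]) (auto simp: V'_def)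
qed

text \<open>
  Consequently every linear relation or inequality between the functionals \<open>carre g h\<close> carries over to
  the values of energy measures, without introducing sums of measures.
\<close>

lemma energy_test_approximation:
  assumes "finite I" "I \<subseteq> core \<times> core"
    and A: "A \<in> sets borel" and K: "compact K" "K \<subseteq> A" and B: "open B" "A \<subseteq> B" and "0 < \<epsilon>"
  shows "\<exists>f\<in>core. (\<forall>x. 0 \<le> f x \<and> f x \<le> 1) \<and> (\<forall>x\<in>K. f x = 1) \<and> (\<forall>x. f x \<noteq> 0 \<longrightarrow> x \<in> B)
    \<and> (\<forall>g h. (g, h) \<in> I \<longrightarrow> \<bar>2 * \<Gamma> g h A - carre g h f\<bar> \<le> \<epsilon>)"
proof -
  define R where "R = (\<lambda>i (P, N). finite_measure P \<and> finite_measure N \<and> radon_measure P \<and> radon_measure N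
        \<and> (\<forall>A\<in>sets borel. \<Gamma> (fst i) (snd i) A = measure P A - measure N A)
        \<and> (\<forall>f\<in>core. 2 * ((\<integral>x. f x \<partial>P) - (\<integral>x. f x \<partial>N)) = carre (fst i) (snd i) f))"
  have "\<exists>p. R i p" if "i \<in> I" for i
    using energy_measures[of "fst i" "snd i"] that assms(2) unfolding is_energy_measure_def R_def carre_def
    by (cases i) auto
  then obtain p where p: "\<And>i. i \<in> I \<Longrightarrow> R i (p i)" by metis
  define \<M> where "\<M> = (fst \<circ> p) ` I \<union> (snd \<circ> p) ` I"
  have \<M>: "finite \<M>" "\<And>M. M \<in> \<M> \<Longrightarrow> finite_measure M \<and> radon_measure M"
    using assms(1) p by (auto simp: \<M>_def R_def case_prod_unfold)
  have "0 < \<epsilon> / 4" using \<open>0 < \<epsilon>\<close> by simp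
  then obtain f where f: "f \<in> core" "\<And>x. 0 \<le> f x" "\<And>x. f x \<le> 1" "\<And>x. x \<in> K \<Longrightarrow> f x = 1"
    "\<And>x. f x \<noteq> 0 \<Longrightarrow> x \<in> B" "\<And>M. M \<in> \<M> \<Longrightarrow> \<bar>measure M A - (\<integral>x. f x \<partial>M)\<bar> \<le> \<epsilon> / 4"
    using radon_test_approximation[OF \<M> A K B] by blast
  have "\<bar>2 * \<Gamma> g h A - carre g h f\<bar> \<le> \<epsilon>" if i: "(g, h) \<in> I" for g h
  proof -
    let ?P = "fst (p (g, h))" and ?N = "snd (p (g, h))"
    have "?P \<in> \<M>" "?N \<in> \<M>" using i by (auto simp: \<M>_def intro: rev_image_eqI)
    from this[THEN f(6)] have "\<bar>measure ?P A - (\<integral>x. f x \<partial>?P)\<bar> \<le> \<epsilon> / 4" "\<bar>measure ?N A - (\<integral>x. f x \<partial>?N)\<bar> \<le> \<epsilon> / 4" .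
    moreover have "\<Gamma> g h A = measure ?P A - measure ?N A"
      "2 * ((\<integral>x. f x \<partial>?P) - (\<integral>x. f x \<partial>?N)) = carre g h f"
      using p[OF i] A f(1) by (auto simp: R_def case_prod_unfold)
    ultimately show ?thesis unfolding right_diff_distrib by linarith
  qed
  then show ?thesis using f(1-5) by (intro bexI[of _ f]) auto
qed

lemma energy_measure_inequality:
  assumes "finite J" and core: "\<And>j. j \<in> J \<Longrightarrow> G j \<in> core \<and> H j \<in> core" and A: "A \<in> sets borel"
    and step: "\<And>f. f \<in> core \<Longrightarrow> (\<And>x. 0 \<le> f x) \<Longrightarrow> (\<And>x. f x \<le> 1) \<Longrightarrow>
      (\<Sum>j\<in>J. a j * carre (G j) (H j) f) \<le> c"
  shows "(\<Sum>j\<in>J. a j * (2 * \<Gamma> (G j) (H j) A)) \<le> c"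
proof (rule field_le_epsilon)
  fix \<epsilon> :: real assume "0 < \<epsilon>"
  define s where "s = (\<Sum>j\<in>J. \<bar>a j\<bar>) + 1"
  have s: "0 < s" unfolding s_def by (intro add_nonneg_pos sum_nonneg) auto
  have "0 < \<epsilon> / s" using s \<open>0 < \<epsilon>\<close> by simp
  define I where "I = (\<lambda>j. (G j, H j)) ` J"
  have I: "finite I" "I \<subseteq> core \<times> core" using assms(1) core by (auto simp: I_def)
  obtain f where f: "f \<in> core" "\<And>x. 0 \<le> f x" "\<And>x. f x \<le> 1"
    "\<And>g h. (g, h) \<in> I \<Longrightarrow> \<bar>2 * \<Gamma> g h A - carre g h f\<bar> \<le> \<epsilon> / s"
    using energy_test_approximation[OF I A compact_empty empty_subsetI open_UNIV subset_UNIV \<open>0 < \<epsilon> / s\<close>]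
    by blast
  have "(\<Sum>j\<in>J. a j * (2 * \<Gamma> (G j) (H j) A)) - (\<Sum>j\<in>J. a j * carre (G j) (H j) f)
      = (\<Sum>j\<in>J. a j * (2 * \<Gamma> (G j) (H j) A - carre (G j) (H j) f))"
    by (simp add: sum_subtractf[symmetric] right_diff_distrib)
  also have "\<dots> \<le> (\<Sum>j\<in>J. \<bar>a j\<bar> * (\<epsilon> / s))"
  proof (rule sum_mono)
    fix j assume j: "j \<in> J"
    have "a j * (2 * \<Gamma> (G j) (H j) A - carre (G j) (H j) f)
        \<le> \<bar>a j\<bar> * \<bar>2 * \<Gamma> (G j) (H j) A - carre (G j) (H j) f\<bar>"
      unfolding abs_mult[symmetric] by (rule abs_ge_self)
    also have "\<dots> \<le> \<bar>a j\<bar> * (\<epsilon> / s)" using f(4) j by (intro mult_left_mono) (auto simp: I_def)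
    finally show "a j * (2 * \<Gamma> (G j) (H j) A - carre (G j) (H j) f) \<le> \<bar>a j\<bar> * (\<epsilon> / s)" .
  qed
  also have "\<dots> = (s - 1) * (\<epsilon> / s)" unfolding sum_distrib_right[symmetric] by (simp add: s_def)
  also have "\<dots> \<le> s * (\<epsilon> / s)" using s \<open>0 < \<epsilon>\<close> by (intro mult_right_mono) auto
  also have "\<dots> = \<epsilon>" using s by simp
  finally show "(\<Sum>j\<in>J. a j * (2 * \<Gamma> (G j) (H j) A)) \<le> c + \<epsilon>" using step[OF f(1-3)] by linarith
qed

lemma energy_measure_equation:
  assumes "finite J" "\<And>j. j \<in> J \<Longrightarrow> G j \<in> core \<and> H j \<in> core" "A \<in> sets borel"
    and step: "\<And>f. f \<in> core \<Longrightarrow> (\<Sum>j\<in>J. a j * carre (G j) (H j) f) = 0"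
  shows "(\<Sum>j\<in>J. a j * \<Gamma> (G j) (H j) A) = 0"
proof -
  have "(\<Sum>j\<in>J. a j * (2 * \<Gamma> (G j) (H j) A)) \<le> 0"
    using step by (intro energy_measure_inequality assms(1-3) eq_refl) auto
  moreover have "(\<Sum>j\<in>J. - a j * (2 * \<Gamma> (G j) (H j) A)) \<le> 0"
  proof (rule energy_measure_inequality[OF assms(1-3)])
    fix f assume "f \<in> core"
    from step[OF this] show "(\<Sum>j\<in>J. - a j * carre (G j) (H j) f) \<le> 0" by (simp add: sum_negf)
  qed
  ultimately have "(\<Sum>j\<in>J. a j * (2 * \<Gamma> (G j) (H j) A)) = 0" by (simp add: sum_negf)
  moreover have "(\<Sum>j\<in>J. a j * (2 * \<Gamma> (G j) (H j) A)) = 2 * (\<Sum>j\<in>J. a j * \<Gamma> (G j) (H j) A)"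
    by (simp add: sum_distrib_left mult.left_commute)
  ultimately show ?thesis by simp
qed

lemma energy_measure_nonneg:
  assumes g: "g \<in> core" and A: "A \<in> sets borel"
  shows "0 \<le> \<Gamma> g g A"
  using energy_measure_inequality[of "{()}" "\<lambda>_. g" "\<lambda>_. g" A "\<lambda>_. -1" 0]
    carre_nonneg[OF core_bounded[OF g]] core_bounded g A by simp

lemma energy_measure_le:
  assumes g: "g \<in> core" and A: "A \<in> sets borel"
  shows "\<Gamma> g g A \<le> E g g"
  using energy_measure_inequality[of "{()}" "\<lambda>_. g" "\<lambda>_. g" A "\<lambda>_. 1" "2 * E g g"]
    carre_le[OF core_bounded[OF g]] core_bounded g A by simp

lemma semi_inner_energy_measure:
  assumes A: "A \<in> sets borel" shows "semi_inner core (\<lambda>g h. \<Gamma> g h A)"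
proof
  fix g g' h :: "'a \<Rightarrow> real" and c :: real
  assume g: "g \<in> core"
  show "(\<lambda>x. c * g x) \<in> core" using g by (rule core_scale)
  show "0 \<le> \<Gamma> g g A" using g A by (rule energy_measure_nonneg)
  assume g': "g' \<in> core"
  show "(\<lambda>x. g x + g' x) \<in> core" using g g' by (rule core_add)
  show "\<Gamma> g g' A = \<Gamma> g' g A"
    using energy_measure_equation[of "UNIV :: bool set" "\<lambda>j. if j then g else g'" "\<lambda>j. if j then g' else g" A
        "\<lambda>j. if j then 1 else -1"] g g' A carre_sym[OF core_bounded[OF g] core_bounded[OF g']]
    by (simp add: UNIV_bool)
  assume h: "h \<in> core"
  define G where "G j = (if j = 0 then (\<lambda>x. g x + g' x) else if j = 1 then g else g')" for j :: nat
  define a where "a j = (if j = 0 then 1 else - 1 :: real)" for j :: nat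
  have three: "(\<Sum>i<3. d i) = d 0 + d 1 + d 2" for d :: "nat \<Rightarrow> real" by (simp add: numeral_3_eq_3 numeral_2_eq_2)
  have "(\<Sum>j<3. a j * \<Gamma> (G j) h A) = 0"
  proof (rule energy_measure_equation[OF _ _ A])
    show "G j \<in> core \<and> h \<in> core" for j using g g' h core_add[OF g g'] by (simp add: G_def)
    show "(\<Sum>j<3. a j * carre (G j) h f) = 0" if "f \<in> core" for f
      unfolding three
      using carre_add[OF core_bounded[OF g] core_bounded[OF g'] core_bounded[OF h] core_bounded[OF that]]
      by (simp add: G_def a_def)
  qed simp
  then show "\<Gamma> (\<lambda>x. g x + g' x) h A = \<Gamma> g h A + \<Gamma> g' h A"
    unfolding three by (simp add: G_def a_def)
next
  fix g h :: "'a \<Rightarrow> real" and c :: real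
  assume g: "g \<in> core" and h: "h \<in> core"
  show "\<Gamma> (\<lambda>x. c * g x) h A = c * \<Gamma> g h A"
    using energy_measure_equation[of "UNIV :: bool set" "\<lambda>j. if j then (\<lambda>x. c * g x) else g" "\<lambda>j. h" A
        "\<lambda>j. if j then 1 else - c"] g h A core_scale[OF g, of c]
      carre_scale[OF core_bounded[OF g] core_bounded[OF h] core_bounded, of _ c]
    by (simp add: UNIV_bool)
qed

text \<open>
  A cutoff that equals \<open>1\<close> on the support of \<open>g\<close> is an admissible \<open>f\<close> in \<open>carre_ge\<close>.
\<close>

lemma energy_measure_total_ge:
  assumes g: "g \<in> core" shows "E g g \<le> 2 * \<Gamma> g g UNIV"
proof (rule field_le_epsilon)
  fix \<epsilon> :: real assume "0 < \<epsilon>"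
  have "compact (closure {x. g x \<noteq> 0})" using g by (intro C0_space_support) simp
  then obtain f where f: "f \<in> core" "\<And>x. 0 \<le> f x" "\<And>x. f x \<le> 1" "\<And>x. x \<in> closure {x. g x \<noteq> 0} \<Longrightarrow> f x = 1"
    "\<And>g' h. (g', h) \<in> {(g, g)} \<Longrightarrow> \<bar>2 * \<Gamma> g' h UNIV - carre g' h f\<bar> \<le> \<epsilon>"
    using energy_test_approximation[of "{(g, g)}" UNIV "closure {x. g x \<noteq> 0}" UNIV \<epsilon>] g \<open>0 < \<epsilon>\<close> by auto
  have "f x = 1" if "g x \<noteq> 0" for x using that f(4) closure_subset[of "{x. g x \<noteq> 0}"] by auto
  then have "E g g \<le> carre g g f"
    by (intro carre_ge core_bounded g f(1-3)) auto
  then show "E g g \<le> 2 * \<Gamma> g g UNIV + \<epsilon>" using f(5)[of g g] by simp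
qed

lemma E1_cong_AE:
  assumes "u \<in> F" "v \<in> L2" "AE x in \<mu>. u x = v x"
  shows "v \<in> F" "E1 \<mu> E v = E1 \<mu> E u"
proof -
  show v: "v \<in> F" by (rule F_cong_AE(1)[OF assms])
  have "E v v = E u u"
    using F_cong_AE(2)[OF assms assms(1)] F_cong_AE(2)[OF assms v] En.b_sym[OF assms(1) v] by simp
  moreover have "(\<integral>x. (v x)\<^sup>2 \<partial>\<mu>) = (\<integral>x. (u x)\<^sup>2 \<partial>\<mu>)"
  proof (rule integral_cong_AE)
    show "AE x in \<mu>. (v x)\<^sup>2 = (u x)\<^sup>2" using assms(3) by eventually_elim simp
  qed (use L2_space_integrable[OF assms(2)] L2_space_integrable[OF F_L2[OF assms(1)]] in auto)
  ultimately show "E1 \<mu> E v = E1 \<mu> E u" by (simp add: E1_def)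
qed

lemma emeasure_le_capacity:
  assumes A: "A \<in> sets borel" shows "emeasure \<mu> A \<le> capacity \<mu> E F A"
  unfolding capacity_def
proof (rule INF_greatest)
  fix B assume "B \<in> {B. open B \<and> A \<subseteq> B}"
  then have B: "open B" "A \<subseteq> B" by auto
  then have BM: "B \<in> sets \<mu>" by (simp add: borel_sets)
  have "emeasure \<mu> A \<le> emeasure \<mu> B" using B(2) BM by (rule emeasure_mono)
  also have "\<dots> \<le> open_capacity \<mu> E F B"
    unfolding open_capacity_def
  proof (rule INF_greatest)
    fix u assume "u \<in> {u \<in> F. AE x in \<mu>. x \<in> B \<longrightarrow> 1 \<le> u x}"
    then have u: "u \<in> F" "AE x in \<mu>. x \<in> B \<longrightarrow> 1 \<le> u x" by auto
    have "emeasure \<mu> B = (\<integral>\<^sup>+x. indicator B x \<partial>\<mu>)" using BM by simp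
    also have "\<dots> \<le> (\<integral>\<^sup>+x. ennreal ((u x)\<^sup>2) \<partial>\<mu>)"
    proof (rule nn_integral_mono_AE)
      show "AE x in \<mu>. indicator B x \<le> ennreal ((u x)\<^sup>2)"
        using u(2) by eventually_elim (auto simp: indicator_def one_le_power)
    qed
    also have "\<dots> = ennreal (\<integral>x. (u x)\<^sup>2 \<partial>\<mu>)"
      using L2_space_integrable[OF F_L2[OF u(1)]] by (intro nn_integral_eq_integral) auto
    also have "\<dots> \<le> ennreal (E1 \<mu> E u)"
      unfolding E1_def using En.b_nonneg[OF u(1)] by (intro ennreal_leI) simp
    finally show "emeasure \<mu> B \<le> ennreal (E1 \<mu> E u)" .
  qed
  finally show "emeasure \<mu> A \<le> open_capacity \<mu> E F B" .
qed

text \<open>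
  Let \<open>u \<in> F\<close> with \<open>u \<ge> 1\<close> almost everywhere on an open neighbourhood \<open>B\<close> of \<open>A\<close> have small \<open>E\<^sub>1 u\<close>.
  A cutoff \<open>w\<close> that nearly computes \<open>\<Gamma>(g, g)(A)\<close> and vanishes off \<open>B\<close> is dominated by the
  truncation of \<open>u\<close>, and \<open>carre g g\<close> is monotone; so \<open>2 \<Gamma>(g, g)(A)\<close> is at most the value of
  \<open>carre g g\<close> at the truncation, up to a small error, and \<open>carre_tendsto_zero\<close> applies.
\<close>

lemma energy_measure_capacity_zero:
  assumes g: "g \<in> core" and A: "A \<in> sets borel" and cap: "capacity \<mu> E F A = 0"
  shows "\<Gamma> g g A = 0"
proof -
  have ex: "\<exists>z. z \<in> F \<and> (\<forall>x. 0 \<le> z x \<and> z x \<le> 1) \<and> E1 \<mu> E z < \<epsilon> \<and> 2 * \<Gamma> g g A \<le> carre g g z + \<epsilon>"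
    if "0 < \<epsilon>" for \<epsilon>
  proof -
    have "capacity \<mu> E F A < ennreal \<epsilon>" using cap \<open>0 < \<epsilon>\<close> by simp
    then obtain B where B: "open B" "A \<subseteq> B" "open_capacity \<mu> E F B < ennreal \<epsilon>"
      unfolding capacity_def by (auto simp: INF_less_iff)
    then obtain u where u: "u \<in> F" "AE x in \<mu>. x \<in> B \<longrightarrow> 1 \<le> u x" "ennreal (E1 \<mu> E u) < ennreal \<epsilon>"
      unfolding open_capacity_def by (auto simp: INF_less_iff)
    define v where "v = (\<lambda>x. min (max (u x) 0) 1)"
    have v: "v \<in> F" "E v v \<le> E u u" using unit_contraction[OF u(1)] by (auto simp: v_def)
    have "ip v v \<le> ip u u" by (intro L2_inner_mono F_L2 v u) (auto simp: v_def)
    then have "E1 \<mu> E v \<le> E1 \<mu> E u" using v(2) by (simp add: E1_eq)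
    also have "\<dots> < \<epsilon>" using u(3) E1_nonneg[OF u(1)] by (simp add: ennreal_less_iff)
    finally have Ev: "E1 \<mu> E v < \<epsilon>" .
    obtain w where w: "w \<in> core" "\<And>x. 0 \<le> w x" "\<And>x. w x \<le> 1" "\<And>x. w x \<noteq> 0 \<Longrightarrow> x \<in> B"
      "\<And>g' h. (g', h) \<in> {(g, g)} \<Longrightarrow> \<bar>2 * \<Gamma> g' h A - carre g' h w\<bar> \<le> \<epsilon>"
      using energy_test_approximation[of "{(g, g)}" A "{}" B \<epsilon>] g A B \<open>0 < \<epsilon>\<close> by auto
    \<comment> \<open>\<open>v\<close> dominates \<open>w\<close> only almost everywhere; \<open>z\<close> is a version of \<open>v\<close> that does so everywhere\<close>
    define z where "z x = max (v x) (w x)" for x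
    have vw: "0 \<le> v x" "v x \<le> 1" for x by (auto simp: v_def)
    have z: "0 \<le> z x" "z x \<le> 1" "w x \<le> z x" for x using vw[of x] w(2,3)[of x] by (auto simp: z_def)
    have ae: "AE x in \<mu>. v x = z x" using u(2)
    proof eventually_elim
      case (elim x)
      show ?case
      proof (cases "x \<in> B")
        case True
        then have "v x = 1" using elim by (simp add: v_def)
        then show ?thesis using w(3)[of x] by (simp add: z_def)
      next
        case False
        then have "w x = 0" using w(4) by blast
        then show ?thesis using vw[of x] by (simp add: z_def)
      qed
    qed
    have "z \<in> L2"
    proof (rule L2_spaceI)
      show "z \<in> borel_measurable \<mu>" unfolding z_def[abs_def]
        using v(1) w(1) by (intro borel_measurable_max L2_space_measurable F_L2) auto
      show "integrable \<mu> (\<lambda>x. (v x)\<^sup>2 + (w x)\<^sup>2)"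
        using v(1) w(1) by (intro Bochner_Integration.integrable_add L2_space_integrable F_L2) auto
      show "(z x)\<^sup>2 \<le> (v x)\<^sup>2 + (w x)\<^sup>2" for x by (simp add: z_def max_def)
    qed
    note zF = E1_cong_AE[OF v(1) this ae]
    have "z \<in> bounded_F" unfolding bounded_F_def using zF(1) z(1,2) by (auto intro!: exI[of _ 1])
    then have "carre g g w \<le> carre g g z"
      by (rule carre_mono[OF core_bounded[OF g] core_bounded[OF w(1)] _ z(3)])
    then have "2 * \<Gamma> g g A \<le> carre g g z + \<epsilon>" using w(5)[of g g] by simp
    then show ?thesis using zF z(1,2) Ev by auto
  qed
  have "\<exists>z. z \<in> F \<and> (\<forall>x. 0 \<le> z x \<and> z x \<le> 1) \<and> E1 \<mu> E z < 1 / real (Suc n)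
      \<and> 2 * \<Gamma> g g A \<le> carre g g z + 1 / real (Suc n)" for n
    by (rule ex) simp
  then obtain z where z: "\<And>n. z n \<in> F" "\<And>n x. 0 \<le> z n x \<and> z n x \<le> 1" "\<And>n. E1 \<mu> E (z n) < 1 / real (Suc n)"
    "\<And>n. 2 * \<Gamma> g g A \<le> carre g g (z n) + 1 / real (Suc n)" by metis
  have "(\<lambda>n. carre g g (z n)) \<longlonglongrightarrow> 0"
  proof (rule carre_tendsto_zero[OF core_bounded[OF g] z(1)])
    show "\<bar>z n x\<bar> \<le> 1" for n x using z(2)[of n x] by simp
    show "(\<lambda>n. E1 \<mu> E (z n)) \<longlonglongrightarrow> 0"
      by (rule tendsto_sandwich[OF _ _ tendsto_const LIMSEQ_Suc[OF lim_1_over_n]])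
        (use E1_nonneg[OF z(1)] z(3)[THEN less_imp_le] in auto)
  qed
  then have "(\<lambda>n. carre g g (z n) + 1 / real (Suc n)) \<longlonglongrightarrow> 0 + 0"
    by (intro tendsto_intros LIMSEQ_Suc[OF lim_1_over_n])
  then have "2 * \<Gamma> g g A \<le> 0 + 0" by (rule LIMSEQ_le_const) (use z(4) in auto)
  then show ?thesis using energy_measure_nonneg[OF g A] by simp
qed

lemma energy_measure_sums:
  assumes "g \<in> core" "h \<in> core" and A: "range A \<subseteq> sets borel" "disjoint_family A"
  shows "(\<lambda>i. \<Gamma> g h (A i)) sums \<Gamma> g h (\<Union>i. A i)"
proof -
  obtain P N where PN: "finite_measure P" "finite_measure N" "radon_measure P" "radon_measure N"
    "\<And>A. A \<in> sets borel \<Longrightarrow> \<Gamma> g h A = measure P A - measure N A"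
    using energy_measures[OF assms(1,2)] unfolding is_energy_measure_def by blast
  have "(\<lambda>i. measure P (A i) - measure N (A i)) sums (measure P (\<Union>i. A i) - measure N (\<Union>i. A i))"
    using A PN(3,4) by (intro sums_diff finite_measure.finite_measure_UNION PN(1,2)) (auto simp: radon_measure_sets)
  moreover have "(\<Union>i. A i) \<in> sets borel" using A(1) by auto
  ultimately show ?thesis using A(1) PN(5) by (simp add: range_subsetD)
qed

lemma energy_measure_mono:
  assumes g: "g \<in> core" and A: "A \<in> sets borel" and B: "B \<in> sets borel" and "A \<subseteq> B"
  shows "\<Gamma> g g A \<le> \<Gamma> g g B"
proof -
  obtain P N where PN: "finite_measure P" "finite_measure N" "radon_measure P" "radon_measure N"
    "\<And>A. A \<in> sets borel \<Longrightarrow> \<Gamma> g g A = measure P A - measure N A"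
    using energy_measures[OF g g] unfolding is_energy_measure_def by blast
  have "measure P (B - A) = measure P B - measure P A" "measure N (B - A) = measure N B - measure N A"
    using A B \<open>A \<subseteq> B\<close> PN(3,4)
    by (auto intro!: finite_measure.finite_measure_Diff PN(1,2) simp: radon_measure_sets)
  moreover have "0 \<le> \<Gamma> g g (B - A)" using A B by (intro energy_measure_nonneg g) auto
  ultimately show ?thesis using PN(5)[OF A] PN(5)[OF B] PN(5)[of "B - A"] A B by simp
qed

lemma energy_measure_sigma_compact:
  assumes g: "g \<in> core" and A: "A \<in> sets borel"
  shows "\<exists>H :: nat \<Rightarrow> 'a set. (\<forall>j. compact (H j) \<and> H j \<subseteq> A) \<and> \<Gamma> g g (A - (\<Union>j. H j)) = 0"
proof -
  obtain P N where PN: "finite_measure P" "radon_measure P"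
    "\<And>A. A \<in> sets borel \<Longrightarrow> \<Gamma> g g A = measure P A - measure N A"
    using energy_measures[OF g g] unfolding is_energy_measure_def by blast
  obtain H :: "nat \<Rightarrow> 'a set" where H: "\<And>j. compact (H j)" "\<And>j. H j \<subseteq> A" "emeasure P (A - (\<Union>j. H j)) = 0"
    using radon_sigma_compact[OF PN(2) A] finite_measure.emeasure_finite[OF PN(1), of A] by (auto simp: less_top)
  have "A - (\<Union>j. H j) \<in> sets borel" using A H(1) borel_compact by blast
  then have "\<Gamma> g g (A - (\<Union>j. H j)) = measure P (A - (\<Union>j. H j)) - measure N (A - (\<Union>j. H j))"
    "0 \<le> \<Gamma> g g (A - (\<Union>j. H j))"
    using PN(3) energy_measure_nonneg[OF g] by blast+
  moreover have "measure P (A - (\<Union>j. H j)) = 0" using H(3) by (simp add: measure_def)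
  ultimately have "\<Gamma> g g (A - (\<Union>j. H j)) = 0" using measure_nonneg[of N "A - (\<Union>j. H j)"] by linarith
  then show ?thesis using H by (intro exI[of _ H]) auto
qed

end

section \<open>The reference measure\<close>

text \<open>
  Adding \<open>c m\<close> makes the signed set function a measure dominated by \<open>2 c m\<close>, to which the
  Radon-Nikodym theorem applies.
\<close>

lemma bounded_set_function_density:
  fixes \<nu> :: "'a set \<Rightarrow> real"
  assumes "finite_measure m"
    and sums: "\<And>A :: nat \<Rightarrow> 'a set. range A \<subseteq> sets m \<Longrightarrow> disjoint_family A \<Longrightarrow> (\<lambda>i. \<nu> (A i)) sums \<nu> (\<Union>i. A i)"
    and bound: "\<And>A. A \<in> sets m \<Longrightarrow> \<bar>\<nu> A\<bar> \<le> c * measure m A"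
  shows "\<exists>d. integrable m d \<and> (\<forall>A\<in>sets m. \<nu> A = set_lebesgue_integral m A d) \<and> (AE x in m. \<bar>d x\<bar> \<le> c)"
proof -
  interpret finite_measure m by fact
  define \<kappa> where "\<kappa> A = \<nu> A + c * measure m A" for A
  have \<kappa>_nonneg: "0 \<le> \<kappa> A" if "A \<in> sets m" for A using bound[OF that] by (simp add: \<kappa>_def)
  define N where "N = measure_of (space m) (sets m) (\<lambda>A. ennreal (\<kappa> A))"
  have sN: "sets N = sets m" by (simp add: N_def sets.sigma_sets_eq)
  have N: "emeasure N A = ennreal (\<kappa> A)" if "A \<in> sets m" for A
  proof (rule emeasure_measure_of[OF N_def])
    show "sets m \<subseteq> Pow (space m)" by (rule sets.space_closed)
    have "\<nu> {} = 0" using bound[of "{}"] by simp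
    then show "positive (sets N) (\<lambda>A. ennreal (\<kappa> A))" by (simp add: positive_def \<kappa>_def)
    show "countably_additive (sets N) (\<lambda>A. ennreal (\<kappa> A))"
      unfolding sN
    proof (rule countably_additiveI)
      fix A :: "nat \<Rightarrow> 'a set"
      assume A: "range A \<subseteq> sets m" "disjoint_family A"
      have "(\<lambda>i. \<kappa> (A i)) sums \<kappa> (\<Union>i. A i)"
        unfolding \<kappa>_def using A by (intro sums_add sums_mult sums finite_measure_UNION)
      moreover have "0 \<le> \<kappa> (A i)" for i using A(1) by (intro \<kappa>_nonneg) auto
      ultimately show "(\<Sum>i. ennreal (\<kappa> (A i))) = ennreal (\<kappa> (\<Union>i. A i))"
        by (intro suminf_ennreal_eq)
    qed
    show "A \<in> sets N" using that sN by simp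
  qed
  have "absolutely_continuous m N"
    unfolding absolutely_continuous_def
  proof
    fix A assume "A \<in> null_sets m"
    then have A: "A \<in> sets m" "measure m A = 0" by (auto simp: measure_def)
    then have "\<kappa> A = 0" using bound[OF A(1)] by (simp add: \<kappa>_def)
    then show "A \<in> null_sets N" using N[OF A(1)] A(1) by (intro null_setsI) (auto simp: sN)
  qed
  then obtain g where g: "g \<in> borel_measurable m" "density m g = N"
    using Radon_Nikodym sN by blast
  have int_g: "(\<integral>\<^sup>+x. g x * indicator A x \<partial>m) = ennreal (\<kappa> A)" if "A \<in> sets m" for A
    using emeasure_density[OF g(1) that] g(2) N[OF that] by simp
  have g_fin: "AE x in m. g x \<noteq> \<infinity>"
  proof (rule nn_integral_PInf_AE[OF g(1)])
    have "(\<integral>\<^sup>+x. g x \<partial>m) = (\<integral>\<^sup>+x. g x * indicator (space m) x \<partial>m)"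
      by (intro nn_integral_cong) simp
    then show "(\<integral>\<^sup>+x. g x \<partial>m) \<noteq> \<infinity>" using int_g[OF sets.top] by simp
  qed
  define d where "d x = enn2real (g x) - c" for x
  have g'_int: "has_bochner_integral m (\<lambda>x. enn2real (g x) * indicator A x) (\<kappa> A)" if A: "A \<in> sets m" for A
  proof (rule has_bochner_integral_nn_integral)
    show "(\<lambda>x. enn2real (g x) * indicator A x) \<in> borel_measurable m" using g(1) A by measurable
    have "(\<integral>\<^sup>+x. ennreal (enn2real (g x) * indicator A x) \<partial>m) = (\<integral>\<^sup>+x. g x * indicator A x \<partial>m)"
      using g_fin by (intro nn_integral_cong_AE, eventually_elim) (auto simp: indicator_def less_top)
    then show "(\<integral>\<^sup>+x. ennreal (enn2real (g x) * indicator A x) \<partial>m) = ennreal (\<kappa> A)" using int_g[OF A] by simp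
  qed (use \<kappa>_nonneg[OF that] in auto)
  have d_int: "has_bochner_integral m (\<lambda>x. indicator A x * d x) (\<nu> A)" if A: "A \<in> sets m" for A
  proof -
    have "has_bochner_integral m (\<lambda>x. enn2real (g x) * indicator A x - c * indicator A x) (\<kappa> A - c * measure m A)"
      using A by (intro has_bochner_integral_diff g'_int has_bochner_integral_mult_right has_bochner_integral_real_indicator)
        (auto simp: less_top[symmetric])
    then show ?thesis by (simp add: d_def \<kappa>_def algebra_simps)
  qed
  have "has_bochner_integral m d (\<nu> (space m))"
    using d_int[OF sets.top] by (rule has_bochner_integral_cong[THEN iffD1, rotated -1]) auto
  then have di: "integrable m d" by (auto simp: has_bochner_integral_iff)
  have [measurable]: "d \<in> borel_measurable m" using di by auto
  have one_sided: "AE x in m. s * d x \<le> c" if s: "\<bar>s\<bar> = 1" for s :: real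
  proof -
    define B where "B = {x \<in> space m. c < s * d x}"
    have B[measurable]: "B \<in> sets m" unfolding B_def by measurable
    have *: "has_bochner_integral m (\<lambda>x. s * (indicator B x * d x) - c * indicator B x) (s * \<nu> B - c * measure m B)"
      using B by (intro has_bochner_integral_diff has_bochner_integral_mult_right d_int has_bochner_integral_real_indicator)
        (auto simp: less_top[symmetric])
    have pos: "0 \<le> s * (indicator B x * d x) - c * indicator B x" for x by (auto simp: B_def indicator_def)
    have "s * \<nu> B \<le> \<bar>\<nu> B\<bar>" using s abs_ge_self[of "s * \<nu> B"] by (simp add: abs_mult)
    then have "(\<integral>x. s * (indicator B x * d x) - c * indicator B x \<partial>m) \<le> 0"
      using bound[OF B] * by (simp add: has_bochner_integral_iff)
    then have "(\<integral>x. s * (indicator B x * d x) - c * indicator B x \<partial>m) = 0"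
      using pos by (intro antisym integral_nonneg_AE) auto
    then have "AE x in m. s * (indicator B x * d x) - c * indicator B x = 0"
      using * pos by (subst (asm) integral_nonneg_eq_0_iff_AE) (auto simp: has_bochner_integral_iff)
    then show ?thesis using AE_space
      by eventually_elim (auto simp: B_def indicator_def split: if_splits)
  qed
  have "AE x in m. 1 * d x \<le> c" "AE x in m. (- 1) * d x \<le> c" by (rule one_sided, simp)+
  then have "AE x in m. \<bar>d x\<bar> \<le> c" by eventually_elim auto
  moreover have "\<nu> A = set_lebesgue_integral m A d" if "A \<in> sets m" for A
    using d_int[OF that] by (simp add: set_lebesgue_integral_def has_bochner_integral_iff)
  ultimately show ?thesis using di by blast
qed

lemma ennreal_suminf_swap: "(\<Sum>i. \<Sum>j. F i j) = (\<Sum>j. \<Sum>i. F i j)" for F :: "nat \<Rightarrow> nat \<Rightarrow> ennreal"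
  using nn_integral_suminf[of "\<lambda>i j. F i j" "count_space UNIV"] by (simp add: nn_integral_count_space_nat)

lemma countably_additive_suminf:
  assumes "\<And>n::nat. countably_additive \<A> (F n)"
  shows "countably_additive \<A> (\<lambda>A. \<Sum>n. F n A)"
proof (rule countably_additiveI)
  fix A :: "nat \<Rightarrow> 'a set"
  assume A: "range A \<subseteq> \<A>" "disjoint_family A" "(\<Union>i. A i) \<in> \<A>"
  have "(\<Sum>i. \<Sum>n. F n (A i)) = (\<Sum>n. \<Sum>i. F n (A i))" by (rule ennreal_suminf_swap)
  also have "\<dots> = (\<Sum>n. F n (\<Union>i. A i))" using assms A by (simp add: countably_additive_def)
  finally show "(\<Sum>i. \<Sum>n. F n (A i)) = (\<Sum>n. F n (\<Union>i. A i))" .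
qed

lemma countably_additive_add:
  assumes "countably_additive \<A> F" "countably_additive \<A> G"
  shows "countably_additive \<A> (\<lambda>A. F A + G A)"
  using assms unfolding countably_additive_def by (simp add: suminf_add[symmetric] summableI)

lemma countably_additive_restrict:
  assumes "R \<in> sets M" shows "countably_additive (sets M) (\<lambda>A. c * (emeasure M (A \<inter> R) / d))"
proof (rule countably_additiveI)
  fix A :: "nat \<Rightarrow> 'a set"
  assume A: "range A \<subseteq> sets M" "disjoint_family A"
  have "(\<Sum>i. emeasure M (A i \<inter> R)) = emeasure M (\<Union>i. A i \<inter> R)"
    using A assms by (intro suminf_emeasure) (auto simp: disjoint_family_on_def)
  then show "(\<Sum>i. c * (emeasure M (A i \<inter> R) / d)) = c * (emeasure M ((\<Union>i. A i) \<inter> R) / d)"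
    by (simp add: Int_UN_distrib2)
qed

lemma compact_exhaustion_sequence:
  fixes H :: "nat \<Rightarrow> nat \<Rightarrow> 'a::topological_space set"
  assumes "\<And>n j. compact (H n j)" "\<And>n j. H n j \<subseteq> A"
  shows "\<exists>K :: nat \<Rightarrow> 'a set. (\<forall>i. compact (K i) \<and> K i \<subseteq> A) \<and> (\<Union>i. K i) = (\<Union>n j. H n j)"
proof (intro exI conjI allI)
  let ?K = "\<lambda>i. H (fst (prod_decode i)) (snd (prod_decode i))"
  show "compact (?K i)" "?K i \<subseteq> A" for i using assms by auto
  have "H n j = ?K (prod_encode (n, j))" for n j by simp
  then show "(\<Union>i. ?K i) = (\<Union>n j. H n j)" by blast
qed

text \<open>
  The hypothesis, that every Borel set is \<open>\<sigma>\<close>-compact up to a null set, is stable under countable sums of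
  measures, unlike the definition of inner regularity, which needs a uniform choice of compact sets.
\<close>

lemma finite_radonI:
  fixes m :: "'a::t2_space measure"
  assumes "finite_measure m" and sets: "sets m = sets borel"
    and core: "\<And>A. A \<in> sets borel \<Longrightarrow>
      \<exists>H :: nat \<Rightarrow> 'a set. (\<forall>j. compact (H j) \<and> H j \<subseteq> A) \<and> emeasure m (A - (\<Union>j. H j)) = 0"
  shows "radon_measure m"
proof -
  interpret finite_measure m by fact
  have "emeasure m A = (SUP K\<in>{K \<in> sets borel. compact K \<and> K \<subseteq> A}. emeasure m K)" if A: "A \<in> sets borel" for A
  proof (rule antisym)
    obtain H :: "nat \<Rightarrow> 'a set" where H: "\<And>j. compact (H j)" "\<And>j. H j \<subseteq> A" "emeasure m (A - (\<Union>j. H j)) = 0"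
      using core[OF A] by blast
    define K where "K n = (\<Union>j\<le>n. H j)" for n
    have K: "compact (K n)" "K n \<subseteq> A" for n using H by (auto simp: K_def intro!: compact_UN)
    have Kb: "K n \<in> sets borel" for n using K(1) by (rule borel_compact)
    have UN: "(\<Union>n. K n) = (\<Union>j. H j)" by (auto simp: K_def)
    have Hm: "(\<Union>j. H j) \<in> sets m" using borel_compact[OF H(1)] by (auto simp: sets)
    have "emeasure m A = emeasure m ((\<Union>j. H j) \<union> (A - (\<Union>j. H j)))" using H(2) by (intro arg_cong[of _ _ "emeasure m"]) auto
    also have "\<dots> \<le> emeasure m (\<Union>j. H j) + emeasure m (A - (\<Union>j. H j))"
      using Hm A by (intro emeasure_subadditive) (auto simp: sets)
    also have "\<dots> = emeasure m (\<Union>n. K n)" using H(3) UN by simp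
    also have "\<dots> = (SUP n. emeasure m (K n))"
    proof (rule SUP_emeasure_incseq[symmetric])
      show "range K \<subseteq> sets m" using Kb by (auto simp: sets)
      show "incseq K" unfolding incseq_def K_def by (auto intro: order_trans)
    qed
    also have "\<dots> \<le> (SUP K\<in>{K \<in> sets borel. compact K \<and> K \<subseteq> A}. emeasure m K)"
      using K Kb by (intro SUP_least SUP_upper) auto
    finally show "emeasure m A \<le> (SUP K\<in>{K \<in> sets borel. compact K \<and> K \<subseteq> A}. emeasure m K)" .
    show "(SUP K\<in>{K \<in> sets borel. compact K \<and> K \<subseteq> A}. emeasure m K) \<le> emeasure m A"
      using A by (intro SUP_least emeasure_mono) (auto simp: sets)
  qed
  then show ?thesis unfolding radon_measure_def using sets by (auto simp: less_top[symmetric])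
qed

locale reference_measure = energy_space \<mu> E F \<Gamma>
  for \<mu> :: "'a::{metric_space, second_countable_topology} measure" and E F \<Gamma> +
  fixes f :: "nat \<Rightarrow> 'a \<Rightarrow> real" and U :: "nat \<Rightarrow> 'a set"
  assumes admissible: "admissible_measure \<mu>"
    and f_core: "\<And>n. f n \<in> core" and f_normalized: "\<And>n. \<Gamma> (f n) (f n) UNIV \<le> 1"
    and U_open: "\<And>n. open (U n)" and U_ne: "\<And>n. U n \<noteq> {}" and U_compact: "\<And>n. compact (closure (U n))"
    and U_Suc: "\<And>n. closure (U n) \<subseteq> U (Suc n)" and U_cover: "(\<Union>n. U n) = UNIV"
    and U_gap: "\<And>n. emeasure \<mu> (U (Suc n) - closure (U n)) > 0"
begin

definition shell where "shell k = U (Suc k) - U k"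
abbreviation m where "m \<equiv> energy_reference_measure \<mu> \<Gamma> f U"

lemma radon: "radon_measure \<mu>" using admissible by (simp add: admissible_measure_def)

lemma U_sets: "U n \<in> sets \<mu>" using U_open by (simp add: borel_sets)
lemma shell_sets: "shell n \<in> sets \<mu>" using U_sets by (auto simp: shell_def)

lemma U_finite: "emeasure \<mu> (U n) < \<infinity>"
proof -
  have "emeasure \<mu> (U n) \<le> emeasure \<mu> (closure (U n))"
    using closure_subset by (intro emeasure_mono) (auto simp: borel_sets)
  also have "\<dots> < \<infinity>" using radon U_compact unfolding radon_measure_def by blast
  finally show ?thesis .
qed

lemma U0_pos: "0 < emeasure \<mu> (U 0)"
  using admissible U_open U_ne by (simp add: admissible_measure_def)

lemma shell_pos: "0 < emeasure \<mu> (shell k)"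
proof -
  have "emeasure \<mu> (U (Suc k) - closure (U k)) \<le> emeasure \<mu> (shell k)"
    using shell_sets closure_subset by (intro emeasure_mono) (auto simp: shell_def)
  then show ?thesis using U_gap[of k] by (meson less_le_trans)
qed

lemma shell_finite: "emeasure \<mu> (shell k) < \<infinity>"
proof -
  have "emeasure \<mu> (shell k) \<le> emeasure \<mu> (U (Suc k))" using U_sets by (intro emeasure_mono) (auto simp: shell_def)
  then show ?thesis using U_finite[of "Suc k"] by (meson le_less_trans)
qed

lemma m_sets: "sets m = sets borel"
  by (simp add: energy_reference_measure_def sets.sigma_sets_eq[of borel, simplified])

lemma emeasure_m:
  assumes A: "A \<in> sets borel"
  shows "emeasure m A = (\<Sum>n. ennreal ((1 / 2) ^ n * \<Gamma> (f n) (f n) A))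
        + (\<Sum>k. ennreal ((1 / 2) ^ k) * (emeasure \<mu> (A \<inter> shell k) / emeasure \<mu> (shell k)))
        + emeasure \<mu> (A \<inter> U 0) / emeasure \<mu> (U 0)"
proof (rule emeasure_measure_of[OF energy_reference_measure_def[of \<mu> \<Gamma> f U, folded shell_def]])
  show "sets borel \<subseteq> Pow UNIV" by simp
  have "\<Gamma> (f n) (f n) {} = 0" for n
    using energy_measure_sums[OF f_core f_core, of "\<lambda>_. {}" n n]
      summable_LIMSEQ_zero[OF sums_summable, of "\<lambda>_. \<Gamma> (f n) (f n) {}"]
    by (auto simp: disjoint_family_on_def LIMSEQ_const_iff)
  then show "positive (sets m) (\<lambda>A. (\<Sum>n. ennreal ((1 / 2) ^ n * \<Gamma> (f n) (f n) A))
        + (\<Sum>k. ennreal ((1 / 2) ^ k) * (emeasure \<mu> (A \<inter> shell k) / emeasure \<mu> (shell k)))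
        + emeasure \<mu> (A \<inter> U 0) / emeasure \<mu> (U 0))"
    by (simp add: positive_def)
  have 1: "countably_additive (sets \<mu>) (\<lambda>A. ennreal ((1 / 2) ^ n * \<Gamma> (f n) (f n) A))" for n
  proof (rule countably_additiveI)
    fix A :: "nat \<Rightarrow> 'a set"
    assume "range A \<subseteq> sets \<mu>" "disjoint_family A"
    then have A: "range A \<subseteq> sets borel" "disjoint_family A" by (auto simp: borel_sets)
    have "(\<lambda>i. (1 / 2) ^ n * \<Gamma> (f n) (f n) (A i)) sums ((1 / 2) ^ n * \<Gamma> (f n) (f n) (\<Union>i. A i))"
      by (intro sums_mult energy_measure_sums f_core A)
    moreover have "0 \<le> (1 / 2) ^ n * \<Gamma> (f n) (f n) (A i)" for i
      using A(1) by (intro mult_nonneg_nonneg energy_measure_nonneg f_core) auto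
    ultimately show "(\<Sum>i. ennreal ((1 / 2) ^ n * \<Gamma> (f n) (f n) (A i))) = ennreal ((1 / 2) ^ n * \<Gamma> (f n) (f n) (\<Union>i. A i))"
      by (intro suminf_ennreal_eq)
  qed
  have 3: "countably_additive (sets \<mu>) (\<lambda>A. emeasure \<mu> (A \<inter> U 0) / emeasure \<mu> (U 0))"
    using countably_additive_restrict[OF U_sets, of 1] by simp
  show "countably_additive (sets m) (\<lambda>A. (\<Sum>n. ennreal ((1 / 2) ^ n * \<Gamma> (f n) (f n) A))
        + (\<Sum>k. ennreal ((1 / 2) ^ k) * (emeasure \<mu> (A \<inter> shell k) / emeasure \<mu> (shell k)))
        + emeasure \<mu> (A \<inter> U 0) / emeasure \<mu> (U 0))"
    unfolding m_sets borel_sets[symmetric]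
    by (intro countably_additive_add countably_additive_suminf 1 3 countably_additive_restrict shell_sets)
  show "A \<in> sets m" using A by (simp add: m_sets)
qed

lemma energy_le_m:
  assumes A: "A \<in> sets borel"
  shows "ennreal ((1 / 2) ^ n * \<Gamma> (f n) (f n) A) \<le> emeasure m A"
proof -
  have "ennreal ((1 / 2) ^ n * \<Gamma> (f n) (f n) A) \<le> (\<Sum>n. ennreal ((1 / 2) ^ n * \<Gamma> (f n) (f n) A))"
    using sum_le_suminf[of "\<lambda>n. ennreal ((1 / 2) ^ n * \<Gamma> (f n) (f n) A)" "{n}"] by (simp add: summableI)
  also have "\<dots> \<le> emeasure m A" unfolding emeasure_m[OF A] add.assoc by simp
  finally show ?thesis .
qed

text \<open>
  This equivalence reduces positivity on open sets, null sets of capacity zero and inner regularity of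
  \<open>m\<close> to the corresponding facts about \<open>\<mu>\<close> and the \<open>\<Gamma>(f\<^sub>n, f\<^sub>n)\<close>.
\<close>

lemma null_m_iff:
  assumes A: "A \<in> sets borel"
  shows "emeasure m A = 0 \<longleftrightarrow> (\<forall>n. \<Gamma> (f n) (f n) A = 0) \<and> emeasure \<mu> A = 0"
proof
  assume 0: "emeasure m A = 0"
  have "\<Gamma> (f n) (f n) A = 0" for n
  proof -
    have "(1 / 2) ^ n * \<Gamma> (f n) (f n) A \<le> 0"
      using energy_le_m[OF A, of n] 0 by (simp add: ennreal_eq_0_iff)
    moreover have "0 < (1 / 2 :: real) ^ n" by simp
    ultimately have "\<Gamma> (f n) (f n) A \<le> 0" by (simp only: mult_le_0_iff) linarith
    then show ?thesis using energy_measure_nonneg[OF f_core A, of n] by simp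
  qed
  moreover have "emeasure \<mu> A = 0"
  proof -
    from 0 have z: "(\<Sum>k. ennreal ((1 / 2) ^ k) * (emeasure \<mu> (A \<inter> shell k) / emeasure \<mu> (shell k))) = 0"
      "emeasure \<mu> (A \<inter> U 0) / emeasure \<mu> (U 0) = 0"
      unfolding emeasure_m[OF A] by auto
    have "emeasure \<mu> (A \<inter> shell k) = 0" for k
    proof -
      have "0 < (1 / 2 :: real) ^ k" by simp
      moreover have "ennreal ((1 / 2) ^ k) * (emeasure \<mu> (A \<inter> shell k) / emeasure \<mu> (shell k)) = 0"
        using z(1) by (simp add: suminf_eq_zero_iff[OF summableI])
      ultimately show ?thesis using shell_finite[of k]
        by (auto simp: ennreal_divide_eq_0_iff ennreal_eq_0_iff simp del: zero_less_power)
    qed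
    moreover have "emeasure \<mu> (A \<inter> U 0) = 0"
      using z(2) U_finite[of 0] by (auto simp: ennreal_divide_eq_0_iff)
    moreover have AM: "A \<in> sets \<mu>" using A by (simp add: borel_sets)
    ultimately have "(A \<inter> U 0) \<union> (\<Union>k. A \<inter> shell k) \<in> null_sets \<mu>"
      using U_sets shell_sets by (intro null_sets.Un null_sets_UN null_setsI) auto
    moreover have "A = (A \<inter> U 0) \<union> (\<Union>k. A \<inter> shell k)"
    proof -
      have "x \<in> U 0 \<or> (\<exists>k. x \<in> shell k)" for x
      proof -
        obtain n where "x \<in> U n" using U_cover by (metis UNIV_I UN_E)
        then show ?thesis by (induction n) (auto simp: shell_def)
      qed
      then show ?thesis by blast
    qed
    ultimately show ?thesis by auto
  qed
  ultimately show "(\<forall>n. \<Gamma> (f n) (f n) A = 0) \<and> emeasure \<mu> A = 0" by blast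
next
  assume 0: "(\<forall>n. \<Gamma> (f n) (f n) A = 0) \<and> emeasure \<mu> A = 0"
  have "emeasure \<mu> (A \<inter> B) = 0" for B
    using 0 emeasure_mono[of "A \<inter> B" A \<mu>] A by (simp add: borel_sets)
  then show "emeasure m A = 0" unfolding emeasure_m[OF A] using 0 by simp
qed

lemma finite_m: "finite_measure m"
proof (rule finite_measureI)
  have UNIV_b: "UNIV \<in> sets (borel :: 'a measure)" by simp
  have half: "(\<lambda>k. (1 / 2 :: real) ^ k) sums 2" using geometric_sums[of "1 / 2 :: real"] by simp
  have geo: "(\<Sum>k. ennreal ((1 / 2) ^ k)) = ennreal 2"
    by (rule suminf_ennreal_eq[OF _ half]) simp
  have "emeasure m UNIV \<le> (\<Sum>n. ennreal ((1 / 2) ^ n)) + (\<Sum>k. ennreal ((1 / 2) ^ k)) + 1"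
    unfolding emeasure_m[OF UNIV_b]
  proof (intro add_mono suminf_le summableI)
    fix n
    show "ennreal ((1 / 2) ^ n * \<Gamma> (f n) (f n) UNIV) \<le> ennreal ((1 / 2) ^ n)"
      using f_normalized[of n] by (intro ennreal_leI) simp
    show "ennreal ((1 / 2) ^ n) * (emeasure \<mu> (UNIV \<inter> shell n) / emeasure \<mu> (shell n)) \<le> ennreal ((1 / 2) ^ n)"
      using shell_pos[of n] shell_finite[of n] by (simp add: ennreal_divide_self)
    show "emeasure \<mu> (UNIV \<inter> U 0) / emeasure \<mu> (U 0) \<le> 1"
      using U0_pos U_finite[of 0] by (simp add: ennreal_divide_self)
  qed
  also have "\<dots> < \<infinity>" unfolding geo by simp
  finally have "emeasure m UNIV < \<infinity>" .
  moreover have "space m = UNIV" using sets_eq_imp_space_eq[OF m_sets] by simp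
  ultimately show "emeasure m (space m) \<noteq> \<infinity>" by simp
qed

lemma \<mu>_sigma_compact:
  assumes A: "A \<in> sets borel"
  shows "\<exists>H :: nat \<Rightarrow> 'a set. (\<forall>j. compact (H j) \<and> H j \<subseteq> A) \<and> emeasure \<mu> (A - (\<Union>j. H j)) = 0"
proof -
  have "\<exists>H :: nat \<Rightarrow> 'a set. (\<forall>j. compact (H j) \<and> H j \<subseteq> A \<inter> U k) \<and> emeasure \<mu> (A \<inter> U k - (\<Union>j. H j)) = 0" for k
  proof -
    have "A \<inter> U k \<in> sets borel" using A U_open by simp
    moreover have "emeasure \<mu> (A \<inter> U k) < \<infinity>"
      using emeasure_mono[of "A \<inter> U k" "U k" \<mu>] U_sets U_finite[of k] by (auto intro: le_less_trans)
    ultimately show ?thesis using radon_sigma_compact[OF radon] by metis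
  qed
  then have "\<forall>k. \<exists>H :: nat \<Rightarrow> 'a set.
      (\<forall>j. compact (H j) \<and> H j \<subseteq> A \<inter> U k) \<and> emeasure \<mu> (A \<inter> U k - (\<Union>j. H j)) = 0" by (rule allI)
  then obtain H :: "nat \<Rightarrow> nat \<Rightarrow> 'a set"
    where "\<forall>k. (\<forall>j. compact (H k j) \<and> H k j \<subseteq> A \<inter> U k) \<and> emeasure \<mu> (A \<inter> U k - (\<Union>j. H k j)) = 0"
    by (rule choice[THEN exE])
  then have H: "compact (H k j)" "H k j \<subseteq> A \<inter> U k" "emeasure \<mu> (A \<inter> U k - (\<Union>j. H k j)) = 0" for k j
    by simp_all
  have HA: "H k j \<subseteq> A" for k j using H(2)[of k j] by blast
  obtain K :: "nat \<Rightarrow> 'a set"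
    where KH: "(\<forall>i. compact (K i) \<and> K i \<subseteq> A) \<and> (\<Union>i. K i) = (\<Union>k j. H k j)"
    using compact_exhaustion_sequence[of H A, OF H(1) HA] by (rule exE)
  have K: "compact (K i)" "K i \<subseteq> A" for i using KH by simp_all
  have KU: "(\<Union>i. K i) = (\<Union>k j. H k j)" using KH by (rule conjunct2)
  have Hm: "H k j \<in> sets \<mu>" for k j using borel_compact[OF H(1)] by (simp add: borel_sets)
  have AM: "A \<in> sets \<mu>" using A by (simp add: borel_sets)
  have null: "(\<Union>k. A \<inter> U k - (\<Union>j. H k j)) \<in> null_sets \<mu>"
    using H(3) Hm AM U_sets by (intro null_sets_UN null_setsI) auto
  have "emeasure \<mu> (A - (\<Union>i. K i)) = 0"
  proof (rule emeasure_eq_0[OF _ null_setsD1[OF null]])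
    show "(\<Union>k. A \<inter> U k - (\<Union>j. H k j)) \<in> sets \<mu>" using Hm AM U_sets by auto
    show "A - (\<Union>i. K i) \<subseteq> (\<Union>k. A \<inter> U k - (\<Union>j. H k j))"
    proof
      fix x assume x: "x \<in> A - (\<Union>i. K i)"
      obtain k where "x \<in> U k" using U_cover by (metis UNIV_I UN_E)
      then show "x \<in> (\<Union>k. A \<inter> U k - (\<Union>j. H k j))" using x unfolding KU by auto
    qed
  qed
  then show ?thesis using K(1,2) by blast
qed

lemma radon_m: "radon_measure m"
proof (rule finite_radonI[OF finite_m m_sets])
  fix A :: "'a set" assume A: "A \<in> sets borel"
  obtain H0 :: "nat \<Rightarrow> 'a set" where H0: "\<And>j. compact (H0 j)" "\<And>j. H0 j \<subseteq> A" "emeasure \<mu> (A - (\<Union>j. H0 j)) = 0"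
    using \<mu>_sigma_compact[OF A] by blast
  have "\<forall>n. \<exists>H :: nat \<Rightarrow> 'a set. (\<forall>j. compact (H j) \<and> H j \<subseteq> A) \<and> \<Gamma> (f n) (f n) (A - (\<Union>j. H j)) = 0"
    by (rule allI, rule energy_measure_sigma_compact[OF f_core A])
  then obtain H1 :: "nat \<Rightarrow> nat \<Rightarrow> 'a set"
    where "\<forall>n. (\<forall>j. compact (H1 n j) \<and> H1 n j \<subseteq> A) \<and> \<Gamma> (f n) (f n) (A - (\<Union>j. H1 n j)) = 0"
    by (rule choice[THEN exE])
  then have H1: "compact (H1 n j)" "H1 n j \<subseteq> A" "\<Gamma> (f n) (f n) (A - (\<Union>j. H1 n j)) = 0" for n j
    by simp_all
  define H where "H n = (case n of 0 \<Rightarrow> H0 | Suc k \<Rightarrow> H1 k)" for n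
  have H: "compact (H n j)" "H n j \<subseteq> A" for n j using H0 H1 by (simp_all add: H_def split: nat.split)
  obtain K :: "nat \<Rightarrow> 'a set"
    where KH: "(\<forall>i. compact (K i) \<and> K i \<subseteq> A) \<and> (\<Union>i. K i) = (\<Union>n j. H n j)"
    using compact_exhaustion_sequence[of H A, OF H] by (rule exE)
  have K: "compact (K i)" "K i \<subseteq> A" for i using KH by simp_all
  have KU: "(\<Union>i. K i) = (\<Union>n j. H n j)" using KH by (rule conjunct2)
  have sub: "(\<Union>j. H n j) \<subseteq> (\<Union>i. K i)" for n unfolding KU by blast
  have b: "A - (\<Union>i. K i) \<in> sets borel" using A borel_compact[OF K(1)] by auto
  have "emeasure \<mu> (A - (\<Union>i. K i)) = 0"
  proof (rule emeasure_eq_0[OF _ H0(3)])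
    show "A - (\<Union>j. H0 j) \<in> sets \<mu>" using A borel_compact[OF H0(1)] by (auto simp: borel_sets)
    show "A - (\<Union>i. K i) \<subseteq> A - (\<Union>j. H0 j)" using sub[of 0] by (auto simp: H_def)
  qed
  moreover have "\<Gamma> (f n) (f n) (A - (\<Union>i. K i)) = 0" for n
  proof (rule antisym)
    have c: "A - (\<Union>j. H1 n j) \<in> sets borel" using A borel_compact[OF H1(1)] by auto
    have "A - (\<Union>i. K i) \<subseteq> A - (\<Union>j. H1 n j)" using sub[of "Suc n"] by (auto simp: H_def)
    then have "\<Gamma> (f n) (f n) (A - (\<Union>i. K i)) \<le> \<Gamma> (f n) (f n) (A - (\<Union>j. H1 n j))"
      by (rule energy_measure_mono[OF f_core b c])
    then show "\<Gamma> (f n) (f n) (A - (\<Union>i. K i)) \<le> 0" using H1(3) by simp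
  qed (rule energy_measure_nonneg[OF f_core b])
  ultimately show "\<exists>H :: nat \<Rightarrow> 'a set. (\<forall>j. compact (H j) \<and> H j \<subseteq> A) \<and> emeasure m (A - (\<Union>j. H j)) = 0"
    using K null_m_iff[OF b] by (intro exI[of _ K]) simp
qed

lemma admissible_m: "admissible_measure m"
  unfolding admissible_measure_def
proof (intro conjI allI impI radon_m)
  fix V :: "'a set" assume V: "open V \<and> V \<noteq> {}"
  then have "emeasure \<mu> V \<noteq> 0" using admissible unfolding admissible_measure_def by force
  then have "emeasure m V \<noteq> 0" using null_m_iff[of V] V by auto
  then show "0 < emeasure m V" by (simp add: zero_less_iff_neq_zero)
qed

lemma capacity_null: "A \<in> sets borel \<Longrightarrow> capacity \<mu> E F A = 0 \<Longrightarrow> emeasure m A = 0"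
  using null_m_iff[of A] energy_measure_capacity_zero[OF f_core] emeasure_le_capacity[of A] by simp

lemma density_exists:
  "\<exists>d. is_density m (\<Gamma> (f i) (f j)) d \<and> (\<exists>c. AE x in m. \<bar>d x\<bar> \<le> c)"
proof -
  define c where "c = sqrt (2 ^ i) * sqrt (2 ^ j :: real)"
  have le: "\<Gamma> (f n) (f n) A \<le> 2 ^ n * measure m A" if "A \<in> sets borel" for n A
  proof -
    have "emeasure m A = ennreal (measure m A)"
      by (rule finite_measure.emeasure_eq_measure[OF finite_m])
    then have "(1 / 2) ^ n * \<Gamma> (f n) (f n) A \<le> measure m A"
      using energy_le_m[OF that, of n] by (simp add: ennreal_le_iff)
    then show ?thesis by (simp add: field_simps)
  qed
  have "\<exists>d. integrable m d \<and> (\<forall>A\<in>sets m. \<Gamma> (f i) (f j) A = set_lebesgue_integral m A d) \<and> (AE x in m. \<bar>d x\<bar> \<le> c)"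
  proof (rule bounded_set_function_density[OF finite_m])
    show "(\<lambda>k. \<Gamma> (f i) (f j) (A k)) sums \<Gamma> (f i) (f j) (\<Union>k. A k)"
      if "range A \<subseteq> sets m" "disjoint_family A" for A :: "nat \<Rightarrow> 'a set"
      using that by (intro energy_measure_sums f_core) (auto simp: m_sets)
    show "\<bar>\<Gamma> (f i) (f j) A\<bar> \<le> c * measure m A" if "A \<in> sets m" for A
    proof -
      have A: "A \<in> sets borel" using that m_sets by simp
      interpret G: semi_inner core "\<lambda>g h. \<Gamma> g h A" using A by (rule semi_inner_energy_measure)
      have "\<bar>\<Gamma> (f i) (f j) A\<bar> \<le> sqrt (\<Gamma> (f i) (f i) A) * sqrt (\<Gamma> (f j) (f j) A)"
        by (intro G.cauchy_schwarz_abs f_core)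
      also have "\<dots> \<le> sqrt (2 ^ i * measure m A) * sqrt (2 ^ j * measure m A)"
        using le[OF A] energy_measure_nonneg[OF f_core A] by (intro mult_mono real_sqrt_le_mono) auto
      also have "\<dots> = c * measure m A" unfolding c_def by (simp add: real_sqrt_mult)
      finally show ?thesis .
    qed
  qed
  then show ?thesis by (auto simp: is_density_def m_sets)
qed

end

section \<open>Cylinder functions\<close>

text \<open>
  The mean value theorem is applied to one coordinate at a time, replacing the coordinates of \<open>x\<close> by
  those of \<open>y\<close> successively.
\<close>

lemma Cb1_lipschitz:
  assumes G: "G \<in> Cb1 k"
  shows "\<exists>M\<ge>0. \<forall>x y. \<bar>G x - G y\<bar> \<le> M * (\<Sum>i<k. \<bar>x i - y i\<bar>)"
proof -
  have first_coords: "G x = G y" if "\<forall>j<k. x j = y j" for x y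
    using G that unfolding Cb1_def by blast
  obtain D where "\<forall>i<k. continuous_on UNIV (D i) \<and> bounded (range (D i))
      \<and> (\<forall>x. ((\<lambda>t. G (x(i := t))) has_real_derivative D i x) (at (x i)))"
    using G unfolding Cb1_def by blast
  then have D: "bounded (range (D i))" "((\<lambda>t. G (x(i := t))) has_real_derivative D i x) (at (x i))"
    if "i < k" for i x using that by simp_all
  have "\<exists>B. \<forall>x. \<bar>D i x\<bar> \<le> B" if "i < k" for i using D(1)[OF that] unfolding bounded_real by auto
  then obtain B where B: "\<And>i x. i < k \<Longrightarrow> \<bar>D i x\<bar> \<le> B i" by metis
  define M where "M = (\<Sum>i<k. \<bar>B i\<bar>)"
  have BM: "\<bar>D i x\<bar> \<le> M" if "i < k" for i x
  proof -
    have "\<bar>D i x\<bar> \<le> \<bar>B i\<bar>" using B[OF that, of x] by linarith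
    also have "\<dots> \<le> M" unfolding M_def using that by (intro member_le_sum) auto
    finally show ?thesis .
  qed
  have M: "0 \<le> M" unfolding M_def by (intro sum_nonneg) auto
  have coord: "\<bar>G (z(i := s)) - G (z(i := t))\<bar> \<le> M * \<bar>s - t\<bar>" if i: "i < k" for i s t and z :: "nat \<Rightarrow> real"
  proof -
    have "norm (G (z(i := s)) - G (z(i := t))) \<le> M * norm (s - t)"
    proof (rule field_differentiable_bound[where S = UNIV and f' = "\<lambda>r. D i (z(i := r))"])
      fix r show "((\<lambda>r. G (z(i := r))) has_real_derivative D i (z(i := r))) (at r within UNIV)"
        using D(2)[OF i, of "z(i := r)"] by simp
      show "norm (D i (z(i := r))) \<le> M" using BM[OF i] by simp
    qed auto
    then show ?thesis by simp
  qed
  have "\<bar>G x - G y\<bar> \<le> M * (\<Sum>i<k. \<bar>x i - y i\<bar>)" for x y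
  proof -
    define z where "z n j = (if j < n then y j else x j)" for n j
    have "\<bar>G x - G (z n)\<bar> \<le> M * (\<Sum>i<n. \<bar>x i - y i\<bar>)" if "n \<le> k" for n
      using that
    proof (induction n)
      case 0
      have "z 0 = x" by (auto simp: z_def)
      then show ?case by simp
    next
      case (Suc n)
      have "z n = (z n)(n := x n)" "z (Suc n) = (z n)(n := y n)" by (auto simp: z_def less_Suc_eq)
      then have "\<bar>G (z n) - G (z (Suc n))\<bar> \<le> M * \<bar>x n - y n\<bar>" using coord[of n "z n" "x n" "y n"] Suc.prems by simp
      moreover have "\<bar>G x - G (z n)\<bar> \<le> M * (\<Sum>i<n. \<bar>x i - y i\<bar>)" using Suc by simp
      ultimately show ?case by (simp add: distrib_left)
    qed
    moreover have "G (z k) = G y" by (rule first_coords) (simp add: z_def)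
    ultimately show ?thesis by (metis order_refl)
  qed
  then show ?thesis using M by blast
qed

context energy_space
begin

lemma cylinder_functions_core:
  assumes "\<Phi> \<subseteq> core" shows "cylinder_functions \<Phi> \<subseteq> core"
proof
  fix v assume "v \<in> cylinder_functions \<Phi>"
  then obtain k G \<phi> where v: "v = (\<lambda>x. G (\<lambda>j. \<phi> j x))" and G: "G \<in> Cb1 k" "G (\<lambda>j. 0) = 0"
    and \<phi>_mem: "\<forall>j<k. \<phi> j \<in> \<Phi>"
    unfolding cylinder_functions_def mem_Collect_eq by (elim exE conjE)
  from \<phi>_mem have \<phi>: "\<phi> j \<in> core" if "j < k" for j using assms that by blast
  obtain M where M: "0 \<le> M" "\<And>x y. \<bar>G x - G y\<bar> \<le> M * (\<Sum>i<k. \<bar>x i - y i\<bar>)"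
    using Cb1_lipschitz[OF G(1)] by blast
  have sq: "(G x - G y)\<^sup>2 \<le> M\<^sup>2 * k * (\<Sum>i<k. (x i - y i)\<^sup>2)" for x y
  proof -
    have "(G x - G y)\<^sup>2 \<le> (M * (\<Sum>i<k. \<bar>x i - y i\<bar>))\<^sup>2"
      using power_mono[OF M(2)[of x y] abs_ge_zero, of 2] by simp
    also have "\<dots> \<le> M\<^sup>2 * ((\<Sum>i<k. \<bar>x i - y i\<bar>\<^sup>2) * card {..<k})"
      unfolding power_mult_distrib by (intro mult_left_mono sum_squared_le_sum_of_squares) simp
    finally show ?thesis by (simp add: mult_ac)
  qed
  have cont: "continuous_on UNIV v"
  proof -
    have loc: "G x = G y" if "\<forall>j<k. x j = y j" for x y using G(1) that unfolding Cb1_def by blast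
    \<comment> \<open>for \<open>j \<ge> k\<close> the function \<open>\<phi> j\<close> is arbitrary and is replaced by \<open>0\<close>\<close>
    have "continuous_on UNIV (\<lambda>x j. if j < k then \<phi> j x else 0)"
    proof (rule continuous_on_coordinatewise_then_product)
      fix j show "continuous_on UNIV (\<lambda>x. if j < k then \<phi> j x else 0)"
        using \<phi>[of j] by (cases "j < k") (auto intro: C0_space_continuous)
    qed
    moreover have "continuous_on UNIV G" using G(1) unfolding Cb1_def by blast
    ultimately have "continuous_on UNIV (\<lambda>x. G (\<lambda>j. if j < k then \<phi> j x else 0))"
      using continuous_on_compose2[OF _ _ subset_UNIV] by blast
    also have "(\<lambda>x. G (\<lambda>j. if j < k then \<phi> j x else 0)) = v" unfolding v by (intro ext loc) simp
    finally show ?thesis .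
  qed
  have kill: "(v x)\<^sup>2 \<le> M\<^sup>2 * k * (\<Sum>i<k. (\<phi> i x)\<^sup>2)" for x using sq[of "\<lambda>j. \<phi> j x" "\<lambda>j. 0"] G(2) by (simp add: v)
  have "v \<in> F"
  proof (rule lipschitz_contraction(1)[OF _ _ continuous_measurable[OF cont] _ kill])
    show "(v x - v y)\<^sup>2 \<le> M\<^sup>2 * k * (\<Sum>i<k. (\<phi> i x - \<phi> i y)\<^sup>2)" for x y
      using sq[of "\<lambda>j. \<phi> j x" "\<lambda>j. \<phi> j y"] by (simp add: v)
  qed (use \<phi> in auto)
  moreover have "v \<in> C0_space"
  proof (rule C0_spaceI[OF cont])
    show "compact (\<Union>i<k. closure {x. \<phi> i x \<noteq> 0})" using \<phi> by (auto intro!: compact_UN C0_space_support)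
    show "{x. v x \<noteq> 0} \<subseteq> (\<Union>i<k. closure {x. \<phi> i x \<noteq> 0})"
    proof
      fix x assume x: "x \<in> {x. v x \<noteq> 0}"
      have "\<exists>i<k. \<phi> i x \<noteq> 0"
      proof (rule ccontr)
        assume "\<not> (\<exists>i<k. \<phi> i x \<noteq> 0)"
        then have "(v x)\<^sup>2 \<le> 0" using kill[of x] by simp
        then show False using x by simp
      qed
      then obtain i where "i < k" "x \<in> {x. \<phi> i x \<noteq> 0}" by auto
      then show "x \<in> (\<Union>i<k. closure {x. \<phi> i x \<noteq> 0})" using closure_subset[of "{x. \<phi> i x \<noteq> 0}"] by auto
    qed
  qed
  ultimately show "v \<in> core" by simp
qed

end

text \<open>
  Near \<open>0\<close> the function \<open>sin s - s\<close> vanishes to higher than first order, so it can be glued to \<open>0\<close> at the origin,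
  and the identity plus it stays bounded for positive \<open>s\<close>.
\<close>

lemma sin_minus_id_glued:
  fixes \<rho> :: "real \<Rightarrow> real"
  defines "\<rho> \<equiv> \<lambda>s. if s \<le> 0 then 0 else sin s - s"
  shows "(\<rho> has_real_derivative (cos (max s 0) - 1)) (at s)"
proof -
  have smooth: "((\<lambda>s. sin s - s) has_real_derivative (cos s - 1)) (at s)" for s :: real
    by (auto intro!: derivative_eq_intros)
  consider "s < 0" | "s = 0" | "0 < s" by linarith
  then show ?thesis
  proof cases
    case 1
    have "((\<lambda>s. 0 :: real) has_real_derivative 0) (at s)" by simp
    then have "(\<rho> has_real_derivative 0) (at s)"
      by (rule has_field_derivative_transform_within_open[of _ _ _ "{..<0}"]) (use 1 in \<open>auto simp: \<rho>_def\<close>)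
    then show ?thesis using 1 by simp
  next
    case 3
    have "(\<rho> has_real_derivative (cos s - 1)) (at s)"
      by (rule has_field_derivative_transform_within_open[of "\<lambda>s. sin s - s" _ _ "{0<..}", OF smooth]) (use 3 in \<open>auto simp: \<rho>_def\<close>)
    then show ?thesis using 3 by simp
  next
    case 2
    have "(\<lambda>h :: real. (sin h - h) / h) \<midarrow>0\<rightarrow> 0" using smooth[of 0] by (simp add: DERIV_def)
    note lim = tendsto_norm_zero[OF this]
    have le: "norm (\<rho> h / h) \<le> norm ((sin h - h) / h)" for h
    proof (cases "h \<le> 0")
      case True
      then have "norm (\<rho> h / h) = 0" by (simp add: \<rho>_def)
      then show ?thesis using norm_ge_zero by (rule ord_eq_le_trans)
    qed (simp add: \<rho>_def)
    have "(\<lambda>h. \<rho> h / h) \<midarrow>0\<rightarrow> 0"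
      by (rule Lim_null_comparison[OF _ lim]) (intro always_eventually allI le)
    moreover have "\<rho> 0 = 0" by (simp add: \<rho>_def)
    ultimately have "(\<rho> has_real_derivative 0) (at 0)" by (simp add: DERIV_def)
    then show ?thesis using 2 by simp
  qed
qed

text \<open>
  Outside \<open>[- M, M]\<close> the identity is bent into a sine wave of amplitude \<open>1\<close> around \<open>M\<close> or \<open>- M\<close>.
\<close>

lemma smooth_truncation:
  fixes M :: real
  assumes M: "0 \<le> M"
  obtains \<tau> \<tau>' :: "real \<Rightarrow> real"
  where "\<And>t. (\<tau> has_real_derivative \<tau>' t) (at t)" "continuous_on UNIV \<tau>'" "bounded (range \<tau>)" "bounded (range \<tau>')"
    "\<And>t. \<bar>t\<bar> \<le> M \<Longrightarrow> \<tau> t = t"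
proof -
  define \<rho> :: "real \<Rightarrow> real" where "\<rho> = (\<lambda>s. if s \<le> 0 then 0 else sin s - s)"
  define \<tau> where "\<tau> t = t + \<rho> (t - M) - \<rho> (- t - M)" for t
  define \<tau>' where "\<tau>' t = 1 + (cos (max (t - M) 0) - 1) + (cos (max (- t - M) 0) - 1)" for t :: real
  note \<rho> = sin_minus_id_glued[folded \<rho>_def]
  show thesis
  proof (rule that[of \<tau> \<tau>'])
    show "(\<tau> has_real_derivative \<tau>' t) (at t)" for t
      unfolding \<tau>_def[abs_def] \<tau>'_def by (auto intro!: derivative_eq_intros DERIV_chain2[OF \<rho>])
    show "continuous_on UNIV \<tau>'" unfolding \<tau>'_def[abs_def] by (intro continuous_intros)
    have "\<bar>\<tau> t\<bar> \<le> M + 1" for t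
      using M abs_sin_le_one[of "t - M"] abs_sin_le_one[of "- t - M"] unfolding \<tau>_def \<rho>_def
      by (auto simp del: abs_sin_le_one split: if_splits)
    then show "bounded (range \<tau>)" unfolding bounded_real by auto
    have "\<bar>\<tau>' t\<bar> \<le> 3" for t
      using abs_cos_le_one[of "max (t - M) 0"] abs_cos_le_one[of "max (- t - M) 0"]
      unfolding \<tau>'_def by linarith
    then show "bounded (range \<tau>')" unfolding bounded_real by auto
    show "\<tau> t = t" if "\<bar>t\<bar> \<le> M" for t using that unfolding \<tau>_def \<rho>_def by auto
  qed
qed

text \<open>
  Multiplication by \<open>s\<close> is not bounded on the line; bending it outside the range of \<open>g\<close> makes it so
  without changing the composition with \<open>g\<close>.
\<close>

lemma cylinder_functions_bounded_multiple:
  assumes "g \<in> \<Phi>" and bound: "\<And>x. \<bar>g x\<bar> \<le> M"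
  shows "(\<lambda>x. s * g x) \<in> cylinder_functions \<Phi>"
proof -
  obtain \<tau> \<tau>' :: "real \<Rightarrow> real"
    where \<tau>: "\<And>t. (\<tau> has_real_derivative \<tau>' t) (at t)" "continuous_on UNIV \<tau>'" "bounded (range \<tau>)" "bounded (range \<tau>')"
    "\<And>t. \<bar>t\<bar> \<le> \<bar>M\<bar> \<Longrightarrow> \<tau> t = t"
    using smooth_truncation[OF abs_ge_zero] by blast
  define G where "G y = s * \<tau> (y 0)" for y :: "nat \<Rightarrow> real"
  have \<tau>_cont: "continuous_on UNIV \<tau>"
    using DERIV_continuous_on[of UNIV \<tau> \<tau>'] \<tau>(1) by simp
  have comp: "continuous_on UNIV (\<lambda>y :: nat \<Rightarrow> real. s * h (y 0))" if "continuous_on UNIV h" for h :: "real \<Rightarrow> real"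
    by (rule continuous_on_mult[OF continuous_on_const
          continuous_on_compose2[OF that continuous_on_product_coordinates subset_UNIV]])
  have bd: "bounded (range (\<lambda>y :: nat \<Rightarrow> real. s * h (y 0)))" if h: "bounded (range h)" for h :: "real \<Rightarrow> real"
  proof -
    obtain B where B: "\<And>t. \<bar>h t\<bar> \<le> B" using h unfolding bounded_real by auto
    have "\<bar>s * h (y 0)\<bar> \<le> \<bar>s\<bar> * B" for y :: "nat \<Rightarrow> real"
      unfolding abs_mult using B by (intro mult_left_mono) auto
    then show ?thesis unfolding bounded_real by blast
  qed
  have "G \<in> Cb1 1"
    unfolding Cb1_def
  proof (intro CollectI conjI allI impI exI[of _ "\<lambda>i y. s * \<tau>' (y 0)"])
    show "continuous_on UNIV G" unfolding G_def[abs_def] by (rule comp[OF \<tau>_cont])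
    show "bounded (range G)" unfolding G_def[abs_def] by (rule bd[OF \<tau>(3)])
    show "continuous_on UNIV (\<lambda>y :: nat \<Rightarrow> real. s * \<tau>' (y 0))" by (rule comp[OF \<tau>(2)])
    show "bounded (range (\<lambda>y :: nat \<Rightarrow> real. s * \<tau>' (y 0)))" by (rule bd[OF \<tau>(4)])
    show "G x = G y" if "\<forall>j<1. x j = y j" for x y using that by (simp add: G_def)
    show "((\<lambda>t. G (x(i := t))) has_real_derivative s * \<tau>' (x 0)) (at (x i))" if "i < 1" for x i
      using DERIV_cmult[OF \<tau>(1)[of "x 0"], of s] that by (simp add: G_def)
  qed
  moreover have "G (\<lambda>j. 0) = 0" using \<tau>(5)[of 0] by (simp add: G_def)
  moreover have "(\<lambda>x. s * g x) = (\<lambda>x. G (\<lambda>j. g x))"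
  proof
    fix x
    have "\<bar>g x\<bar> \<le> \<bar>M\<bar>" using bound[of x] by linarith
    then show "s * g x = G (\<lambda>j. g x)" using \<tau>(5) by (simp add: G_def)
  qed
  ultimately show ?thesis
    unfolding cylinder_functions_def using assms(1)
    by (intro CollectI exI[of _ "1::nat"] exI[of _ G] exI[of _ "\<lambda>j. g"]) auto
qed

section \<open>Continuous coordinates\<close>

context dirichlet_space
begin

text \<open>
  A function \<open>g\<close> of zero energy is first replaced by \<open>g + t h\<close> with a small \<open>t\<close>; its energy is \<open>t\<^sup>2 E h h\<close>,
  since \<open>E g h = 0\<close> by the Cauchy-Schwarz inequality. Functions close enough to one of positive energy have
  positive energy.
\<close>

lemma positive_energy_dense:
  assumes g: "g \<in> F" and h: "h \<in> F" "0 < E h h" and "0 < \<epsilon>"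
    and e: "\<And>n::nat. e n \<in> F" "\<And>u \<epsilon>. u \<in> F \<Longrightarrow> 0 < \<epsilon> \<Longrightarrow> \<exists>n. E1 \<mu> E (\<lambda>x. e n x - u x) < \<epsilon>"
    and \<phi>: "\<And>n k::nat. \<phi> n k \<in> F" "\<And>n k. sqrt (E1 \<mu> E (\<lambda>x. e n x - \<phi> n k x)) \<le> (1 / 2) ^ k"
  shows "\<exists>n k. 0 < E (\<phi> n k) (\<phi> n k) \<and> E1 \<mu> E (\<lambda>x. g x - \<phi> n k x) < \<epsilon>"
proof -
  interpret S: semi_inner F "\<lambda>u v. E u v + 1 * ip u v" by (rule semi_inner_shifted) simp
  define d where "d u v = sqrt (E1 \<mu> E (\<lambda>x. u x - v x))" for u v :: "'a \<Rightarrow> real"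
  have d_sym: "d u v = d v u" if "u \<in> F" "v \<in> F" for u v
    unfolding d_def E1_eq using S.dist_commute[OF that] by simp
  have d_tri: "d u w \<le> d u v + d v w" if "u \<in> F" "v \<in> F" "w \<in> F" for u v w
    unfolding d_def E1_eq using S.triangle_diff[OF that] .
  have E_d: "sqrt (E u u) \<le> sqrt (E v v) + d u v" if "u \<in> F" "v \<in> F" for u v
  proof -
    have le: "sqrt (E u u) \<le> sqrt (E v v) + sqrt (qE (\<lambda>x. u x - v x))"
      using En.triangle[OF that(2) En.diff[OF that]] by simp
    have "qE (\<lambda>x. u x - v x) \<le> E1 \<mu> E (\<lambda>x. u x - v x)"
      using L2.b_nonneg[OF F_L2[OF En.diff[OF that]]] by (simp add: E1_eq)
    from real_sqrt_le_mono[OF this] show ?thesis using le unfolding d_def by linarith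
  qed
  have "\<exists>g'. g' \<in> F \<and> 0 < E g' g' \<and> d g g' < sqrt \<epsilon> / 4"
  proof (cases "0 < E g g")
    case True
    have "d g g = 0" unfolding d_def E1_eq using S.b_square_diff[OF g g] by simp
    then show ?thesis using g True \<open>0 < \<epsilon>\<close> by (intro exI[of _ g]) auto
  next
    case False
    then have Eg: "E g g = 0" using En.b_nonneg[OF g] by simp
    then have Egh: "E g h = 0" using En.cauchy_schwarz[OF g h(1)] by simp
    define N where "N = E h h + 1 * ip h h"
    have N: "0 < N" using h L2.b_nonneg[OF F_L2[OF h(1)]] by (simp add: N_def)
    define t where "t = sqrt \<epsilon> / (8 * sqrt N)"
    have t: "0 < t" using N \<open>0 < \<epsilon>\<close> by (simp add: t_def)
    let ?g' = "\<lambda>x. g x + t * h x"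
    have "?g' \<in> F" by (intro En.add En.scale g h)
    moreover have "E ?g' ?g' = t\<^sup>2 * E h h" using En.b_square_add[OF g h(1), of t] Eg Egh by simp
    moreover have "d g ?g' = t * sqrt N"
    proof -
      have "E1 \<mu> E (\<lambda>x. g x - ?g' x) = t\<^sup>2 * N"
        unfolding E1_eq N_def using S.b_scale[OF h(1) S.scale[OF h(1)], of "- t" "- t"] S.b_scale_right[OF h(1) h(1), of "- t"]
        by (simp add: power2_eq_square)
      then show ?thesis using t by (simp add: d_def real_sqrt_mult)
    qed
    moreover have "t * sqrt N < sqrt \<epsilon> / 4" using N \<open>0 < \<epsilon>\<close> by (simp add: t_def)
    ultimately show ?thesis using t h(2) by (intro exI[of _ ?g']) simp
  qed
  then obtain g' where g': "g' \<in> F" "0 < E g' g'" "d g g' < sqrt \<epsilon> / 4" by blast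
  define \<eta> where "\<eta> = min (sqrt \<epsilon> / 4) (sqrt (E g' g') / 4)"
  have \<eta>: "0 < \<eta>" "\<eta> \<le> sqrt \<epsilon> / 4" "\<eta> \<le> sqrt (E g' g') / 4" using g'(2) \<open>0 < \<epsilon>\<close> by (auto simp: \<eta>_def)
  obtain n where n: "E1 \<mu> E (\<lambda>x. e n x - g' x) < \<eta>\<^sup>2" using e(2)[OF g'(1), of "\<eta>\<^sup>2"] \<eta>(1) by auto
  have n': "d (e n) g' < \<eta>" unfolding d_def using real_sqrt_less_mono[OF n] \<eta>(1) by simp
  obtain k where k: "(1 / 2 :: real) ^ k < \<eta>" using real_arch_pow_inv[OF \<eta>(1), of "1 / 2"] by auto
  have "d (e n) (\<phi> n k) < \<eta>" using \<phi>(2)[of n k] k by (simp add: d_def)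
  then have close: "d g' (\<phi> n k) < 2 * \<eta>"
    using d_tri[OF g'(1) e(1)[of n] \<phi>(1)[of n k]] d_sym[OF g'(1) e(1)[of n]] n' by linarith
  have "0 < sqrt (E (\<phi> n k) (\<phi> n k))"
    using E_d[OF g'(1) \<phi>(1)[of n k]] close \<eta>(3) real_sqrt_gt_zero[OF g'(2)] by linarith
  moreover have "d g (\<phi> n k) < sqrt \<epsilon>" using d_tri[OF g g'(1) \<phi>(1)[of n k]] g'(3) close \<eta>(1,2) by linarith
  ultimately show ?thesis unfolding d_def by (intro exI[of _ n] exI[of _ k]) simp
qed

end

theorem theorem7p1:
  fixes \<mu> :: "'a::{metric_space, second_countable_topology} measure"
    and E :: "('a \<Rightarrow> real) \<Rightarrow> ('a \<Rightarrow> real) \<Rightarrow> real"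
    and F :: "('a \<Rightarrow> real) set"
    and \<Gamma> :: "('a \<Rightarrow> real) \<Rightarrow> ('a \<Rightarrow> real) \<Rightarrow> 'a set \<Rightarrow> real"
    and e :: "nat \<Rightarrow> 'a \<Rightarrow> real"
    and \<phi> :: "nat \<Rightarrow> nat \<Rightarrow> 'a \<Rightarrow> real"
    and \<psi> f :: "nat \<Rightarrow> 'a \<Rightarrow> real"
    and U :: "nat \<Rightarrow> 'a set"
  assumes locally_compact: "locally compact (UNIV :: 'a set)"
    and admissible: "admissible_measure \<mu>"
    and form: "dirichlet_form \<mu> E F" "regular_form \<mu> E F" "local_form \<mu> E F"
    and energy_measures: "\<forall>g\<in>C0_space \<inter> F. \<forall>h\<in>C0_space \<inter> F. is_energy_measure E F g h (\<Gamma> g h)"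
    and e_dense: "\<forall>n. e n \<in> F" "\<forall>u\<in>F. \<forall>\<epsilon>>0. \<exists>n. E1 \<mu> E (\<lambda>x. e n x - u x) < \<epsilon>"
    and \<phi>_approx: "\<forall>n k. \<phi> n k \<in> C0_space \<inter> F"
      "\<forall>n k. sqrt (E1 \<mu> E (\<lambda>x. e n x - \<phi> n k x)) \<le> (1 / 2) ^ k"
    and \<psi>_enum: "range \<psi> = {\<phi> n k | n k. E (\<phi> n k) (\<phi> n k) > 0}"
    and f_def: "f = (\<lambda>n x. \<psi> n x / sqrt (\<Gamma> (\<psi> n) (\<psi> n) UNIV))"
    and exhaustion: "\<forall>n. open (U n)" "\<forall>n. U n \<noteq> {}" "\<forall>n. compact (closure (U n))"
      "\<forall>n. closure (U n) \<subseteq> U (Suc n)" "(\<Union>n. U n) = UNIV"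
      "\<forall>n. emeasure \<mu> (U (Suc n) - closure (U n)) > 0"
  shows "continuous_coordinates \<mu> E F \<Gamma> (energy_reference_measure \<mu> \<Gamma> f U) (range f)"
proof -
  have "sets \<mu> = sets borel" using admissible by (simp add: admissible_measure_def radon_measure_def)
  then interpret energy_space \<mu> E F \<Gamma>
    using form locally_compact energy_measures by unfold_locales auto
  have \<psi>_mem: "\<exists>i k. \<psi> n = \<phi> i k \<and> 0 < E (\<phi> i k) (\<phi> i k)" for n
  proof -
    have "\<psi> n \<in> range \<psi>" by simp
    then show ?thesis unfolding \<psi>_enum by blast
  qed
  have \<psi>_core: "\<psi> n \<in> core" and \<psi>_pos: "0 < E (\<psi> n) (\<psi> n)" for n
    using \<psi>_mem[of n] \<phi>_approx(1) by auto
  define s where "s n = sqrt (\<Gamma> (\<psi> n) (\<psi> n) UNIV)" for n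
  have total: "0 < \<Gamma> (\<psi> n) (\<psi> n) UNIV" for n using energy_measure_total_ge[OF \<psi>_core, of n] \<psi>_pos[of n] by linarith
  then have s_pos: "0 < s n" for n by (simp add: s_def)
  have f_eq: "f n = (\<lambda>x. inverse (s n) * \<psi> n x)" for n by (simp add: f_def s_def divide_inverse mult.commute)
  have f_core: "f n \<in> core" for n unfolding f_eq by (rule core_scale[OF \<psi>_core])
  have f_energy: "\<Gamma> (f n) (f n) A = inverse (s n) * inverse (s n) * \<Gamma> (\<psi> n) (\<psi> n) A" if A: "A \<in> sets borel" for n A
  proof -
    interpret G: semi_inner core "\<lambda>g h. \<Gamma> g h A" using A by (rule semi_inner_energy_measure)
    show ?thesis unfolding f_eq
      using G.b_scale[OF \<psi>_core G.scale[OF \<psi>_core]] G.b_scale_right[OF \<psi>_core \<psi>_core] by simp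
  qed
  have "\<Gamma> (f n) (f n) UNIV = 1" for n
  proof -
    have "s n * s n = \<Gamma> (\<psi> n) (\<psi> n) UNIV" using total[of n] by (simp add: s_def)
    then show ?thesis using f_energy[of UNIV n] s_pos[of n] by (simp flip: \<open>s n * s n = _\<close> add: field_simps)
  qed
  then interpret reference_measure \<mu> E F \<Gamma> f U
    using admissible f_core exhaustion by unfold_locales auto
  have dense: "\<exists>n. E1 \<mu> E (\<lambda>x. g x - \<psi> n x) < \<epsilon>" if g: "g \<in> core" and "0 < \<epsilon>" for g \<epsilon>
  proof -
    have "\<exists>n k. 0 < E (\<phi> n k) (\<phi> n k) \<and> E1 \<mu> E (\<lambda>x. g x - \<phi> n k x) < \<epsilon>"
      by (rule positive_energy_dense[of g "\<psi> 0" \<epsilon> e \<phi>]) (use g \<psi>_core[of 0] \<psi>_pos \<open>0 < \<epsilon>\<close> e_dense \<phi>_approx in auto)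
    then obtain i k where ik: "0 < E (\<phi> i k) (\<phi> i k)" "E1 \<mu> E (\<lambda>x. g x - \<phi> i k x) < \<epsilon>" by blast
    then have "\<phi> i k \<in> range \<psi>" unfolding \<psi>_enum by blast
    then show ?thesis using ik(2) by auto
  qed
  have energy_null: "\<Gamma> g g A = 0" if g: "g \<in> core" and A: "A \<in> sets borel" and null: "emeasure m A = 0" for g A
  proof -
    interpret G: semi_inner core "\<lambda>g h. \<Gamma> g h A" using A by (rule semi_inner_energy_measure)
    have "\<Gamma> g g A \<le> 0 + \<epsilon>" if "0 < \<epsilon>" for \<epsilon>
    proof -
      obtain n where n: "E1 \<mu> E (\<lambda>x. g x - \<psi> n x) < \<epsilon> / 2" using dense[OF g, of "\<epsilon> / 2"] \<open>0 < \<epsilon>\<close> by auto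
      have d: "(\<lambda>x. g x - \<psi> n x) \<in> core" using g \<psi>_core by (rule G.diff)
      have "\<Gamma> (f n) (f n) A = 0" using null null_m_iff[OF A] by blast
      then have "\<Gamma> (\<psi> n) (\<psi> n) A = 0" using f_energy[OF A] s_pos[of n] by simp
      then have "\<Gamma> g g A \<le> 2 * \<Gamma> (\<lambda>x. g x - \<psi> n x) (\<lambda>x. g x - \<psi> n x) A"
        using G.square_add_le[OF \<psi>_core d, of n] by simp
      also have "\<dots> \<le> 2 * E (\<lambda>x. g x - \<psi> n x) (\<lambda>x. g x - \<psi> n x)" using energy_measure_le[OF d A] by simp
      also have "\<dots> \<le> 2 * E1 \<mu> E (\<lambda>x. g x - \<psi> n x)" by (simp add: E1_def)
      finally show ?thesis using n by simp
    qed
    then have "\<Gamma> g g A \<le> 0" by (rule field_le_epsilon)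
    then show ?thesis using energy_measure_nonneg[OF g A] by simp
  qed
  have cyl_dense: "\<exists>v\<in>cylinder_functions (range f). E1 \<mu> E (\<lambda>x. g x - v x) < \<epsilon>" if g: "g \<in> core" and \<epsilon>: "0 < \<epsilon>" for g \<epsilon>
  proof -
    obtain n where n: "E1 \<mu> E (\<lambda>x. g x - \<psi> n x) < \<epsilon>" using dense[OF g \<epsilon>] by blast
    obtain B where B: "\<And>x. \<bar>f n x\<bar> \<le> B" using core_bounded[OF f_core[of n]] by (auto simp: bounded_F_def)
    have "(\<lambda>x. s n * f n x) \<in> cylinder_functions (range f)"
      by (rule cylinder_functions_bounded_multiple[OF _ B]) simp
    moreover have "(\<lambda>x. s n * f n x) = \<psi> n" using s_pos[of n] by (simp add: f_eq mult.assoc[symmetric])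
    ultimately show ?thesis using n by metis
  qed
  show ?thesis
    unfolding continuous_coordinates_def
  proof (intro conjI ballI allI impI)
    show "cylinder_functions (range f) \<subseteq> core" using f_core by (intro cylinder_functions_core) auto
    fix u v assume "u \<in> range f" "v \<in> range f"
    then show "\<exists>d. is_density m (\<Gamma> u v) d \<and> (\<exists>c. AE x in m. \<bar>d x\<bar> \<le> c)" using density_exists by blast
  qed (use admissible_m energy_null finite_m capacity_null f_core cyl_dense in auto)
qed

end
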